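(* Let $(M,J,\omega)$ be a real-analytic Kähler manifold of real dimension $2n$. There exist a complex manifold $(X,I)$ of complex dimension $2n$ with a holomorphic symplectic form $\Omega$, and an inclusion (embedding) $\iota:M\hookrightarrow X$ such that $\iota^*\Omega=\omega$, with the following additional structure: (1) An anti-holomorphic involution $\tau:X\to X$ whose fixed point set is the image of $\iota$ and such that $\tau^*\Omega=\overline{\Omega}$. (2) A holomorphic projection $\Pi:(X,I)\to(M,J)$ with $\Pi\circ\iota=\mathrm{Id}_M$, whose fibers are holomorphic Lagrangian submanifolds of $(X,\Omega)$.
   Context: A holomorphic symplectic form on $(X,I)$ is a closed holomorphic $(2,0)$-form that is non-degenerate. A complex submanifold $L\subset X$ is holomorphic Lagrangian if $\dim_{\mathbb{C}}L=n$ and $\Omega|_L=0$. "Real-analytic Kähler" means that $\omega$ is real-analytic (with respect to the real-analytic structure underlying the complex structure $J$). *)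

theory Defs
  imports "HOL-Analysis.Analysis"
begin

section \<open>Function classes on open subsets of Euclidean space\<close>

text \<open>All predicates of this section are meant for open sets \<open>S\<close>.\<close>

definition holomorphic_fun :: "(complex ^ 'k::finite) set \<Rightarrow> (complex ^ 'k \<Rightarrow> complex) \<Rightarrow> bool" where
  "holomorphic_fun S f \<longleftrightarrow>
     (\<forall>z\<in>S. \<exists>D. (f has_derivative D) (at z) \<and> (\<forall>c v. D (c *s v) = c * D v))"

definition holomorphic_vec :: "(complex ^ 'k::finite) set \<Rightarrow> (complex ^ 'k \<Rightarrow> complex ^ 'l::finite) \<Rightarrow> bool" where
  "holomorphic_vec S f \<longleftrightarrow> (\<forall>i. holomorphic_fun S (\<lambda>z. f z $ i))"

definition antiholomorphic_vec :: "(complex ^ 'k::finite) set \<Rightarrow> (complex ^ 'k \<Rightarrow> complex ^ 'l::finite) \<Rightarrow> bool" where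
  "antiholomorphic_vec S f \<longleftrightarrow> (\<forall>i. holomorphic_fun S (\<lambda>z. cnj (f z $ i)))"

text \<open>\<open>k\<close> times differentiable with continuous \<open>k\<close>-th directional derivatives; on a
  finite-dimensional domain this is the class \<open>C\<^sup>k\<close>.\<close>

primrec C_k_on :: "nat \<Rightarrow> 'a::real_normed_vector set \<Rightarrow> ('a \<Rightarrow> 'b::real_normed_vector) \<Rightarrow> bool" where
  "C_k_on 0 S f \<longleftrightarrow> continuous_on S f"
| "C_k_on (Suc k) S f \<longleftrightarrow> (\<forall>x\<in>S. f differentiable (at x)) \<and>
     (\<forall>v. C_k_on k S (\<lambda>x. frechet_derivative f (at x) v))"

definition smooth_vec :: "'a::real_normed_vector set \<Rightarrow> ('a \<Rightarrow> 'b::real_normed_vector) \<Rightarrow> bool" where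
  "smooth_vec S f \<longleftrightarrow> (\<forall>k. C_k_on k S f)"

text \<open>Locally the sum of a power series in the real coordinates, indexed by the multi-indices
  \<open>\<alpha> : Basis \<rightarrow> nat\<close>.\<close>

definition real_analytic_fun :: "'a::euclidean_space set \<Rightarrow> ('a \<Rightarrow> real) \<Rightarrow> bool" where
  "real_analytic_fun S f \<longleftrightarrow>
     (\<forall>x\<in>S. \<exists>r>0. \<exists>a :: ('a \<Rightarrow> nat) \<Rightarrow> real. \<forall>y\<in>ball x r.
        ((\<lambda>\<alpha>. a \<alpha> * (\<Prod>b\<in>Basis. ((y - x) \<bullet> b) ^ \<alpha> b)) has_sum f y) (Basis \<rightarrow>\<^sub>E UNIV))"


section \<open>Complex manifolds\<close>

text \<open>A chart is its domain together with a coordinate map, of which only the values on the domain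
  matter. The complex dimension is \<open>CARD('k)\<close>.\<close>

type_synonym ('p, 'k) chart = "'p set \<times> ('p \<Rightarrow> complex ^ 'k)"

record ('p, 'k) manifold =
  topol :: "'p topology"
  atlas :: "('p, 'k) chart set"

abbreviation points :: "('p, 'k::finite) manifold \<Rightarrow> 'p set" where
  "points M \<equiv> topspace (topol M)"

definition chart_inv :: "('p, 'k::finite) chart \<Rightarrow> complex ^ 'k \<Rightarrow> 'p" where
  "chart_inv c = inv_into (fst c) (snd c)"

text \<open>The expression of a map \<open>F\<close> in a chart \<open>c\<close> of the source and a chart \<open>d\<close> of the target, and
  the set on which it is defined. For \<open>F = id\<close> this is the change of coordinates.\<close>

definition local_rep :: "('p, 'k::finite) chart \<Rightarrow> ('q, 'l::finite) chart \<Rightarrow> ('p \<Rightarrow> 'q)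
    \<Rightarrow> complex ^ 'k \<Rightarrow> complex ^ 'l" where
  "local_rep c d F = (\<lambda>z. snd d (F (chart_inv c z)))"

definition local_dom :: "('p, 'k::finite) chart \<Rightarrow> ('q, 'l::finite) chart \<Rightarrow> ('p \<Rightarrow> 'q)
    \<Rightarrow> (complex ^ 'k) set" where
  "local_dom c d F = snd c ` {p \<in> fst c. F p \<in> fst d}"

definition is_chart :: "'p topology \<Rightarrow> ('p, 'k::finite) chart \<Rightarrow> bool" where
  "is_chart X c \<longleftrightarrow> openin X (fst c) \<and> open (snd c ` fst c) \<and>
     homeomorphic_map (subtopology X (fst c)) (top_of_set (snd c ` fst c)) (snd c)"

definition compatible :: "('p, 'k::finite) chart \<Rightarrow> ('p, 'k) chart \<Rightarrow> bool" where
  "compatible c d \<longleftrightarrow> holomorphic_vec (local_dom c d id) (local_rep c d id) \<and>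
                      holomorphic_vec (local_dom d c id) (local_rep d c id)"

text \<open>The atlas is not required to be maximal; it determines the complex structure, whose
  charts are the \<open>holomorphic_charts\<close>.\<close>

definition complex_manifold :: "('p, 'k::finite) manifold \<Rightarrow> bool" where
  "complex_manifold M \<longleftrightarrow> Hausdorff_space (topol M) \<and> second_countable (topol M) \<and>
     (\<forall>c\<in>atlas M. is_chart (topol M) c) \<and> (\<Union>c\<in>atlas M. fst c) = points M \<and>
     (\<forall>c\<in>atlas M. \<forall>d\<in>atlas M. compatible c d)"

definition holomorphic_charts :: "('p, 'k::finite) manifold \<Rightarrow> ('p, 'k) chart set" where
  "holomorphic_charts M = {c. is_chart (topol M) c \<and> (\<forall>d\<in>atlas M. compatible c d)}"

definition holomorphic_map :: "('p, 'k::finite) manifold \<Rightarrow> ('q, 'l::finite) manifold \<Rightarrow> ('p \<Rightarrow> 'q) \<Rightarrow> bool" where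
  "holomorphic_map M N F \<longleftrightarrow> continuous_map (topol M) (topol N) F \<and>
     (\<forall>c\<in>atlas M. \<forall>d\<in>atlas N. holomorphic_vec (local_dom c d F) (local_rep c d F))"

definition antiholomorphic_map :: "('p, 'k::finite) manifold \<Rightarrow> ('q, 'l::finite) manifold \<Rightarrow> ('p \<Rightarrow> 'q) \<Rightarrow> bool" where
  "antiholomorphic_map M N F \<longleftrightarrow> continuous_map (topol M) (topol N) F \<and>
     (\<forall>c\<in>atlas M. \<forall>d\<in>atlas N. antiholomorphic_vec (local_dom c d F) (local_rep c d F))"

definition smooth_map :: "('p, 'k::finite) manifold \<Rightarrow> ('q, 'l::finite) manifold \<Rightarrow> ('p \<Rightarrow> 'q) \<Rightarrow> bool" where
  "smooth_map M N F \<longleftrightarrow> continuous_map (topol M) (topol N) F \<and>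
     (\<forall>c\<in>atlas M. \<forall>d\<in>atlas N. smooth_vec (local_dom c d F) (local_rep c d F))"


section \<open>Tangent vectors and differentials\<close>

text \<open>A tangent vector at \<open>p\<close> assigns to each chart of the atlas around \<open>p\<close> its coordinate vector,
  subject to the transformation rule (and \<open>0\<close> to all other charts, so that equality is as it
  should be). This is the tangent space of the underlying real manifold.\<close>

type_synonym ('p, 'k) tangent_vector = "('p, 'k) chart \<Rightarrow> complex ^ 'k"

definition charts_at :: "('p, 'k::finite) manifold \<Rightarrow> 'p \<Rightarrow> ('p, 'k) chart set" where
  "charts_at M p = {c \<in> atlas M. p \<in> fst c}"

definition tangent_space :: "('p, 'k::finite) manifold \<Rightarrow> 'p \<Rightarrow> ('p, 'k) tangent_vector set" where
  "tangent_space M p = {v.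
     (\<forall>c\<in>charts_at M p. \<forall>d\<in>charts_at M p.
        v d = frechet_derivative (local_rep c d id) (at (snd c p)) (v c)) \<and>
     (\<forall>c. c \<notin> charts_at M p \<longrightarrow> v c = 0)}"

abbreviation zero_vector :: "('p, 'k::finite) tangent_vector" where
  "zero_vector \<equiv> \<lambda>_. 0"

text \<open>The tangent vector at \<open>p\<close> with coordinates \<open>a\<close> in the holomorphic chart \<open>c\<close>,
  which need not belong to the atlas.\<close>

definition from_coords :: "('p, 'k::finite) manifold \<Rightarrow> ('p, 'k) chart \<Rightarrow> 'p \<Rightarrow> complex ^ 'k
    \<Rightarrow> ('p, 'k) tangent_vector" where
  "from_coords M c p a =
     (\<lambda>d. if d \<in> charts_at M p then frechet_derivative (local_rep c d id) (at (snd c p)) a else 0)"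

text \<open>The complex structure acting on tangent vectors.\<close>

definition cplx_struct :: "('p, 'k::finite) tangent_vector \<Rightarrow> ('p, 'k) tangent_vector" where
  "cplx_struct v = (\<lambda>c. \<i> *s v c)"

text \<open>The result does not depend on the chart \<open>c\<close> chosen.\<close>

definition differential :: "('p, 'k::finite) manifold \<Rightarrow> ('q, 'l::finite) manifold \<Rightarrow> ('p \<Rightarrow> 'q) \<Rightarrow> 'p
    \<Rightarrow> ('p, 'k) tangent_vector \<Rightarrow> ('q, 'l) tangent_vector" where
  "differential M N F p v =
     (let c = (SOME c. c \<in> charts_at M p) in
      (\<lambda>d. if d \<in> charts_at N (F p)
           then frechet_derivative (local_rep c d F) (at (snd c p)) (v c) else 0))"

definition smooth_embedding :: "('p, 'k::finite) manifold \<Rightarrow> ('q, 'l::finite) manifold \<Rightarrow> ('p \<Rightarrow> 'q) \<Rightarrow> bool" where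
  "smooth_embedding M N F \<longleftrightarrow> smooth_map M N F \<and> embedding_map (topol M) (topol N) F \<and>
     (\<forall>p\<in>points M. inj_on (differential M N F p) (tangent_space M p))"

definition submersion :: "('p, 'k::finite) manifold \<Rightarrow> ('q, 'l::finite) manifold \<Rightarrow> ('p \<Rightarrow> 'q) \<Rightarrow> bool" where
  "submersion M N F \<longleftrightarrow> smooth_map M N F \<and>
     (\<forall>p\<in>points M. differential M N F p ` tangent_space M p = tangent_space N (F p))"


section \<open>Differential 2-forms\<close>

text \<open>A 2-form takes real or complex values; only its values at \<open>p \<in> points M\<close> on pairs from
  \<open>tangent_space M p\<close> are meaningful.\<close>

type_synonym ('p, 'k, 'v) form2 = "'p \<Rightarrow> ('p, 'k) tangent_vector \<Rightarrow> ('p, 'k) tangent_vector \<Rightarrow> 'v"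

text \<open>The expression of a form in the chart \<open>c\<close> of the atlas, at the point with coordinates \<open>z\<close>.\<close>

definition form_coords :: "('p, 'k::finite) manifold \<Rightarrow> ('p, 'k, 'v) form2 \<Rightarrow> ('p, 'k) chart
    \<Rightarrow> complex ^ 'k \<Rightarrow> complex ^ 'k \<Rightarrow> complex ^ 'k \<Rightarrow> 'v" where
  "form_coords M \<omega> c z a b =
     (let p = chart_inv c z in \<omega> p (from_coords M c p a) (from_coords M c p b))"

definition alternating_form :: "('p, 'k::finite) manifold \<Rightarrow> ('p, 'k, 'v::real_normed_vector) form2 \<Rightarrow> bool" where
  "alternating_form M \<omega> \<longleftrightarrow> (\<forall>c\<in>atlas M. \<forall>z \<in> snd c ` fst c.
     bilinear (form_coords M \<omega> c z) \<and> (\<forall>a. form_coords M \<omega> c z a a = 0))"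

text \<open>Vanishing of the exterior derivative, evaluated on constant coordinate vector fields.
  Only used for forms with differentiable coefficients.\<close>

definition closed_form :: "('p, 'k::finite) manifold \<Rightarrow> ('p, 'k, 'v::real_normed_vector) form2 \<Rightarrow> bool" where
  "closed_form M \<omega> \<longleftrightarrow> (\<forall>c\<in>atlas M. \<forall>z \<in> snd c ` fst c. \<forall>a b e.
       frechet_derivative (\<lambda>y. form_coords M \<omega> c y b e) (at z) a
     - frechet_derivative (\<lambda>y. form_coords M \<omega> c y a e) (at z) b
     + frechet_derivative (\<lambda>y. form_coords M \<omega> c y a b) (at z) e = 0)"

text \<open>Sign convention: the metric is \<open>g(u,v) = \<omega>(u, J v)\<close>. Symmetry of \<open>g\<close> is the
  \<open>J\<close>-invariance of \<open>\<omega>\<close>.\<close>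

definition real_analytic_kaehler :: "('p, 'k::finite) manifold \<Rightarrow> ('p, 'k, real) form2 \<Rightarrow> bool" where
  "real_analytic_kaehler M \<omega> \<longleftrightarrow> complex_manifold M \<and>
     alternating_form M \<omega> \<and>
     (\<forall>c\<in>atlas M. \<forall>a b. real_analytic_fun (snd c ` fst c) (\<lambda>z. form_coords M \<omega> c z a b)) \<and>
     closed_form M \<omega> \<and>
     (\<forall>p\<in>points M. \<forall>u\<in>tangent_space M p. \<forall>v\<in>tangent_space M p.
        \<omega> p (cplx_struct u) (cplx_struct v) = \<omega> p u v) \<and>
     (\<forall>p\<in>points M. \<forall>u\<in>tangent_space M p. u \<noteq> zero_vector \<longrightarrow> \<omega> p u (cplx_struct u) > 0)"

text \<open>The second conjunct says that \<open>\<Omega>\<close> is of type (2,0), the third that it is holomorphic.\<close>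

definition holomorphic_symplectic :: "('p, 'k::finite) manifold \<Rightarrow> ('p, 'k, complex) form2 \<Rightarrow> bool" where
  "holomorphic_symplectic X \<Omega> \<longleftrightarrow>
     alternating_form X \<Omega> \<and>
     (\<forall>p\<in>points X. \<forall>u\<in>tangent_space X p. \<forall>v\<in>tangent_space X p.
        \<Omega> p (cplx_struct u) v = \<i> * \<Omega> p u v) \<and>
     (\<forall>c\<in>atlas X. \<forall>a b. holomorphic_fun (snd c ` fst c) (\<lambda>z. form_coords X \<Omega> c z a b)) \<and>
     closed_form X \<Omega> \<and>
     (\<forall>p\<in>points X. \<forall>u\<in>tangent_space X p. u \<noteq> zero_vector \<longrightarrow>
        (\<exists>v\<in>tangent_space X p. \<Omega> p u v \<noteq> 0))"

definition pullback :: "('p, 'k::finite) manifold \<Rightarrow> ('q, 'l::finite) manifold \<Rightarrow> ('p \<Rightarrow> 'q)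
    \<Rightarrow> ('q, 'l, 'v) form2 \<Rightarrow> ('p, 'k, 'v) form2" where
  "pullback M N F \<Omega> = (\<lambda>p u v. \<Omega> (F p) (differential M N F p u) (differential M N F p v))"

definition form_eq :: "('p, 'k::finite) manifold \<Rightarrow> ('p, 'k, 'v) form2 \<Rightarrow> ('p, 'k, 'v) form2 \<Rightarrow> bool" where
  "form_eq M \<omega> \<eta> \<longleftrightarrow> (\<forall>p\<in>points M. \<forall>u\<in>tangent_space M p. \<forall>v\<in>tangent_space M p. \<omega> p u v = \<eta> p u v)"


section \<open>Complex and Lagrangian submanifolds\<close>

definition coord_subspace :: "'k set \<Rightarrow> (complex ^ 'k::finite) set" where
  "coord_subspace S = {z. \<forall>i. i \<notin> S \<longrightarrow> z $ i = 0}"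

text \<open>\<open>c\<close> is a holomorphic chart around \<open>p\<close> in which \<open>L\<close> is a coordinate subspace.\<close>

definition slice_chart :: "('p, 'k::finite) manifold \<Rightarrow> 'p set \<Rightarrow> 'p \<Rightarrow> ('p, 'k) chart \<Rightarrow> 'k set \<Rightarrow> bool" where
  "slice_chart X L p c S \<longleftrightarrow> c \<in> holomorphic_charts X \<and> p \<in> fst c \<and>
     snd c ` (fst c \<inter> L) = snd c ` fst c \<inter> coord_subspace S"

definition complex_submanifold :: "('p, 'k::finite) manifold \<Rightarrow> nat \<Rightarrow> 'p set \<Rightarrow> bool" where
  "complex_submanifold X d L \<longleftrightarrow> L \<subseteq> points X \<and>
     (\<forall>p\<in>L. \<exists>c S. slice_chart X L p c S \<and> card S = d)"

definition submanifold_tangent :: "('p, 'k::finite) manifold \<Rightarrow> 'p set \<Rightarrow> 'p \<Rightarrow> ('p, 'k) tangent_vector set" where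
  "submanifold_tangent X L p =
     {from_coords X c p a | c S a. slice_chart X L p c S \<and> a \<in> coord_subspace S}"

definition holomorphic_lagrangian :: "('p, 'k::finite) manifold \<Rightarrow> ('p, 'k, complex) form2 \<Rightarrow> nat \<Rightarrow> 'p set \<Rightarrow> bool" where
  "holomorphic_lagrangian X \<Omega> n L \<longleftrightarrow> complex_submanifold X n L \<and>
     (\<forall>p\<in>L. \<forall>u\<in>submanifold_tangent X L p. \<forall>v\<in>submanifold_tangent X L p. \<Omega> p u v = 0)"

end

theory Submission
  imports Defs "HOL-Complex_Analysis.Complex_Analysis"
begin

text \<open>
  The space \<open>X\<close> is a neighbourhood of the diagonal in \<open>M\<close> times its complex conjugate, \<open>\<Omega>\<close> is the
  holomorphic extension of \<open>\<omega>\<close> from the diagonal, \<open>\<tau>\<close> swaps the factors and \<open>\<Pi>\<close> is the projection to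
  the first factor. The diagonal is totally real, so every identity between holomorphic functions that
  holds on it propagates: \<open>\<Omega>\<close> inherits closedness and reality from \<open>\<omega>\<close>, and the \<open>J\<close>-invariance of
  \<open>\<omega>\<close> makes the fibres of \<open>\<Pi>\<close> isotropic. Propagation needs convex domains. Therefore \<open>X\<close> is the union
  of squares \<open>V \<times> V\<close> of coordinate balls chosen so small with respect to a metric on \<open>M\<close> that of two
  balls that meet, one lies in a larger ball on which the power series of the other still converges.
\<close>

text \<open>Two local extensions of \<open>\<omega>\<close> agree on the diagonal, but this decides
  little on the overlap of two squares: in coordinates the overlap is the square of a set that may
  fail to be convex or even connected, and if it is disconnected, parts of its square miss the
  diagonal. The comparison therefore runs over one whole square, convex in its own coordinates, and
  the other extension has to exist on all of it. Sizes measured by a distance on \<open>M\<close>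
  can be compared between charts, so of two balls that meet, the smaller one can be made to fit.
  Convexity enters through complex lines. A point of the square over a convex \<open>B\<close> lies
  on a complex line through the midpoint of its two components; the real points of the line are
  diagonal, and the parameters that stay over \<open>B\<close> form a convex set, on which the
  one-variable identity theorem applies. Nondegeneracy is no identity and does not propagate. It
  holds on the diagonal by positivity of the metric and near it by compactness, which costs a
  further shrinking of the balls.\<close>

section \<open>Complex vectors as real normed vectors\<close>

lemma norm_cvec_scale: "norm (c *s v) = cmod c * norm v" for v :: "complex ^ 'k::finite"
  by (simp add: norm_vec_def norm_mult L2_set_right_distrib)

lemma scaleR_cvec: "r *\<^sub>R v = complex_of_real r *s v" for v :: "complex ^ 'k::finite"
  by (simp add: vec_eq_iff) (simp add: scaleR_conv_of_real)

lemma bounded_linear_cvec_scale: "bounded_linear (\<lambda>c. c *s v)" for v :: "complex ^ 'k::finite"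
  by (rule bounded_linear_intro[where K = "norm v"])
     (simp_all add: norm_cvec_scale vector_sadd_rdistrib vec_eq_iff algebra_simps)

text \<open>\<open>holomorphic_vec\<close> speaks of complex components, not of the real coordinates
  in \<open>Basis\<close>; the vector is reassembled from its components by the bounded linear maps
  \<open>axis i\<close>.\<close>

lemma has_derivative_vecI:
  fixes f :: "'a::real_normed_vector \<Rightarrow> 'b::real_normed_vector ^ 'k::finite"
  assumes "\<And>i. ((\<lambda>x. f x $ i) has_derivative (\<lambda>h. D h $ i)) F"
  shows "(f has_derivative D) F"
proof -
  have ax: "bounded_linear (axis i :: 'b \<Rightarrow> 'b ^ 'k)" for i
  proof (rule bounded_linear_intro[where K = 1])
    show "norm (axis i x :: 'b ^ 'k) \<le> norm x * 1" for x :: 'b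
      by (simp add: norm_vec_def L2_set_def axis_def if_distrib[of norm] if_distrib[of "\<lambda>x. x^2"] cong: if_cong)
  qed (simp_all add: axis_def vec_eq_iff)
  have ex: "v = (\<Sum>i\<in>UNIV. axis i (v $ i))" for v :: "'b ^ 'k"
    by (simp add: vec_eq_iff axis_def if_distrib sum.delta' cong: if_cong)
  have "((\<lambda>x. \<Sum>i\<in>UNIV. axis i (f x $ i)) has_derivative (\<lambda>h. \<Sum>i\<in>UNIV. axis i (D h $ i))) F"
    by (intro has_derivative_sum bounded_linear.has_derivative[OF ax] assms)
  then show ?thesis
    by (simp flip: ex)
qed

section \<open>Holomorphic functions of several variables\<close>

lemma holomorphic_funI:
  assumes "\<And>z. z \<in> S \<Longrightarrow> (f has_derivative D z) (at z)" "\<And>z c v. z \<in> S \<Longrightarrow> D z (c *s v) = c * D z v"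
  shows "holomorphic_fun S f"
  using assms unfolding holomorphic_fun_def by blast

lemma holomorphic_fun_frechet:
  assumes "holomorphic_fun S f" "z \<in> S"
  shows "(f has_derivative frechet_derivative f (at z)) (at z)"
    "frechet_derivative f (at z) (c *s v) = c * frechet_derivative f (at z) v"
proof -
  obtain D where D: "(f has_derivative D) (at z)" "\<And>c v. D (c *s v) = c * D v"
    using assms unfolding holomorphic_fun_def by blast
  then show "(f has_derivative frechet_derivative f (at z)) (at z)"
    "frechet_derivative f (at z) (c *s v) = c * frechet_derivative f (at z) v"
    using frechet_derivative_at[OF D(1)] by auto
qed

lemma holomorphic_fun_subset: "holomorphic_fun S f \<Longrightarrow> T \<subseteq> S \<Longrightarrow> holomorphic_fun T f"
  unfolding holomorphic_fun_def by blast

lemma holomorphic_fun_cong: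
  assumes "holomorphic_fun S f" "open S" "\<And>z. z \<in> S \<Longrightarrow> g z = f z"
  shows "holomorphic_fun S g"
proof (rule holomorphic_funI)
  fix z assume z: "z \<in> S"
  show "(g has_derivative frechet_derivative f (at z)) (at z)"
    using has_derivative_transform_within_open[OF holomorphic_fun_frechet(1)[OF assms(1) z] assms(2) z]
      assms(3) by metis
qed (use holomorphic_fun_frechet(2)[OF assms(1)] in auto)

text \<open>The derivative refers to the full filter \<open>at z\<close>, so being holomorphic is a
  condition on each point separately and the sets \<open>T\<close> can be arbitrary.\<close>

lemma holomorphic_fun_locally:
  assumes "\<And>z. z \<in> S \<Longrightarrow> \<exists>T. z \<in> T \<and> holomorphic_fun T f"
  shows "holomorphic_fun S f"
  using assms unfolding holomorphic_fun_def by blast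

lemma holomorphic_fun_continuous_on: "holomorphic_fun S f \<Longrightarrow> continuous_on S f"
  by (meson continuous_at_imp_continuous_on has_derivative_continuous holomorphic_fun_frechet(1))

lemma holomorphic_fun_const [intro]: "holomorphic_fun S (\<lambda>_. c)"
  by (rule holomorphic_funI[where D = "\<lambda>_ _. 0"]) auto

lemma holomorphic_fun_linear:
  assumes "bounded_linear f" "\<And>c v. f (c *s v) = c * f v"
  shows "holomorphic_fun S f"
  by (rule holomorphic_funI[where D = "\<lambda>_. f"]) (auto intro: bounded_linear_imp_has_derivative assms)

lemma holomorphic_fun_add [intro]:
  "holomorphic_fun S f \<Longrightarrow> holomorphic_fun S g \<Longrightarrow> holomorphic_fun S (\<lambda>z. f z + g z)"
  by (rule holomorphic_funI, rule has_derivative_add, erule (1) holomorphic_fun_frechet(1)[of S f],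
      erule (1) holomorphic_fun_frechet(1)[of S g])
     (simp add: holomorphic_fun_frechet(2)[of S] algebra_simps)

lemma holomorphic_fun_mult [intro]:
  "holomorphic_fun S f \<Longrightarrow> holomorphic_fun S g \<Longrightarrow> holomorphic_fun S (\<lambda>z. f z * g z)"
  by (rule holomorphic_funI, rule has_derivative_mult, erule (1) holomorphic_fun_frechet(1)[of S f],
      erule (1) holomorphic_fun_frechet(1)[of S g])
     (simp add: holomorphic_fun_frechet(2)[of S] algebra_simps)

lemma holomorphic_fun_diff [intro]:
  "holomorphic_fun S f \<Longrightarrow> holomorphic_fun S g \<Longrightarrow> holomorphic_fun S (\<lambda>z. f z - g z)"
  by (rule holomorphic_funI, rule has_derivative_diff, erule (1) holomorphic_fun_frechet(1)[of S f],
      erule (1) holomorphic_fun_frechet(1)[of S g])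
     (simp add: holomorphic_fun_frechet(2)[of S] algebra_simps)

lemma holomorphic_fun_sum [intro]:
  "(\<And>i. i \<in> I \<Longrightarrow> holomorphic_fun S (f i)) \<Longrightarrow> holomorphic_fun S (\<lambda>z. \<Sum>i\<in>I. f i z)"
  by (induction I rule: infinite_finite_induct) auto

lemma holomorphic_fun_prod [intro]:
  "(\<And>i. i \<in> I \<Longrightarrow> holomorphic_fun S (f i)) \<Longrightarrow> holomorphic_fun S (\<lambda>z. \<Prod>i\<in>I. f i z)"
  by (induction I rule: infinite_finite_induct) auto

lemma holomorphic_fun_power [intro]: "holomorphic_fun S f \<Longrightarrow> holomorphic_fun S (\<lambda>z. f z ^ n)"
  by (induction n) auto

lemma holomorphic_vec_frechet:
  fixes f :: "complex ^ 'k::finite \<Rightarrow> complex ^ 'l::finite"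
  assumes "holomorphic_vec S f" "z \<in> S"
  shows "(f has_derivative frechet_derivative f (at z)) (at z)"
    "frechet_derivative f (at z) (c *s v) = c *s frechet_derivative f (at z) v"
    "frechet_derivative f (at z) v $ i = frechet_derivative (\<lambda>z. f z $ i) (at z) v"
proof -
  define D where "D v = (\<chi> i. frechet_derivative (\<lambda>z. f z $ i) (at z) v)" for v
  have h: "holomorphic_fun S (\<lambda>z. f z $ i)" for i
    using assms by (simp add: holomorphic_vec_def)
  have D: "(f has_derivative D) (at z)"
    by (rule has_derivative_vecI) (simp add: D_def holomorphic_fun_frechet(1)[OF h assms(2)])
  then show "(f has_derivative frechet_derivative f (at z)) (at z)"
    "frechet_derivative f (at z) (c *s v) = c *s frechet_derivative f (at z) v"
    "frechet_derivative f (at z) v $ i = frechet_derivative (\<lambda>z. f z $ i) (at z) v"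
    by (simp_all flip: frechet_derivative_at[OF D])
      (simp_all add: D_def vec_eq_iff holomorphic_fun_frechet(2)[OF h assms(2)])
qed

lemma holomorphic_vec_subset: "holomorphic_vec S f \<Longrightarrow> T \<subseteq> S \<Longrightarrow> holomorphic_vec T f"
  unfolding holomorphic_vec_def using holomorphic_fun_subset by blast

lemma holomorphic_vec_cong:
  "holomorphic_vec S f \<Longrightarrow> open S \<Longrightarrow> (\<And>z. z \<in> S \<Longrightarrow> g z = f z) \<Longrightarrow> holomorphic_vec S g"
  unfolding holomorphic_vec_def using holomorphic_fun_cong[of S "\<lambda>z. f z $ i" "\<lambda>z. g z $ i" for i]
  by simp

lemma holomorphic_vec_linear:
  assumes "bounded_linear f" "\<And>c v. f (c *s v) = c *s f v"
  shows "holomorphic_vec S f"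
  unfolding holomorphic_vec_def
proof (intro allI holomorphic_fun_linear)
  show "bounded_linear (\<lambda>z. f z $ i)" for i
    by (rule bounded_linear_compose[OF bounded_linear_vec_nth assms(1)])
qed (simp add: assms(2))

lemma holomorphic_fun_compose:
  fixes g :: "complex ^ 'k::finite \<Rightarrow> complex ^ 'l::finite"
  assumes f: "holomorphic_fun T f" and g: "holomorphic_vec S g" and ST: "\<And>z. z \<in> S \<Longrightarrow> g z \<in> T"
  shows "holomorphic_fun S (\<lambda>z. f (g z))"
proof (rule holomorphic_funI)
  fix z assume z: "z \<in> S"
  show "((\<lambda>z. f (g z)) has_derivative
      (\<lambda>h. frechet_derivative f (at (g z)) (frechet_derivative g (at z) h))) (at z)"
    by (rule has_derivative_compose[OF holomorphic_vec_frechet(1)[OF g z]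
        holomorphic_fun_frechet(1)[OF f ST[OF z]]])
  show "frechet_derivative f (at (g z)) (frechet_derivative g (at z) (c *s v))
     = c * frechet_derivative f (at (g z)) (frechet_derivative g (at z) v)" for c v
    by (simp add: holomorphic_vec_frechet(2)[OF g z] holomorphic_fun_frechet(2)[OF f ST[OF z]])
qed

lemma holomorphic_vec_compose:
  fixes g :: "complex ^ 'k::finite \<Rightarrow> complex ^ 'l::finite"
  assumes "holomorphic_vec T f" "holomorphic_vec S g" "\<And>z. z \<in> S \<Longrightarrow> g z \<in> T"
  shows "holomorphic_vec S (\<lambda>z. f (g z))"
  using assms holomorphic_fun_compose[OF _ assms(2,3)] unfolding holomorphic_vec_def by blast

lemma holomorphic_vec_continuous_on:
  "holomorphic_vec S f \<Longrightarrow> continuous_on S f"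
  by (meson continuous_at_imp_continuous_on has_derivative_continuous holomorphic_vec_frechet(1))

text \<open>\<open>cnj\<close> and the conjugate-linear \<open>K\<close> conjugate scalars twice.
  \<open>K = sndc\<close> serves functions of the second factor, \<open>K = conjc\<close> the
  reflected form in \<open>bilc_reality\<close>.\<close>

lemma holomorphic_fun_cnj_compose:
  fixes K :: "complex ^ 'k::finite \<Rightarrow> complex ^ 'l::finite"
  assumes f: "holomorphic_fun T f" and K: "bounded_linear K" "\<And>c v. K (c *s v) = cnj c *s K v"
    and ST: "\<And>z. z \<in> S \<Longrightarrow> K z \<in> T"
  shows "holomorphic_fun S (\<lambda>z. cnj (f (K z)))"
proof (rule holomorphic_funI)
  fix z assume z: "z \<in> S"
  show "((\<lambda>z. cnj (f (K z))) has_derivative (\<lambda>h. cnj (frechet_derivative f (at (K z)) (K h)))) (at z)"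
    by (rule bounded_linear.has_derivative[OF bounded_linear_cnj])
      (rule has_derivative_compose[OF bounded_linear_imp_has_derivative[OF K(1)]
        holomorphic_fun_frechet(1)[OF f ST[OF z]]])
  show "cnj (frechet_derivative f (at (K z)) (K (c *s v)))
     = c * cnj (frechet_derivative f (at (K z)) (K v))" for c v
    by (simp add: K(2) holomorphic_fun_frechet(2)[OF f ST[OF z]])
qed

section \<open>Complex lines, Cauchy estimates and limits\<close>

lemma holomorphic_fun_line:
  fixes f :: "complex ^ 'k::finite \<Rightarrow> complex"
  assumes "holomorphic_fun S f" "p + l *s q \<in> S"
  shows "((\<lambda>l. f (p + l *s q)) has_field_derivative frechet_derivative f (at (p + l *s q)) q) (at l)"
proof -
  have 1: "((\<lambda>l. p + l *s q) has_derivative (\<lambda>h. h *s q)) (at l)"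
    by (rule has_derivative_eq_rhs, rule has_derivative_add[OF has_derivative_const
        bounded_linear_imp_has_derivative[OF bounded_linear_cvec_scale]]) auto
  have "((\<lambda>l. f (p + l *s q)) has_derivative
      (\<lambda>h. frechet_derivative f (at (p + l *s q)) (h *s q))) (at l)"
    by (rule has_derivative_compose[OF 1 holomorphic_fun_frechet(1)[OF assms]])
  then show ?thesis
    unfolding has_field_derivative_def
    by (simp add: holomorphic_fun_frechet(2)[OF assms] mult_commute_abs)
qed

lemma open_line_preimage: "open S \<Longrightarrow> open {l. p + l *s q \<in> S}" for q :: "complex ^ 'k::finite"
  using open_vimage[of S "\<lambda>l. p + l *s q"]
    continuous_on_add[OF continuous_on_const linear_continuous_on[OF bounded_linear_cvec_scale[of q]]]
  unfolding vimage_def by blast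

lemma holomorphic_fun_line_holomorphic_on:
  fixes f :: "complex ^ 'k::finite \<Rightarrow> complex"
  assumes "holomorphic_fun S f" "A \<subseteq> {l. p + l *s q \<in> S}"
  shows "(\<lambda>l. f (p + l *s q)) holomorphic_on A"
  unfolding holomorphic_on_def field_differentiable_def
  using holomorphic_fun_line[OF assms(1)] assms(2)
  by (meson has_field_derivative_at_within mem_Collect_eq subset_iff)

text \<open>The one-variable Cauchy inequality for the first derivative along the line through
  \<open>z\<close> in direction \<open>h\<close>.\<close>

lemma cauchy_frechet:
  fixes f :: "complex ^ 'k::finite \<Rightarrow> complex"
  assumes f: "holomorphic_fun S f" and S: "cball z \<delta> \<subseteq> S" "\<delta> > 0"
    and B: "\<And>x. x \<in> S \<Longrightarrow> cmod (f x) \<le> B"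
  shows "cmod (frechet_derivative f (at z) h) \<le> B / \<delta> * norm h"
proof (cases "h = 0")
  case True
  have "z \<in> S" using S by auto
  then show ?thesis
    using holomorphic_fun_frechet(2)[OF f, of z 0 0] True by simp
next
  case False
  \<comment> \<open>The parameters of modulus at most \<open>r\<close> are exactly those that stay
    in \<open>cball z \<delta>\<close>; the factor \<open>norm h\<close> of the estimate comes from
    here.\<close>
  define r where "r = \<delta> / norm h"
  have r: "r > 0" using S False by (simp add: r_def)
  have in_S: "z + l *s h \<in> S" if "cmod l \<le> r" for l
    using that S(1) False by (auto simp: dist_norm norm_cvec_scale r_def field_simps)
  have hol: "(\<lambda>l. f (z + l *s h)) holomorphic_on cball 0 r"
    by (rule holomorphic_fun_line_holomorphic_on[OF f]) (auto intro: in_S)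
  have "cmod ((deriv ^^ 1) (\<lambda>l. f (z + l *s h)) 0) \<le> fact 1 * B / r ^ 1"
  proof (rule Cauchy_inequality)
    show "(\<lambda>l. f (z + l *s h)) holomorphic_on ball 0 r"
      using hol by (rule holomorphic_on_subset) auto
  qed (use r hol B in_S in \<open>auto intro!: holomorphic_on_imp_continuous_on\<close>)
  moreover have "deriv (\<lambda>l. f (z + l *s h)) 0 = frechet_derivative f (at z) h"
    using DERIV_imp_deriv[OF holomorphic_fun_line[OF f, of z 0 h]] in_S[of 0] r by simp
  ultimately show ?thesis
    by (simp add: r_def)
qed

lemma frechet_derivative_diff_holo:
  assumes "holomorphic_fun S f" "holomorphic_fun S g" "z \<in> S"
  shows "frechet_derivative (\<lambda>z. f z - g z) (at z) h
    = frechet_derivative f (at z) h - frechet_derivative g (at z) h"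
  using frechet_derivative_at[OF has_derivative_diff[OF holomorphic_fun_frechet(1)[OF assms(1,3)]
        holomorphic_fun_frechet(1)[OF assms(2,3)]]] by metis

text \<open>Cauchy estimates turn uniform convergence of the functions into uniform convergence of
  their derivatives on a smaller ball, so the limit can be differentiated term by term; complex
  linearity of the derivative passes to the limit.\<close>

lemma holomorphic_fun_uniform_limit:
  fixes f :: "complex ^ 'k::finite \<Rightarrow> complex"
  assumes S: "open S" and g: "\<And>n. holomorphic_fun S (g n)" and lim: "uniform_limit S g f sequentially"
  shows "holomorphic_fun S f"
proof (rule holomorphic_fun_locally)
  fix z0 assume "z0 \<in> S"
  then obtain e where e: "e > 0" "cball z0 e \<subseteq> S"
    using S open_contains_cball by blast
  \<comment> \<open>Half the radius leaves a closed ball of radius \<open>\<delta>\<close> around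
    every point of \<open>ball z0 \<delta>\<close> inside \<open>S\<close>, as the Cauchy estimate
    requires.\<close>
  define \<delta> where "\<delta> = e / 2"
  have \<delta>: "\<delta> > 0" using e by (simp add: \<delta>_def)
  have sub: "cball z \<delta> \<subseteq> S" if "z \<in> ball z0 \<delta>" for z
  proof
    fix x assume "x \<in> cball z \<delta>"
    then have "dist z0 x \<le> e" using that dist_triangle[of z0 x z] by (auto simp: \<delta>_def)
    then show "x \<in> S" using e by auto
  qed
  define D where "D n z = frechet_derivative (g n) (at z)" for n z
  have Dd: "(g n has_derivative D n z) (at z)" "D n z (c *s v) = c * D n z v" if "z \<in> S" for n z c v
    using holomorphic_fun_frechet[OF g that] by (simp_all add: D_def)
  have cau: "\<exists>N. \<forall>m\<ge>N. \<forall>n\<ge>N. \<forall>z\<in>ball z0 \<delta>. \<forall>h. cmod (D m z h - D n z h) \<le> \<epsilon> * norm h"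
    if "\<epsilon> > 0" for \<epsilon>
  proof -
    have "uniformly_convergent_on S g"
      using lim uniformly_convergent_on_def by blast
    then have "uniformly_Cauchy_on S g"
      by (simp add: uniformly_convergent_Cauchy)
    \<comment> \<open>The functions are compared up to \<open>\<epsilon> * \<delta>\<close> because
      the Cauchy estimate divides by \<open>\<delta>\<close>.\<close>
    moreover have "\<epsilon> * \<delta> > 0" using that \<delta> by simp
    ultimately obtain N where N: "\<And>x m n. x \<in> S \<Longrightarrow> m \<ge> N \<Longrightarrow> n \<ge> N \<Longrightarrow> dist (g m x) (g n x) < \<epsilon> * \<delta>"
      unfolding uniformly_Cauchy_on_def by meson
    have "cmod (D m z h - D n z h) \<le> \<epsilon> * norm h"
      if "m \<ge> N" "n \<ge> N" "z \<in> ball z0 \<delta>" for m n z h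
    proof -
      have z: "z \<in> S" using sub[OF that(3)] \<delta> by auto
      have "cmod (frechet_derivative (\<lambda>z. g m z - g n z) (at z) h) \<le> \<epsilon> * \<delta> / \<delta> * norm h"
        using N[OF _ that(1,2)] holomorphic_fun_diff[OF g g]
        by (intro cauchy_frechet[OF _ sub[OF that(3)] \<delta>]) (auto simp: dist_norm less_imp_le)
      then show ?thesis
        using \<delta> by (simp add: frechet_derivative_diff_holo[OF g g z] D_def)
    qed
    then show ?thesis by blast
  qed
  define D' where "D' z h = lim (\<lambda>n. D n z h)" for z h
  have D': "(\<lambda>n. D n z h) \<longlonglongrightarrow> D' z h" if z: "z \<in> ball z0 \<delta>" for z h
  proof -
    have "Cauchy (\<lambda>n. D n z h)"
    proof (rule metric_CauchyI)
      fix \<epsilon> :: real assume \<epsilon>: "\<epsilon> > 0"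
      \<comment> \<open>The added 1 covers \<open>h = 0\<close>.\<close>
      define \<eta> where "\<eta> = \<epsilon> / (norm h + 1)"
      have nh: "norm h + 1 > 0" using norm_ge_zero[of h] by linarith
      have "\<eta> > 0" using \<epsilon> nh by (simp add: \<eta>_def)
      then obtain N where N: "\<And>m n. m \<ge> N \<Longrightarrow> n \<ge> N \<Longrightarrow> cmod (D m z h - D n z h) \<le> \<eta> * norm h"
        using cau z by meson
      have "\<eta> * norm h < \<epsilon>"
        using \<epsilon> nh by (simp add: \<eta>_def divide_simps)
      then show "\<exists>N. \<forall>m\<ge>N. \<forall>n\<ge>N. dist (D m z h) (D n z h) < \<epsilon>"
        using N by (force simp: dist_norm)
    qed
    then show ?thesis
      by (simp add: D'_def Cauchy_convergent_iff convergent_LIMSEQ_iff)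
  qed
  have nle: "\<forall>\<^sub>F n in sequentially. \<forall>z\<in>ball z0 \<delta>. \<forall>h. cmod (D n z h - D' z h) \<le> \<epsilon> * norm h"
    if "\<epsilon> > 0" for \<epsilon>
  proof -
    obtain N where N: "\<And>m n z h. m \<ge> N \<Longrightarrow> n \<ge> N \<Longrightarrow> z \<in> ball z0 \<delta> \<Longrightarrow> cmod (D m z h - D n z h) \<le> \<epsilon> * norm h"
      using cau[OF \<open>\<epsilon> > 0\<close>] by meson
    have "cmod (D n z h - D' z h) \<le> \<epsilon> * norm h" if "n \<ge> N" "z \<in> ball z0 \<delta>" for n z h
    proof (rule LIMSEQ_le_const2)
      show "(\<lambda>m. cmod (D n z h - D m z h)) \<longlonglongrightarrow> cmod (D n z h - D' z h)"
        by (intro tendsto_intros D' that)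
    qed (use N that in blast)
    then show ?thesis
      unfolding eventually_sequentially by blast
  qed
  have z0: "z0 \<in> ball z0 \<delta>" using \<delta> by simp
  have "\<exists>f'. \<forall>z\<in>ball z0 \<delta>. (\<lambda>n. g n z) \<longlonglongrightarrow> f' z \<and> (f' has_derivative D' z) (at z within ball z0 \<delta>)"
  proof (rule has_derivative_sequence[OF convex_ball _ nle z0])
    show "(g n has_derivative D n z) (at z within ball z0 \<delta>)" if "z \<in> ball z0 \<delta>" for n z
      using Dd(1) sub[OF that] \<delta> by (meson centre_in_cball has_derivative_at_withinI less_imp_le subset_iff)
    show "(\<lambda>n. g n z0) \<longlonglongrightarrow> f z0"
      using lim \<open>z0 \<in> S\<close> by (rule tendsto_uniform_limitI)
  qed
  then obtain f' where f': "\<And>z. z \<in> ball z0 \<delta> \<Longrightarrow> (\<lambda>n. g n z) \<longlonglongrightarrow> f' z"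
    "\<And>z. z \<in> ball z0 \<delta> \<Longrightarrow> (f' has_derivative D' z) (at z)"
    by (metis at_within_open open_ball)
  have eq: "f z = f' z" if "z \<in> ball z0 \<delta>" for z
    using LIMSEQ_unique[OF f'(1)[OF that] tendsto_uniform_limitI[OF lim]] sub[OF that] \<delta> by force
  have "holomorphic_fun (ball z0 \<delta>) f'"
  proof (rule holomorphic_funI[OF f'(2)])
    fix z c v assume z: "z \<in> ball z0 \<delta>"
    have "(\<lambda>n. c * D n z v) \<longlonglongrightarrow> D' z (c *s v)"
    proof -
      have "z \<in> S" using sub[OF z] \<delta> by auto
      then show ?thesis
        using D'[OF z, of "c *s v"] by (simp add: Dd(2))
    qed
    moreover have "(\<lambda>n. c * D n z v) \<longlonglongrightarrow> c * D' z v"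
      by (intro tendsto_intros D' z)
    ultimately show "D' z (c *s v) = c * D' z v"
      by (rule LIMSEQ_unique)
  qed
  then have "holomorphic_fun (ball z0 \<delta>) f"
    using eq by (auto intro: holomorphic_fun_cong)
  then show "\<exists>T. z0 \<in> T \<and> holomorphic_fun T f"
    using z0 by blast
qed

lemma holomorphic_vec_translate: "holomorphic_vec S (\<lambda>z. z + a)" for a :: "complex ^ 'k::finite"
  unfolding holomorphic_vec_def vector_add_component
  by (intro allI holomorphic_fun_add holomorphic_fun_linear bounded_linear_vec_nth holomorphic_fun_const) simp

text \<open>The difference quotients in direction \<open>v\<close> are holomorphic and converge
  locally uniformly: Taylor's formula on the line, with the second derivative bounded by Cauchy's
  inequality, gives an error linear in the step. This makes holomorphic maps smooth and lets
  closedness of a form be treated as a holomorphic identity.\<close>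

lemma holomorphic_fun_frechet_holomorphic:
  fixes f :: "complex ^ 'k::finite \<Rightarrow> complex"
  assumes S: "open S" and f: "holomorphic_fun S f"
  shows "holomorphic_fun S (\<lambda>z. frechet_derivative f (at z) v)"
proof (rule holomorphic_fun_locally)
  fix z0 assume "z0 \<in> S"
  then obtain e where e: "e > 0" "cball z0 e \<subseteq> S"
    using S open_contains_cball by blast
  have "compact (f ` cball z0 e)"
    by (intro compact_continuous_image continuous_on_subset[OF holomorphic_fun_continuous_on[OF f]] e compact_cball)
  then obtain B where B: "\<And>z. z \<in> cball z0 e \<Longrightarrow> cmod (f z) \<le> B"
    using compact_imp_bounded bounded_iff by (metis imageI)
  \<comment> \<open>A parameter of modulus at most \<open>3 * s\<close> moves a point by at most
    \<open>3 * e / 4\<close>, so points within \<open>e / 4\<close> of \<open>z0\<close> stay in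
    \<open>cball z0 e\<close>.\<close>
  define s where "s = e / (4 * (norm v + 1))"
  have nv: "norm v + 1 > 0" using norm_ge_zero[of v] by linarith
  have s: "s > 0" using e nv by (simp add: s_def)
  have sv: "r * norm v \<le> 3 * e / 4" if "r \<le> 3 * s" for r
  proof -
    have "r * norm v \<le> 3 * s * norm v"
      using that by (simp add: mult_right_mono)
    also have "\<dots> \<le> 3 * s * (norm v + 1)"
      using s by (intro mult_left_mono) auto
    also have "\<dots> = 3 * e / 4"
      using nv by (simp add: s_def divide_simps)
    finally show ?thesis .
  qed
  have in_ball: "z + l *s v \<in> cball z0 e" if "z \<in> ball z0 (e / 4)" "cmod l \<le> 3 * s" for z l
  proof -
    have "dist z0 (z + l *s v) \<le> dist z0 z + norm (l *s v)"
      by (metis add.commute add_diff_cancel_left' dist_commute dist_norm dist_triangle)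
    then show ?thesis
      using that sv[OF that(2)] by (auto simp: norm_cvec_scale)
  qed
  define t where "t n = s / real (Suc n)" for n
  have t: "0 < t n" "t n \<le> s" for n
    using s mult_left_mono[of 1 "real (Suc n)" s] by (simp_all add: t_def divide_le_eq)
  define g where "g n z = (f (z + complex_of_real (t n) *s v) - f z) * complex_of_real (1 / t n)" for n z
  have hg: "holomorphic_fun (ball z0 (e/4)) (g n)" for n
    unfolding g_def
  proof (intro holomorphic_fun_mult holomorphic_fun_diff holomorphic_fun_const
      holomorphic_fun_compose[OF f holomorphic_vec_translate])
    show "z + complex_of_real (t n) *s v \<in> S" if "z \<in> ball z0 (e/4)" for z
      using in_ball[OF that, of "complex_of_real (t n)"] t(1,2)[of n] s e(2) by auto
    show "holomorphic_fun (ball z0 (e/4)) f"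
      by (rule holomorphic_fun_subset[OF f]) (use e in auto)
  qed
  have est: "cmod (g n z - frechet_derivative f (at z) v) \<le> 2 * B / s\<^sup>2 * t n"
    if z: "z \<in> ball z0 (e/4)" for n z
  proof -
    define \<phi> where "\<phi> l = f (z + l *s v)" for l
    have hol: "\<phi> holomorphic_on cball 0 (3 * s)"
      unfolding \<phi>_def using in_ball[OF z] e
      by (intro holomorphic_fun_line_holomorphic_on[OF f]) auto
    have hol': "\<phi> holomorphic_on ball 0 (3 * s)"
      using hol by (rule holomorphic_on_subset) auto
    have "cmod ((deriv ^^ 0) \<phi> (complex_of_real (t n)) - (\<Sum>i\<le>1. (deriv ^^ i) \<phi> 0 * (complex_of_real (t n) - 0) ^ i / fact i))
        \<le> (2 * B / s\<^sup>2) * cmod (complex_of_real (t n) - 0) ^ Suc 1 / fact 1"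
    proof (rule complex_Taylor[OF convex_cball[of 0 s]])
      show "((deriv ^^ i) \<phi> has_field_derivative (deriv ^^ Suc i) \<phi> x) (at x within cball 0 s)"
        if "x \<in> cball 0 s" for i x
      proof -
        have "(deriv ^^ i) \<phi> holomorphic_on ball 0 (3 * s)"
          using hol' by (rule holomorphic_higher_deriv) auto
        from holomorphic_derivI[OF this open_ball, of x] show ?thesis
          using that s by (simp add: has_field_derivative_at_within)
      qed
      show "cmod ((deriv ^^ Suc 1) \<phi> x) \<le> 2 * B / s\<^sup>2" if x: "x \<in> cball 0 s" for x
      proof -
        \<comment> \<open>The remainder needs the second derivative at every point of
          \<open>cball 0 s\<close>, and Cauchy's inequality needs a disc of radius \<open>s\<close>
          around each such point.\<close>
        have sub: "cball x s \<subseteq> cball 0 (3 * s)"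
          using x s by (simp add: cball_subset_cball_iff)
        have "cmod ((deriv ^^ 2) \<phi> x) \<le> fact 2 * B / s ^ 2"
        proof (rule Cauchy_inequality[OF _ _ s])
          show "\<phi> holomorphic_on ball x s"
            by (rule holomorphic_on_subset[OF hol]) (use sub in auto)
          show "continuous_on (cball x s) \<phi>"
            by (rule holomorphic_on_imp_continuous_on[OF holomorphic_on_subset[OF hol sub]])
          show "cmod (\<phi> y) \<le> B" if "cmod (x - y) = s" for y
          proof -
            have "y \<in> cball 0 (3 * s)" using sub that by (auto simp: dist_norm)
            then show ?thesis
              unfolding \<phi>_def by (intro B in_ball[OF z]) simp
          qed
        qed
        then show ?thesis by (simp add: numeral_2_eq_2)
      qed
    qed (use t[of n] s in auto)
    moreover have "deriv \<phi> 0 = frechet_derivative f (at z) v"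
    proof -
      have "z \<in> S" using e(2) in_ball[OF z, of 0] s by auto
      then show ?thesis
        unfolding \<phi>_def using DERIV_imp_deriv[OF holomorphic_fun_line[OF f, of z 0 v]] by simp
    qed
    ultimately have *: "cmod (\<phi> (complex_of_real (t n)) - (\<phi> 0 + frechet_derivative f (at z) v * complex_of_real (t n)))
        \<le> (2 * B / s\<^sup>2) * (t n)\<^sup>2"
      using t(1)[of n] by (simp add: power2_eq_square)
    have "g n z - frechet_derivative f (at z) v
        = (\<phi> (complex_of_real (t n)) - (\<phi> 0 + frechet_derivative f (at z) v * complex_of_real (t n))) * complex_of_real (1 / t n)"
      using t(1)[of n] by (simp add: g_def \<phi>_def diff_divide_distrib add_divide_distrib)
    then have "cmod (g n z - frechet_derivative f (at z) v)
        = cmod (\<phi> (complex_of_real (t n)) - (\<phi> 0 + frechet_derivative f (at z) v * complex_of_real (t n))) * (1 / t n)"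
      using t(1)[of n] by (simp add: norm_mult norm_divide)
    also have "\<dots> \<le> (2 * B / s\<^sup>2) * (t n)\<^sup>2 * (1 / t n)"
      by (rule mult_right_mono[OF *]) (use t(1)[of n] in simp)
    also have "\<dots> = 2 * B / s\<^sup>2 * t n"
      using t(1)[of n] by (simp add: power2_eq_square)
    finally show ?thesis .
  qed
  have "(\<lambda>n. 2 * B / s\<^sup>2 * t n) \<longlonglongrightarrow> 0"
    unfolding t_def by (rule tendsto_mult_right_zero[OF LIMSEQ_Suc[OF lim_const_over_n]])
  then have "uniform_limit (ball z0 (e/4)) g (\<lambda>z. frechet_derivative f (at z) v) sequentially"
  proof (intro uniform_limitI)
    fix \<epsilon> :: real assume lim: "(\<lambda>n. 2 * B / s\<^sup>2 * t n) \<longlonglongrightarrow> 0" and "\<epsilon> > 0"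
    then have "\<forall>\<^sub>F n in sequentially. 2 * B / s\<^sup>2 * t n < \<epsilon>"
      by (rule order_tendstoD(2))
    then show "\<forall>\<^sub>F n in sequentially. \<forall>z\<in>ball z0 (e/4). dist (g n z) (frechet_derivative f (at z) v) < \<epsilon>"
    proof (rule eventually_mono, intro ballI)
      fix n z assume "2 * B / s\<^sup>2 * t n < \<epsilon>" "z \<in> ball z0 (e/4)"
      then show "dist (g n z) (frechet_derivative f (at z) v) < \<epsilon>"
        unfolding dist_norm using est[of z n] by linarith
    qed
  qed
  then have "holomorphic_fun (ball z0 (e/4)) (\<lambda>z. frechet_derivative f (at z) v)"
    by (rule holomorphic_fun_uniform_limit[OF open_ball hg])
  then show "\<exists>T. z0 \<in> T \<and> holomorphic_fun T (\<lambda>z. frechet_derivative f (at z) v)"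
    using e by (intro exI[of _ "ball z0 (e/4)"]) auto
qed

lemma holomorphic_vec_frechet_holomorphic:
  fixes f :: "complex ^ 'k::finite \<Rightarrow> complex ^ 'l::finite"
  assumes S: "open S" and f: "holomorphic_vec S f"
  shows "holomorphic_vec S (\<lambda>z. frechet_derivative f (at z) v)"
  unfolding holomorphic_vec_def
proof
  fix i
  have "holomorphic_fun S (\<lambda>z. f z $ i)"
    using f by (simp add: holomorphic_vec_def)
  from holomorphic_fun_frechet_holomorphic[OF S this]
  show "holomorphic_fun S (\<lambda>z. frechet_derivative f (at z) v $ i)"
    by (rule holomorphic_fun_cong[OF _ S]) (simp add: holomorphic_vec_frechet(3)[OF f])
qed

section \<open>Germs of derivatives and smooth maps\<close>

lemma frechet_derivative_cong_open:
  assumes "open S" "z \<in> S" "\<And>x. x \<in> S \<Longrightarrow> f x = g x"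
  shows "frechet_derivative f (at z) = frechet_derivative g (at z)"
proof -
  have "(f has_derivative D) (at z) \<longleftrightarrow> (g has_derivative D) (at z)" for D
    using has_derivative_transform_within_open[OF _ assms(1,2), of f D UNIV g]
      has_derivative_transform_within_open[OF _ assms(1,2), of g D UNIV f] assms(3) by auto
  then show ?thesis
    by (simp add: frechet_derivative_def)
qed

lemma C_k_on_cong:
  assumes "open S" "\<And>x. x \<in> S \<Longrightarrow> f x = g x" "C_k_on k S f"
  shows "C_k_on k S g"
  using assms(2,3)
proof (induction k arbitrary: f g)
  case 0
  then show ?case using continuous_on_cong[of S S f g] by simp
next
  case (Suc k)
  have eq: "frechet_derivative f (at x) = frechet_derivative g (at x)" if "x \<in> S" for x
    by (rule frechet_derivative_cong_open[OF assms(1) that Suc.prems(1)])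
  have "C_k_on k S (\<lambda>x. frechet_derivative g (at x) v)" for v
    by (rule Suc.IH[of "\<lambda>x. frechet_derivative f (at x) v"]) (use Suc.prems(2) in \<open>simp_all add: eq\<close>)
  moreover have "g differentiable (at x)" if "x \<in> S" for x
  proof -
    have "(f has_derivative frechet_derivative f (at x)) (at x)"
      using Suc.prems(2) that frechet_derivative_works by auto
    from has_derivative_transform_within_open[OF this assms(1) that Suc.prems(1)]
    show ?thesis by (rule differentiableI)
  qed
  ultimately show ?case
    by simp
qed

lemma C_k_on_bounded_linear:
  assumes S: "open S" and L: "bounded_linear L" and f: "C_k_on k S f"
  shows "C_k_on k S (\<lambda>x. L (f x))"
  using f
proof (induction k arbitrary: f)
  case 0
  then show ?case
    by (simp add: bounded_linear.continuous_on[OF L])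
next
  case (Suc k)
  have d: "((\<lambda>x. L (f x)) has_derivative (\<lambda>v. L (frechet_derivative f (at x) v))) (at x)" if "x \<in> S" for x
  proof (rule bounded_linear.has_derivative[OF L])
    show "(f has_derivative frechet_derivative f (at x)) (at x)"
      using Suc.prems that by (simp add: frechet_derivative_works)
  qed
  have "C_k_on k S (\<lambda>x. frechet_derivative (\<lambda>x. L (f x)) (at x) v)" for v
  proof (rule C_k_on_cong[OF S _ Suc.IH])
    show "L (frechet_derivative f (at x) v) = frechet_derivative (\<lambda>x. L (f x)) (at x) v" if "x \<in> S" for x
      using frechet_derivative_at[OF d[OF that]] by metis
  qed (use Suc.prems in simp)
  moreover have "(\<lambda>x. L (f x)) differentiable (at x)" if "x \<in> S" for x
    using d[OF that] by (rule differentiableI)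
  ultimately show ?case by simp
qed

text \<open>Directional derivatives are holomorphic again, so the induction over \<open>k\<close>
  runs over all holomorphic maps at once.\<close>

lemma holomorphic_vec_smooth:
  fixes f :: "complex ^ 'k::finite \<Rightarrow> complex ^ 'l::finite"
  assumes S: "open S" and f: "holomorphic_vec S f"
  shows "smooth_vec S f"
proof -
  have "C_k_on k S f" for k
    using f
  proof (induction k arbitrary: f)
    case 0
    then show ?case using holomorphic_vec_continuous_on by auto
  next
    case (Suc k)
    have "f differentiable (at x)" if "x \<in> S" for x
      using holomorphic_vec_frechet(1)[OF Suc.prems that] differentiable_def by blast
    then show ?case
      using Suc.IH[OF holomorphic_vec_frechet_holomorphic[OF S Suc.prems]] by simp
  qed
  then show ?thesis by (simp add: smooth_vec_def)
qed

lemma smooth_vec_bounded_linear: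
  "open S \<Longrightarrow> bounded_linear L \<Longrightarrow> smooth_vec S f \<Longrightarrow> smooth_vec S (\<lambda>x. L (f x))"
  unfolding smooth_vec_def by (auto intro: C_k_on_bounded_linear)

lemma smooth_vec_cong:
  assumes "open S" "smooth_vec S f" "\<And>x. x \<in> S \<Longrightarrow> f x = g x"
  shows "smooth_vec S g"
  unfolding smooth_vec_def
proof
  show "C_k_on k S g" for k
    by (rule C_k_on_cong[OF assms(1,3)]) (use assms(2) in \<open>auto simp: smooth_vec_def\<close>)
qed

section \<open>Complexified coordinates\<close>

text \<open>A pair \<open>(z, w)\<close>, the second factor taken with the conjugate complex structure: its
  holomorphic coordinates are \<open>z\<close> and \<open>cnj w\<close>. The functions \<open>sndc\<close> and \<open>conjc\<close> are conjugate-linear.\<close>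

definition pairc :: "complex ^ 'n \<Rightarrow> complex ^ 'n \<Rightarrow> complex ^ ('n::finite + 'n)" where
  "pairc z w = (\<chi> i. case i of Inl j \<Rightarrow> z $ j | Inr j \<Rightarrow> cnj (w $ j))"

definition fstc :: "complex ^ ('n::finite + 'n) \<Rightarrow> complex ^ 'n" where
  "fstc A = (\<chi> j. A $ Inl j)"

definition sndc :: "complex ^ ('n::finite + 'n) \<Rightarrow> complex ^ 'n" where
  "sndc A = (\<chi> j. cnj (A $ Inr j))"

text \<open>The exchange of the two factors. In these coordinates it is conjugate-linear and its
  fixed points form the diagonal, which is thereby a real form of the space.\<close>

definition conjc :: "complex ^ ('n::finite + 'n) \<Rightarrow> complex ^ ('n + 'n)" where
  "conjc A = pairc (sndc A) (fstc A)"

abbreviation diagc :: "complex ^ 'n \<Rightarrow> complex ^ ('n::finite + 'n)" where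
  "diagc z \<equiv> pairc z z"

definition cdom :: "(complex ^ 'n) set \<Rightarrow> (complex ^ ('n::finite + 'n)) set" where
  "cdom B = {A. fstc A \<in> B \<and> sndc A \<in> B}"

text \<open>\<open>rec\<close> and \<open>imc\<close> are the real and imaginary part with respect
  to this real form. The diagonal is parametrised by \<open>complex ^ 'n\<close>, so both are
  complex vectors themselves.\<close>

definition rec :: "complex ^ ('n::finite + 'n) \<Rightarrow> complex ^ 'n" where
  "rec A = (1/2) *s (fstc A + sndc A)"

definition imc :: "complex ^ ('n::finite + 'n) \<Rightarrow> complex ^ 'n" where
  "imc A = (- \<i>/2) *s (fstc A - sndc A)"

lemma pairc_nth [simp]: "pairc z w $ Inl j = z $ j" "pairc z w $ Inr j = cnj (w $ j)"
  by (simp_all add: pairc_def)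

lemma fstc_nth [simp]: "fstc A $ j = A $ Inl j"
  and sndc_nth [simp]: "sndc A $ j = cnj (A $ Inr j)"
  by (simp_all add: fstc_def sndc_def)

lemma vec_sum_eq_iff: "A = B \<longleftrightarrow> (\<forall>j. A $ Inl j = B $ Inl j) \<and> (\<forall>j. A $ Inr j = B $ Inr j)"
  for A B :: "'a ^ ('n::finite + 'm::finite)"
  unfolding vec_eq_iff by (metis sum.exhaust)

lemma fstc_pairc [simp]: "fstc (pairc z w) = z" and sndc_pairc [simp]: "sndc (pairc z w) = w"
  by (simp_all add: vec_eq_iff)

lemma pairc_fstc_sndc [simp]: "pairc (fstc A) (sndc A) = A"
  by (simp add: vec_sum_eq_iff)

lemma fstc_conjc [simp]: "fstc (conjc A) = sndc A" and sndc_conjc [simp]: "sndc (conjc A) = fstc A"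
  and conjc_pairc [simp]: "conjc (pairc z w) = pairc w z"
  and conjc_conjc [simp]: "conjc (conjc A) = A"
  by (simp_all add: conjc_def)

lemma fstc_simps [simp]: "fstc (A + B) = fstc A + fstc B" "fstc (A - B) = fstc A - fstc B"
  "fstc (c *s A) = c *s fstc A" "fstc (r *\<^sub>R A) = r *\<^sub>R fstc A" "fstc 0 = 0"
  by (simp_all add: vec_eq_iff)

lemma sndc_simps [simp]: "sndc (A + B) = sndc A + sndc B" "sndc (A - B) = sndc A - sndc B"
  "sndc (c *s A) = cnj c *s sndc A" "sndc (r *\<^sub>R A) = r *\<^sub>R sndc A" "sndc 0 = 0"
  by (simp_all add: vec_eq_iff)

lemma conjc_simps: "conjc (A + B) = conjc A + conjc B"
  "conjc (c *s A) = cnj c *s conjc A" "conjc (r *\<^sub>R A) = r *\<^sub>R conjc A"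
  by (simp_all add: vec_sum_eq_iff conjc_def)

lemma pairc_simps: "pairc (z + z') (w + w') = pairc z w + pairc z' w'"
  "pairc (r *\<^sub>R z) (r *\<^sub>R w) = r *\<^sub>R pairc z w"
  by (simp_all add: vec_sum_eq_iff)

lemma bounded_linear_complexified: "bounded_linear fstc" "bounded_linear sndc" "bounded_linear conjc"
  "bounded_linear diagc"
  unfolding linear_conv_bounded_linear[symmetric]
  by (rule linearI; simp add: conjc_simps pairc_simps)+

lemma complexified_eqI: "fstc A = fstc B \<Longrightarrow> sndc A = sndc B \<Longrightarrow> A = B"
  by (metis pairc_fstc_sndc)

lemma complexified_decompose: "A = diagc (rec A) + \<i> *s diagc (imc A)"
  by (rule complexified_eqI) (simp_all add: rec_def imc_def vec_eq_iff field_simps)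

lemma rec_simps [simp]: "rec (A + B) = rec A + rec B" "rec (r *\<^sub>R A) = r *\<^sub>R rec A"
  "rec (\<i> *s A) = - imc A" "rec (conjc A) = rec A" "rec (diagc u) = u"
  by (simp_all add: rec_def imc_def vec_eq_iff algebra_simps)

lemma imc_simps [simp]: "imc (A + B) = imc A + imc B" "imc (r *\<^sub>R A) = r *\<^sub>R imc A"
  "imc (\<i> *s A) = rec A" "imc (conjc A) = - imc A" "imc (diagc u) = 0"
  by (simp_all add: rec_def imc_def vec_eq_iff algebra_simps)

lemma open_cdom: "open B \<Longrightarrow> open (cdom B)"
proof -
  assume B: "open B"
  have "open (fstc -` B)" "open (sndc -` B)"
    by (intro open_vimage B linear_continuous_on bounded_linear_complexified)+
  then show "open (cdom B)"
    by (simp add: cdom_def vimage_def Collect_conj_eq open_Int)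
qed

lemma diagc_in_cdom [simp]: "diagc z \<in> cdom B \<longleftrightarrow> z \<in> B"
  by (simp add: cdom_def)

lemma conjc_in_cdom [simp]: "conjc A \<in> cdom B \<longleftrightarrow> A \<in> cdom B"
  by (auto simp: cdom_def)

lemma holomorphic_vec_fstc: "holomorphic_vec S fstc"
  by (rule holomorphic_vec_linear) (simp_all add: bounded_linear_complexified)

text \<open>The points \<open>diagc a + l *s diagc b\<close> with real \<open>l\<close> lie on the diagonal, and \<open>l = \<i>\<close>
  reaches an arbitrary point.\<close>

lemma identity_from_diagonal:
  fixes B :: "(complex ^ 'n::finite) set"
  assumes B: "convex B" "open B" and G: "holomorphic_fun (cdom B) G"
    and 0: "\<And>z. z \<in> B \<Longrightarrow> G (diagc z) = 0" and A: "A \<in> cdom B"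
  shows "G A = 0"
proof -
  define a b where "a = rec A" and "b = imc A"
  have A_eq: "A = diagc a + \<i> *s diagc b"
    unfolding a_def b_def by (rule complexified_decompose)
  define \<Lambda> where "\<Lambda> = {l. diagc a + l *s diagc b \<in> cdom B}"
  \<comment> \<open>\<open>sndc\<close> is conjugate-linear, hence the second condition on
    \<open>cnj l\<close>. Both conditions are convex in \<open>l\<close>, and convexity makes
    \<open>\<Lambda>\<close> connected.\<close>
  have \<Lambda>: "\<Lambda> = {l. a + l *s b \<in> B \<and> a + cnj l *s b \<in> B}"
    by (simp add: \<Lambda>_def cdom_def)
  \<comment> \<open>\<open>a\<close> is the midpoint of the two components of
    \<open>A\<close>.\<close>
  have a: "a \<in> B"
  proof -
    have "a = (1/2) *\<^sub>R fstc A + (1/2) *\<^sub>R sndc A"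
      by (simp add: a_def rec_def scaleR_cvec vec_eq_iff algebra_simps)
    then show ?thesis
      using A B(1) by (auto simp: cdom_def intro!: convexD)
  qed
  have "convex \<Lambda>"
  proof (rule convexI)
    fix l m :: complex and u v :: real
    assume lm: "l \<in> \<Lambda>" "m \<in> \<Lambda>" and uv: "u \<ge> 0" "v \<ge> 0" "u + v = 1"
    have c: "a + (of_real u * l + of_real v * m) *s b \<in> B" if "a + l *s b \<in> B" "a + m *s b \<in> B" for l m
    proof -
      have 1: "u *\<^sub>R a + v *\<^sub>R a = a"
        using uv(3) by (simp flip: scaleR_add_left)
      have "u *\<^sub>R (a + l *s b) + v *\<^sub>R (a + m *s b)
          = (u *\<^sub>R a + v *\<^sub>R a) + (of_real u * l + of_real v * m) *s b"
        by (simp add: vec_eq_iff scaleR_conv_of_real[where 'a = complex] algebra_simps)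
      then show ?thesis
        using convexD[OF B(1) that uv] unfolding 1 by simp
    qed
    show "u *\<^sub>R l + v *\<^sub>R m \<in> \<Lambda>"
      using lm c[of l m] c[of "cnj l" "cnj m"] unfolding \<Lambda> mem_Collect_eq scaleR_conv_of_real
        complex_cnj_add complex_cnj_mult complex_cnj_complex_of_real by blast
  qed
  have op: "open \<Lambda>"
    unfolding \<Lambda>_def by (rule open_line_preimage[OF open_cdom[OF B(2)]])
  have 0: "0 \<in> \<Lambda>" and i: "\<i> \<in> \<Lambda>"
    using a A A_eq by (simp_all add: \<Lambda> \<Lambda>_def)
       (use a in \<open>simp add: \<Lambda>_def cdom_def\<close>)?
  define U where "U = \<Lambda> \<inter> range complex_of_real"
  have lim: "0 islimpt U"
  proof -
    have "\<exists>x'\<in>U. x' \<noteq> 0 \<and> dist x' 0 < e" if "e > 0" for e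
    proof -
      obtain d where d: "d > 0" "ball 0 d \<subseteq> \<Lambda>"
        using op 0 open_contains_ball by blast
      have "complex_of_real (min d e / 2) \<in> U" "complex_of_real (min d e / 2) \<noteq> 0"
        "dist (complex_of_real (min d e / 2)) 0 < e"
        using d that by (auto simp: U_def norm_of_real subset_iff simp del: of_real_divide)
      then show ?thesis by blast
    qed
    then show ?thesis by (simp add: islimpt_approachable)
  qed
  have "G (diagc a + \<i> *s diagc b) = 0"
  proof (rule analytic_continuation[OF _ op convex_connected[OF \<open>convex \<Lambda>\<close>] _ 0 lim _ i])
    show "(\<lambda>l. G (diagc a + l *s diagc b)) holomorphic_on \<Lambda>"
      by (rule holomorphic_fun_line_holomorphic_on[OF G]) (simp add: \<Lambda>_def)
    show "G (diagc a + l *s diagc b) = 0" if l: "l \<in> U" for l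
    proof -
      obtain r where r: "l = complex_of_real r" using l unfolding U_def by blast
      have "diagc a + l *s diagc b = diagc (a + l *s b)"
        by (rule complexified_eqI) (simp_all add: r)
      moreover have "a + l *s b \<in> B"
        using l by (simp add: U_def \<Lambda>)
      ultimately show ?thesis
        using assms(4) by simp
    qed
  qed (auto simp: U_def)
  then show ?thesis
    using A_eq by simp
qed

text \<open>The complex-linear extension of the real coordinate \<open>\<lambda>u. u \<bullet> e\<close> from the diagonal.\<close>

definition coordc :: "complex ^ 'n \<Rightarrow> complex ^ ('n::finite + 'n) \<Rightarrow> complex" where
  "coordc e A = complex_of_real (rec A \<bullet> e) + \<i> * complex_of_real (imc A \<bullet> e)"

lemma coordc_simps [simp]: "coordc e (A + B) = coordc e A + coordc e B"
  "coordc e (r *\<^sub>R A) = complex_of_real r * coordc e A"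
  "coordc e (diagc u) = complex_of_real (u \<bullet> e)" "coordc e (conjc A) = cnj (coordc e A)"
  by (simp_all add: coordc_def inner_add_left algebra_simps)

lemma coordc_scale [simp]: "coordc e (c *s A) = c * coordc e A"
proof -
  have i: "coordc e (\<i> *s A) = \<i> * coordc e A" for A
    by (simp add: coordc_def algebra_simps)
  have "c *s A = Re c *\<^sub>R A + Im c *\<^sub>R (\<i> *s A)"
    by (simp add: vec_eq_iff complex_eq_iff)
  then have "coordc e (c *s A) = (Re c + \<i> * Im c) * coordc e A"
    by (simp add: i algebra_simps)
  then show ?thesis by (simp flip: complex_eq)
qed

lemma bounded_linear_coordc: "bounded_linear (coordc e)"
  unfolding linear_conv_bounded_linear[symmetric]
  by (rule linearI) (simp_all add: scaleR_conv_of_real[where 'a = complex])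

lemma holomorphic_fun_coordc: "holomorphic_fun S (coordc e)"
  by (rule holomorphic_fun_linear[OF bounded_linear_coordc]) simp

text \<open>After translation by the centre, the two norms on the right are what membership in
  \<open>cdom (ball x r)\<close> controls.\<close>

lemma coordc_bound:
  assumes "e \<in> Basis"
  shows "cmod (coordc e A) \<le> norm (fstc A) + norm (sndc A)"
proof -
  have 1: "norm (rec A) \<le> (norm (fstc A) + norm (sndc A)) / 2"
    and 2: "norm (imc A) \<le> (norm (fstc A) + norm (sndc A)) / 2"
    using norm_triangle_ineq[of "fstc A" "sndc A"] norm_triangle_ineq4[of "fstc A" "sndc A"]
    unfolding rec_def imc_def norm_cvec_scale by (simp_all add: norm_divide)
  have "cmod (coordc e A) \<le> norm (rec A) + norm (imc A)"
    unfolding coordc_def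
    using Basis_le_norm[OF assms, of "rec A"] Basis_le_norm[OF assms, of "imc A"]
    by (intro order_trans[OF norm_triangle_ineq]) (simp add: norm_mult)
  also have "\<dots> \<le> (norm (fstc A) + norm (sndc A)) / 2 + (norm (fstc A) + norm (sndc A)) / 2"
    by (rule add_mono[OF 1 2])
  finally show ?thesis by (simp only: field_sum_of_halves)
qed

text \<open>Each real coordinate in the power series is replaced by its complex-linear extension.
  The series converges unconditionally at real points, hence absolutely, and its absolute terms at a
  single point with all coordinates equal dominate the complexified series near the diagonal point;
  the Weierstrass test applies.\<close>

lemma real_analytic_complexification:
  fixes f :: "complex ^ 'n::finite \<Rightarrow> real"
  assumes "real_analytic_fun S f" "x \<in> S"
  obtains r F where "r > 0" "holomorphic_fun (cdom (ball x r)) F"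
    "\<And>z. z \<in> ball x r \<Longrightarrow> F (diagc z) = complex_of_real (f z)"
proof -
  let ?I = "(Basis :: (complex ^ 'n) set) \<rightarrow>\<^sub>E (UNIV :: nat set)"
  obtain r0 a where r0: "r0 > 0"
    and a: "\<And>y. y \<in> ball x r0 \<Longrightarrow> ((\<lambda>\<alpha>. a \<alpha> * (\<Prod>b\<in>Basis. ((y - x) \<bullet> b) ^ \<alpha> b)) has_sum f y) ?I"
    using assms(1)[unfolded real_analytic_fun_def, rule_format, OF assms(2)] by blast
  define N where "N = DIM(complex ^ 'n)"
  have N: "N \<ge> 1" unfolding N_def by (rule DIM_ge_Suc0[unfolded One_nat_def[symmetric]])
  \<comment> \<open>The comparison point \<open>y\<close> has all its \<open>N\<close> real
    coordinates relative to \<open>x\<close> equal to \<open>\<rho>\<close>, so its distance from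
    \<open>x\<close> is at most \<open>N * \<rho> = r0 / 2\<close>.\<close>
  define \<rho> where "\<rho> = r0 / (2 * real N)"
  have \<rho>: "\<rho> > 0" "\<rho> \<le> r0"
    using r0 N mult_left_mono[of 1 "real N" r0] by (simp_all add: \<rho>_def divide_le_eq)
  define y where "y = x + (\<Sum>b\<in>Basis. \<rho> *\<^sub>R b)"
  have "norm (\<Sum>b\<in>Basis. \<rho> *\<^sub>R b :: complex ^ 'n) \<le> (\<Sum>b\<in>(Basis :: (complex ^ 'n) set). \<rho>)"
    using \<rho> by (intro sum_norm_le) auto
  also have "\<dots> = r0 / 2"
    using N by (simp only: \<rho>_def sum_constant N_def[symmetric]) (simp add: field_simps)
  finally have y: "y \<in> ball x r0"
    using r0 by (simp add: y_def dist_norm)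
  have yb: "(y - x) \<bullet> b = \<rho>" if "b \<in> Basis" for b
    using that by (simp add: y_def inner_sum_left inner_Basis if_distrib cong: if_cong)
  define M where "M \<alpha> = \<bar>a \<alpha>\<bar> * (\<Prod>b\<in>(Basis :: (complex ^ 'n) set). \<rho> ^ \<alpha> b)" for \<alpha> :: "complex ^ 'n \<Rightarrow> nat"
  have M: "M summable_on ?I"
  proof -
    have "(\<lambda>\<alpha>. a \<alpha> * (\<Prod>b\<in>Basis. ((y - x) \<bullet> b) ^ \<alpha> b)) summable_on ?I"
      using a[OF y] has_sum_imp_summable by blast
    then have "(\<lambda>\<alpha>. norm (a \<alpha> * (\<Prod>b\<in>Basis. ((y - x) \<bullet> b) ^ \<alpha> b))) summable_on ?I"
      by (rule summable_on_iff_abs_summable_on_real[THEN iffD1])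
    also have "(\<lambda>\<alpha>. norm (a \<alpha> * (\<Prod>b\<in>Basis. ((y - x) \<bullet> b) ^ \<alpha> b))) = M"
      using \<rho> by (simp add: M_def fun_eq_iff abs_mult abs_prod yb power_abs)
    finally show ?thesis .
  qed
  \<comment> \<open>By \<open>coordc_bound\<close> every complex coordinate is bounded by a sum of
    two norms below \<open>r\<close>, hence by \<open>\<rho>\<close>.\<close>
  define r where "r = \<rho> / 2"
  define t where "t \<alpha> A = complex_of_real (a \<alpha>) * (\<Prod>b\<in>Basis. coordc b (A + diagc (- x)) ^ \<alpha> b)" for \<alpha> A
  define F where "F A = (\<Sum>\<^sub>\<infinity>\<alpha>\<in>?I. t \<alpha> A)" for A
  have ht: "holomorphic_fun S' (t \<alpha>)" for S' \<alpha>
    unfolding t_def by (intro holomorphic_fun_mult holomorphic_fun_const holomorphic_fun_prod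
        holomorphic_fun_power holomorphic_fun_compose[OF holomorphic_fun_coordc[of UNIV] holomorphic_vec_translate]) simp
  have bt: "cmod (t \<alpha> A) \<le> M \<alpha>" if A: "A \<in> cdom (ball x r)" for A \<alpha>
  proof -
    define c where "c b = coordc b (A + diagc (- x))" for b
    have "cmod (c b) \<le> \<rho>" if "b \<in> Basis" for b
      unfolding c_def
      using coordc_bound[OF that, of "A + diagc (- x)"] A
      by (simp add: cdom_def dist_norm norm_minus_commute[of x] r_def del: coordc_simps)
    then have "\<bar>a \<alpha>\<bar> * (\<Prod>b\<in>Basis. cmod (c b) ^ \<alpha> b) \<le> M \<alpha>"
      unfolding M_def by (intro mult_left_mono prod_mono conjI power_mono) auto
    then show ?thesis
      unfolding t_def c_def[symmetric] norm_mult prod_norm[symmetric] norm_power by simp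
  qed
  have ul: "uniform_limit (cdom (ball x r)) (\<lambda>X A. \<Sum>\<alpha>\<in>X. t \<alpha> A) F (finite_subsets_at_top ?I)"
    unfolding F_def by (rule Weierstrass_m_test_general[OF bt M])
  \<comment> \<open>\<open>holomorphic_fun_uniform_limit\<close> is about sequences, so a sequence
    is extracted from the net of finite partial sums.\<close>
  have "\<exists>X. \<forall>A\<in>cdom (ball x r). dist (\<Sum>\<alpha>\<in>X. t \<alpha> A) (F A) < 1 / real (Suc n)" for n
  proof -
    have "\<forall>\<^sub>F X in finite_subsets_at_top ?I. \<forall>A\<in>cdom (ball x r). dist (\<Sum>\<alpha>\<in>X. t \<alpha> A) (F A) < 1 / real (Suc n)"
      by (rule uniform_limitD[OF ul]) simp
    then show ?thesis
      by (rule eventually_happens'[OF finite_subsets_at_top_neq_bot])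
  qed
  then obtain X where X: "\<And>n A. A \<in> cdom (ball x r) \<Longrightarrow> dist (\<Sum>\<alpha>\<in>X n. t \<alpha> A) (F A) < 1 / real (Suc n)"
    by metis
  have "uniform_limit (cdom (ball x r)) (\<lambda>n A. \<Sum>\<alpha>\<in>X n. t \<alpha> A) F sequentially"
  proof (rule uniform_limitI)
    fix e :: real assume "e > 0"
    then have "\<forall>\<^sub>F n in sequentially. 1 / real (Suc n) < e"
      using order_tendstoD(2)[OF LIMSEQ_Suc[OF lim_const_over_n[of "1::real"]]] by simp
    then show "\<forall>\<^sub>F n in sequentially. \<forall>A\<in>cdom (ball x r). dist (\<Sum>\<alpha>\<in>X n. t \<alpha> A) (F A) < e"
      by (rule eventually_mono) (use X less_trans in blast)
  qed
  then have "holomorphic_fun (cdom (ball x r)) F"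
    by (rule holomorphic_fun_uniform_limit[OF open_cdom[OF open_ball] holomorphic_fun_sum[OF ht]])
  moreover have "F (diagc z) = complex_of_real (f z)" if z: "z \<in> ball x r" for z
  proof -
    have "z \<in> ball x r0" using z \<rho> by (auto simp: r_def)
    from has_sum_of_real[OF a[OF this], where ?'a = complex]
    have "((\<lambda>\<alpha>. t \<alpha> (diagc z)) has_sum complex_of_real (f z)) ?I"
      by (simp add: t_def inner_diff_left)
    then show ?thesis
      unfolding F_def by (rule infsumI)
  qed
  moreover have "r > 0" using \<rho> by (simp add: r_def)
  ultimately show ?thesis using that by blast
qed

section \<open>A metric on a regular second countable space\<close>

text \<open>Urysohn functions for the countably many pairs of basic sets \<open>V\<close>,
  \<open>W\<close> with the closure of \<open>V\<close> inside \<open>W\<close>. A regular Lindelof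
  space is normal, so they exist, and regularity puts such a pair between any point and any of its
  open neighbourhoods.\<close>

lemma second_countable_regular_separating_functions:
  assumes X: "second_countable X" "regular_space X"
  obtains f :: "nat \<Rightarrow> 'a \<Rightarrow> real"
  where "\<And>n. continuous_map X (top_of_set {0..1}) (f n)"
    "\<And>U x. openin X U \<Longrightarrow> x \<in> U \<Longrightarrow> \<exists>n. f n x = 0 \<and> (\<forall>y\<in>topspace X - U. f n y = 1)"
proof -
  obtain \<B> where \<B>0: "countable \<B> \<and> (\<forall>V\<in>\<B>. openin X V) \<and>
      (\<forall>U x. openin X U \<and> x \<in> U \<longrightarrow> (\<exists>V\<in>\<B>. x \<in> V \<and> V \<subseteq> U))"
    using X(1) unfolding second_countable_def by (rule exE)
  have \<B>: "countable \<B>" "\<And>V. V \<in> \<B> \<Longrightarrow> openin X V"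
    "\<And>U x. openin X U \<Longrightarrow> x \<in> U \<Longrightarrow> \<exists>V\<in>\<B>. x \<in> V \<and> V \<subseteq> U"
    using \<B>0 by simp_all
  have normal: "normal_space X"
    using regular_Lindelof_imp_normal_space[OF X(2) second_countable_imp_Lindelof_space[OF X(1)]] .
  define P where "P = {(V, W). V \<in> \<B> \<and> W \<in> \<B> \<and> X closure_of V \<subseteq> W}"
  have "P \<subseteq> \<B> \<times> \<B>" by (auto simp: P_def)
  then have P: "countable P" by (rule countable_subset) (intro countable_SIGMA \<B>(1))
  have "\<forall>p\<in>P. \<exists>f. continuous_map X (top_of_set {0..1::real}) f \<and> f ` (X closure_of fst p) \<subseteq> {0} \<and>
      f ` (topspace X - snd p) \<subseteq> {1}"
  proof
    fix p assume p: "p \<in> P"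
    have "closedin X (topspace X - snd p)" "disjnt (X closure_of fst p) (topspace X - snd p)"
      using p \<B>(2) by (auto simp: P_def disjnt_def)
    then obtain f where "continuous_map X (top_of_set {0..1::real}) f"
      "f ` (X closure_of fst p) \<subseteq> {0}" "f ` (topspace X - snd p) \<subseteq> {1}"
      by (rule Urysohn_lemma[OF normal closedin_closure_of _ _ zero_le_one])
    then show "\<exists>f. continuous_map X (top_of_set {0..1::real}) f \<and> f ` (X closure_of fst p) \<subseteq> {0} \<and>
      f ` (topspace X - snd p) \<subseteq> {1}" by (intro exI[of _ f] conjI)
  qed
  from bchoice[OF this] obtain g where g: "\<forall>p\<in>P. continuous_map X (top_of_set {0..1::real}) (g p) \<and>
      g p ` (X closure_of fst p) \<subseteq> {0} \<and> g p ` (topspace X - snd p) \<subseteq> {1}"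
    by (rule exE)
  \<comment> \<open>The constant 0 keeps the family nonempty, so that the naturals can enumerate it
    even if \<open>P\<close> is empty.\<close>
  define \<Phi> where "\<Phi> = insert (\<lambda>_. 0) (g ` P)"
  define f where "f = from_nat_into \<Phi>"
  have \<Phi>: "countable \<Phi>" "\<Phi> \<noteq> {}" using P by (auto simp: \<Phi>_def)
  have range: "range f = \<Phi>" unfolding f_def by (rule range_from_nat_into[OF \<Phi>(2,1)])
  show ?thesis
  proof
    show "continuous_map X (top_of_set {0..1}) (f n)" for n
    proof -
      have "f n \<in> \<Phi>" using range by blast
      then consider "f n = (\<lambda>_. 0)" | p where "p \<in> P" "f n = g p" by (auto simp: \<Phi>_def)
      then show ?thesis using g by cases simp_all
    qed
    show "\<exists>n. f n x = 0 \<and> (\<forall>y\<in>topspace X - U. f n y = 1)" if U: "openin X U" "x \<in> U" for U x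
    proof -
      obtain W where W: "W \<in> \<B>" "x \<in> W" "W \<subseteq> U" using \<B>(3)[OF U] by blast
      have "neighbourhood_base_of (closedin X) X"
        using X(2) neighbourhood_base_of_closedin by blast
      then have "\<exists>V' C. openin X V' \<and> closedin X C \<and> x \<in> V' \<and> V' \<subseteq> C \<and> C \<subseteq> W"
        using W(2) \<B>(2)[OF W(1)] unfolding neighbourhood_base_of by simp
      then obtain V' C where C: "openin X V'" "closedin X C" "x \<in> V'" "V' \<subseteq> C" "C \<subseteq> W"
        by (elim exE conjE)
      obtain V where V: "V \<in> \<B>" "x \<in> V" "V \<subseteq> V'" using \<B>(3)[OF C(1,3)] by blast
      have "X closure_of V \<subseteq> W"
        using closure_of_minimal[OF order_trans[OF V(3) C(4)] C(2)] C(5) by (rule order_trans)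
      then have p: "(V, W) \<in> P" using V W by (simp add: P_def)
      have "x \<in> X closure_of V"
        using V(2) closure_of_subset[OF openin_subset[OF \<B>(2)[OF V(1)]]] by auto
      then have "g (V, W) x = 0" "\<forall>y\<in>topspace X - U. g (V, W) y = 1"
        using bspec[OF g p] W(3) by auto
      moreover have "g (V, W) \<in> range f" using p by (simp add: range \<Phi>_def)
      then obtain n where "g (V, W) = f n" by (rule rangeE)
      ultimately show ?thesis by (intro exI[of _ n]) simp
    qed
  qed
qed

text \<open>The weights \<open>1 / 2 ^ n\<close> bound the supremum and leave only finitely many
  functions to control at a given scale. The choice of small balls rests on symmetry, the triangle
  inequality and the fact that distance balls and open neighbourhoods of a point refine each
  other.\<close>

lemma second_countable_regular_metric:
  assumes X: "second_countable X" "regular_space X"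
  obtains d :: "'a \<Rightarrow> 'a \<Rightarrow> real"
  where "\<And>x y. d x y = d y x" "\<And>x y z. x \<in> topspace X \<Longrightarrow> y \<in> topspace X \<Longrightarrow> z \<in> topspace X \<Longrightarrow> d x z \<le> d x y + d y z"
    "\<And>U x. openin X U \<Longrightarrow> x \<in> U \<Longrightarrow> \<exists>\<rho>>0. \<forall>y\<in>topspace X. d x y < \<rho> \<longrightarrow> y \<in> U"
    "\<And>x \<rho>. x \<in> topspace X \<Longrightarrow> \<rho> > 0 \<Longrightarrow> \<exists>U. openin X U \<and> x \<in> U \<and> (\<forall>y\<in>U. d x y < \<rho>)"
proof -
  obtain f :: "nat \<Rightarrow> 'a \<Rightarrow> real" where f: "\<And>n. continuous_map X (top_of_set {0..1}) (f n)"
    "\<And>U x. openin X U \<Longrightarrow> x \<in> U \<Longrightarrow> \<exists>n. f n x = 0 \<and> (\<forall>y\<in>topspace X - U. f n y = 1)"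
    using second_countable_regular_separating_functions[OF X] by metis
  have f01: "0 \<le> f n x" "f n x \<le> 1" if "x \<in> topspace X" for n x
    using f(1)[of n] that by (auto simp: continuous_map_in_subtopology)
  define e where "e n x y = \<bar>f n x - f n y\<bar> / 2 ^ n" for n x y
  define d where "d x y = (SUP n. e n x y)" for x y
  have e_le: "e n x y \<le> 1 / 2 ^ n" if "x \<in> topspace X" "y \<in> topspace X" for n x y
    unfolding e_def using f01[OF that(1), of n] f01[OF that(2), of n]
    by (intro divide_right_mono) (auto simp: abs_le_iff)
  have bdd: "bdd_above (range (\<lambda>n. e n x y))" if "x \<in> topspace X" "y \<in> topspace X" for x y
  proof (rule bdd_aboveI2)
    show "e n x y \<le> 1" for n
      using e_le[OF that, of n] by (rule order_trans) (simp add: divide_le_eq)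
  qed
  have e_d: "e n x y \<le> d x y" if "x \<in> topspace X" "y \<in> topspace X" for n x y
    unfolding d_def by (rule cSUP_upper[OF UNIV_I bdd[OF that]])
  show ?thesis
  proof
    show "d x y = d y x" for x y
      by (simp add: d_def e_def abs_minus_commute)
    show "d x z \<le> d x y + d y z" if "x \<in> topspace X" "y \<in> topspace X" "z \<in> topspace X" for x y z
      unfolding d_def[of x z]
    proof (rule cSUP_least)
      fix n
      have "e n x z \<le> e n x y + e n y z"
        unfolding e_def add_divide_distrib[symmetric] by (intro divide_right_mono) auto
      then show "e n x z \<le> d x y + d y z"
        using e_d[OF that(1,2), of n] e_d[OF that(2,3), of n] by linarith
    qed simp
    show "\<exists>\<rho>>0. \<forall>y\<in>topspace X. d x y < \<rho> \<longrightarrow> y \<in> U" if U: "openin X U" "x \<in> U" for U x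
    proof -
      obtain n where n: "f n x = 0" "\<And>y. y \<in> topspace X - U \<Longrightarrow> f n y = 1"
        using f(2)[OF U] by blast
      have x: "x \<in> topspace X" using U openin_subset by blast
      have "y \<in> U" if y: "y \<in> topspace X" "d x y < 1 / 2 ^ n" for y
      proof (rule ccontr)
        assume "y \<notin> U"
        then have "e n x y = 1 / 2 ^ n" using n y(1) by (simp add: e_def)
        then show False using e_d[OF x y(1), of n] y(2) by simp
      qed
      then show ?thesis by (intro exI[of _ "1 / 2 ^ n"]) simp
    qed
    show "\<exists>U. openin X U \<and> x \<in> U \<and> (\<forall>y\<in>U. d x y < \<rho>)" if x: "x \<in> topspace X" and \<rho>: "\<rho> > 0" for x \<rho>
    proof -
      \<comment> \<open>The terms from index \<open>N\<close> on are below \<open>\<rho> / 2\<close>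
        for all points; the others are small on an open set by continuity.\<close>
      obtain N where N: "(1/2) ^ N < \<rho> / 2"
        using real_arch_pow_inv[of "\<rho> / 2" "1/2"] \<rho> by auto
      define W where "W n = {y \<in> topspace X. f n y \<in> ball (f n x) (\<rho> / 2)}" for n
      have W: "openin X (W n)" for n
      proof -
        have "continuous_map X euclideanreal (f n)"
          using f(1)[of n] by (simp add: continuous_map_in_subtopology)
        from openin_continuous_map_preimage[OF this, of "ball (f n x) (\<rho> / 2)"] show ?thesis
          by (simp add: W_def)
      qed
      \<comment> \<open>The factor \<open>topspace X\<close> supplies the neighbourhood when
        \<open>N = 0\<close> and there is nothing to intersect.\<close>
      define U where "U = topspace X \<inter> (\<Inter>n\<in>{..<N}. W n)"
      have "openin X U"
      proof (cases "N = 0")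
        case False
        then have "U = (\<Inter>n\<in>{..<N}. W n)" by (auto simp: U_def W_def)
        then show ?thesis using False W by (auto intro!: openin_INT2)
      qed (simp add: U_def)
      moreover have "x \<in> U" using x \<rho> by (simp add: U_def W_def)
      moreover have "d x y < \<rho>" if y: "y \<in> U" for y
      proof -
        have yX: "y \<in> topspace X" using y by (simp add: U_def)
        have "e n x y \<le> \<rho> / 2" for n
        proof (cases "n < N")
          case True
          then have "\<bar>f n x - f n y\<bar> < \<rho> / 2" using y by (auto simp: U_def W_def dist_real_def)
          then show ?thesis
            unfolding e_def using \<rho> by (simp add: divide_le_eq)
              (smt (verit) mult_le_cancel_left1 one_le_numeral one_le_power)
        next
          case False
          then have "(1/2::real) ^ n \<le> (1/2) ^ N" by (intro power_decreasing) auto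
          then show ?thesis using e_le[OF x yX, of n] N by (simp add: power_one_over)
        qed
        \<comment> \<open>A supremum may attain the bound of its terms; aiming at
          \<open>\<rho> / 2\<close> restores the strict inequality.\<close>
        then have "d x y \<le> \<rho> / 2" unfolding d_def by (intro cSUP_least) auto
        then show ?thesis using \<rho> by linarith
      qed
      ultimately show ?thesis by blast
    qed
  qed
qed

section \<open>Complexified 2-forms in coordinates\<close>

text \<open>The diagonal is totally real: its vectors span the whole space over the complex
  numbers.\<close>

lemma clinear_zero:
  fixes l :: "complex ^ ('n::finite + 'n) \<Rightarrow> complex"
  assumes "\<And>X Y. l (X + Y) = l X + l Y" "\<And>c X. l (c *s X) = c * l X" "\<And>u. l (diagc u) = 0"
  shows "l X = 0"
  by (subst complexified_decompose[of X]) (simp only: assms, simp)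

text \<open>Propagation in two respects: from diagonal vectors to all vectors by complex
  bilinearity, and from diagonal base points to all of \<open>cdom B\<close> by
  \<open>identity_from_diagonal\<close>. Independence of the chart, reality, alternation and the
  isotropy of the fibres are all instances.\<close>

lemma bilinear_identity:
  fixes B :: "(complex ^ 'n::finite) set"
  assumes B: "open B" "convex B" and hol: "\<And>X Y. holomorphic_fun (cdom B) (\<lambda>A. T A X Y)"
    and l: "\<And>A X X' Y. A \<in> cdom B \<Longrightarrow> T A (X + X') Y = T A X Y + T A X' Y"
      "\<And>A c X Y. A \<in> cdom B \<Longrightarrow> T A (c *s X) Y = c * T A X Y"
    and r: "\<And>A X Y Y'. A \<in> cdom B \<Longrightarrow> T A X (Y + Y') = T A X Y + T A X Y'"
      "\<And>A c X Y. A \<in> cdom B \<Longrightarrow> T A X (c *s Y) = c * T A X Y"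
    and 0: "\<And>z u v. z \<in> B \<Longrightarrow> T (diagc z) (diagc u) (diagc v) = 0"
    and A: "A \<in> cdom B"
  shows "T A X Y = 0"
proof (rule identity_from_diagonal[OF B(2,1) hol _ A])
  fix z assume z: "z \<in> B"
  then have d: "diagc z \<in> cdom B" by simp
  show "T (diagc z) X Y = 0"
  proof (rule clinear_zero[of "\<lambda>X. T (diagc z) X Y"])
    show "T (diagc z) (diagc u) Y = 0" for u
      by (rule clinear_zero[of "T (diagc z) (diagc u)"]) (simp_all only: r[OF d] 0[OF z])
  qed (simp_all only: l[OF d])
qed

text \<open>The complex-bilinear extension of a real form with coefficients \<open>F e f\<close>.
  The sums range over the real basis of \<open>complex ^ 'n\<close>, which has as many elements as
  the complexified space has complex dimensions; the functions \<open>coordc e\<close> are its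
  complex coordinates.\<close>

definition bilc :: "(complex ^ 'n \<Rightarrow> complex ^ 'n \<Rightarrow> complex ^ ('n::finite + 'n) \<Rightarrow> complex) \<Rightarrow>
    complex ^ ('n + 'n) \<Rightarrow> complex ^ ('n + 'n) \<Rightarrow> complex ^ ('n + 'n) \<Rightarrow> complex" where
  "bilc F A X Y = (\<Sum>e\<in>Basis. \<Sum>f\<in>Basis. F e f A * (coordc e X * coordc f Y))"

lemma bilc_simps: "bilc F A (X + X') Y = bilc F A X Y + bilc F A X' Y"
  "bilc F A (c *s X) Y = c * bilc F A X Y"
  "bilc F A X (Y + Y') = bilc F A X Y + bilc F A X Y'"
  "bilc F A X (c *s Y) = c * bilc F A X Y"
  unfolding bilc_def coordc_simps coordc_scale sum_distrib_left sum.distrib[symmetric]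
  by (intro sum.cong refl; simp only: algebra_simps)+

lemma bilc_scaleR: "bilc F A (r *\<^sub>R X) Y = r *\<^sub>R bilc F A X Y" "bilc F A X (r *\<^sub>R Y) = r *\<^sub>R bilc F A X Y"
  unfolding scaleR_cvec bilc_simps scaleR_conv_of_real by simp_all

lemma bilinear_bilc: "bilinear (bilc F A)"
  unfolding bilinear_def by (intro conjI allI linearI) (simp_all only: bilc_simps bilc_scaleR)

text \<open>\<open>F\<close> is a family of scalar coefficients because real analyticity of the form
  is given, and complexified, coefficient by coefficient.\<close>

locale local_form =
  fixes B :: "(complex ^ 'n::finite) set" and w :: "complex ^ 'n \<Rightarrow> complex ^ 'n \<Rightarrow> complex ^ 'n \<Rightarrow> real"
    and F :: "complex ^ 'n \<Rightarrow> complex ^ 'n \<Rightarrow> complex ^ ('n + 'n) \<Rightarrow> complex"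
  assumes open_B: "open B" and convex_B: "convex B"
    and F_hol: "\<And>e f. e \<in> Basis \<Longrightarrow> f \<in> Basis \<Longrightarrow> holomorphic_fun (cdom B) (F e f)"
    and F_diag: "\<And>z e f. z \<in> B \<Longrightarrow> e \<in> Basis \<Longrightarrow> f \<in> Basis \<Longrightarrow> F e f (diagc z) = complex_of_real (w z e f)"
    and w_bil: "\<And>z. z \<in> B \<Longrightarrow> bilinear (w z)"
begin

lemma bilc_hol: "holomorphic_fun (cdom B) (\<lambda>A. bilc F A X Y)"
  unfolding bilc_def by (intro holomorphic_fun_sum holomorphic_fun_mult F_hol holomorphic_fun_const)

lemma bilc_compose_hol:
  assumes "holomorphic_vec S g" "\<And>A. A \<in> S \<Longrightarrow> g A \<in> cdom B" "holomorphic_vec S X" "holomorphic_vec S Y"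
  shows "holomorphic_fun S (\<lambda>A. bilc F (g A) (X A) (Y A))"
  unfolding bilc_def
  by (intro holomorphic_fun_sum holomorphic_fun_mult holomorphic_fun_compose[OF F_hol assms(1,2)]
      holomorphic_fun_compose[OF holomorphic_fun_coordc[of UNIV] assms(3)]
      holomorphic_fun_compose[OF holomorphic_fun_coordc[of UNIV] assms(4)] UNIV_I)

lemma bilc_diag: 
  assumes z: "z \<in> B"
  shows "bilc F (diagc z) (diagc u) (diagc v) = complex_of_real (w z u v)"
proof -
  have "bilc F (diagc z) (diagc u) (diagc v)
      = (\<Sum>e\<in>Basis. \<Sum>f\<in>Basis. complex_of_real ((u \<bullet> e) * ((v \<bullet> f) * w z e f)))"
    unfolding bilc_def by (intro sum.cong refl) (simp add: F_diag[OF z])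
  also have "\<dots> = complex_of_real (\<Sum>e\<in>Basis. \<Sum>f\<in>Basis. (u \<bullet> e) * ((v \<bullet> f) * w z e f))"
    by simp
  also have "(\<Sum>e\<in>Basis. \<Sum>f\<in>Basis. (u \<bullet> e) * ((v \<bullet> f) * w z e f)) = w z u v"
  proof -
    have lin: "linear (w z u)" "linear (\<lambda>u. w z u v)" for u v
      using w_bil[OF z] by (simp_all add: bilinear_def)
    have "w z u v = w z (\<Sum>e\<in>Basis. (u \<bullet> e) *\<^sub>R e) v"
      by (simp add: euclidean_representation)
    also have "\<dots> = (\<Sum>e\<in>Basis. (u \<bullet> e) * w z e v)"
      by (simp add: linear_sum[OF lin(2)] linear_scale[OF lin(2)])
    also have "\<dots> = (\<Sum>e\<in>Basis. (u \<bullet> e) * w z e (\<Sum>f\<in>Basis. (v \<bullet> f) *\<^sub>R f))"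
      by (simp add: euclidean_representation)
    also have "\<dots> = (\<Sum>e\<in>Basis. \<Sum>f\<in>Basis. (u \<bullet> e) * ((v \<bullet> f) * w z e f))"
      by (simp add: linear_sum[OF lin(1)] linear_scale[OF lin(1)] sum_distrib_left)
    finally show ?thesis by simp
  qed
  finally show ?thesis .
qed

text \<open>On the diagonal \<open>conjc\<close> is the identity and the form is real, so both sides
  agree there. Conjugating the left side makes it holomorphic in \<open>A\<close> and
  complex-bilinear, ready for propagation.\<close>

lemma bilc_reality:
  assumes A: "A \<in> cdom B"
  shows "bilc F (conjc A) (conjc X) (conjc Y) = cnj (bilc F A X Y)"
proof -
  have "cnj (bilc F (conjc A) (conjc X) (conjc Y)) - bilc F A X Y = 0"
  proof (rule bilinear_identity[OF open_B convex_B, of "\<lambda>A X Y. cnj (bilc F (conjc A) (conjc X) (conjc Y)) - bilc F A X Y"])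
    show "holomorphic_fun (cdom B) (\<lambda>A. cnj (bilc F (conjc A) (conjc X) (conjc Y)) - bilc F A X Y)" for X Y
      by (intro holomorphic_fun_diff bilc_hol holomorphic_fun_cnj_compose[OF bilc_hol])
        (simp_all add: conjc_simps bounded_linear_complexified)
  qed (simp_all add: A bilc_simps conjc_simps bilc_diag algebra_simps)
  then have "cnj (bilc F (conjc A) (conjc X) (conjc Y)) = bilc F A X Y" by simp
  then show ?thesis by (metis complex_cnj_cnj)
qed

end

text \<open>On the second factor \<open>t\<close> is conjugated on both sides: the holomorphic
  coordinate there is the conjugate of \<open>sndc A\<close>, and \<open>pairc\<close> conjugates
  the value of \<open>t\<close> again.\<close>

lemma holomorphic_vec_prodc:
  assumes "holomorphic_vec B t"
  shows "holomorphic_vec (cdom B) (\<lambda>A. pairc (t (fstc A)) (t (sndc A)))"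
  unfolding holomorphic_vec_def
proof
  fix i :: "'b + 'b"
  have t: "holomorphic_fun B (\<lambda>z. t z $ j)" for j
    using assms by (simp add: holomorphic_vec_def)
  show "holomorphic_fun (cdom B) (\<lambda>A. pairc (t (fstc A)) (t (sndc A)) $ i)"
  proof (cases i)
    case (Inl j)
    show ?thesis unfolding Inl pairc_nth
      by (rule holomorphic_fun_compose[OF t holomorphic_vec_fstc]) (simp add: cdom_def)
  next
    case (Inr j)
    show ?thesis unfolding Inr pairc_nth
      by (rule holomorphic_fun_cnj_compose[OF t bounded_linear_complexified(2)]) (simp_all add: cdom_def)
  qed
qed

lemma frechet_derivative_eqI: "(f has_derivative D) (at x) \<Longrightarrow> frechet_derivative f (at x) = D"
  using frechet_derivative_at by metis

text \<open>Along the diagonal the product map is \<open>t\<close> itself; the chain rule for its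
  composite with \<open>diagc\<close> and uniqueness of derivatives give the rest.\<close>

lemma frechet_prodc_diag:
  assumes t: "holomorphic_vec B t" and z: "z \<in> B" and B: "open B"
  shows "frechet_derivative (\<lambda>A. pairc (t (fstc A)) (t (sndc A))) (at (diagc z)) (diagc u)
    = diagc (frechet_derivative t (at z) u)"
proof -
  have 1: "((\<lambda>z. diagc (t z)) has_derivative (\<lambda>u. diagc (frechet_derivative t (at z) u))) (at z)"
    by (rule bounded_linear.has_derivative[OF bounded_linear_complexified(4) holomorphic_vec_frechet(1)[OF t z]])
  have "((\<lambda>z. pairc (t (fstc (diagc z))) (t (sndc (diagc z)))) has_derivative
      (\<lambda>u. frechet_derivative (\<lambda>A. pairc (t (fstc A)) (t (sndc A))) (at (diagc z)) (diagc u))) (at z)"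
    by (rule has_derivative_compose[OF bounded_linear_imp_has_derivative[OF bounded_linear_complexified(4)]
        holomorphic_vec_frechet(1)[OF holomorphic_vec_prodc[OF t]]]) (simp add: z)
  then have "((\<lambda>z. diagc (t z)) has_derivative
      (\<lambda>u. frechet_derivative (\<lambda>A. pairc (t (fstc A)) (t (sndc A))) (at (diagc z)) (diagc u))) (at z)"
    by simp
  from fun_cong[OF has_derivative_unique[OF this 1]] show ?thesis .
qed

lemma frechet_linear:
  assumes "(f has_derivative frechet_derivative f (at z)) (at z)"
  shows "frechet_derivative f (at z) (u + v) = frechet_derivative f (at z) u + frechet_derivative f (at z) v"
  by (rule linear_add[OF bounded_linear.linear[OF has_derivative_bounded_linear[OF assms]]])

text \<open>By \<open>w\<close> the real form over \<open>B'\<close> is the pullback along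
  \<open>t\<close> of the one over \<open>B\<close>, which is the claim on the diagonal. The
  propagation takes place over \<open>B'\<close>, the domain of \<open>t\<close>, while
  \<open>B\<close> has to be large enough to receive its image; the nested balls are made for this
  asymmetry.\<close>

lemma bilc_transform:
  assumes F: "local_form B w F" and F': "local_form B' w' F'"
    and t: "holomorphic_vec B' t" "\<And>z. z \<in> B' \<Longrightarrow> t z \<in> B"
    and w: "\<And>z u v. z \<in> B' \<Longrightarrow> w' z u v = w (t z) (frechet_derivative t (at z) u) (frechet_derivative t (at z) v)"
    and A: "A \<in> cdom B'"
  defines "T \<equiv> \<lambda>A. pairc (t (fstc A)) (t (sndc A))"
  shows "bilc F (T A) (frechet_derivative T (at A) X) (frechet_derivative T (at A) Y) = bilc F' A X Y"
proof -
  interpret F: local_form B w F by fact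
  interpret F': local_form B' w' F' by fact
  have T: "holomorphic_vec (cdom B') T"
    unfolding T_def by (rule holomorphic_vec_prodc[OF t(1)])
  have TB: "T A \<in> cdom B" if "A \<in> cdom B'" for A
    using that t(2) by (simp add: T_def cdom_def)
  have "bilc F (T A) (frechet_derivative T (at A) X) (frechet_derivative T (at A) Y) - bilc F' A X Y = 0"
  proof (rule bilinear_identity[OF F'.open_B F'.convex_B, of
        "\<lambda>A X Y. bilc F (T A) (frechet_derivative T (at A) X) (frechet_derivative T (at A) Y) - bilc F' A X Y", OF _ _ _ _ _ _ A])
    show "holomorphic_fun (cdom B')
        (\<lambda>A. bilc F (T A) (frechet_derivative T (at A) X) (frechet_derivative T (at A) Y) - bilc F' A X Y)" for X Y
      by (intro holomorphic_fun_diff F'.bilc_hol F.bilc_compose_hol[OF T TB]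
          holomorphic_vec_frechet_holomorphic[OF open_cdom[OF F'.open_B] T])
    show "bilc F (T (diagc z)) (frechet_derivative T (at (diagc z)) (diagc u)) (frechet_derivative T (at (diagc z)) (diagc v))
        - bilc F' (diagc z) (diagc u) (diagc v) = 0" if z: "z \<in> B'" for z u v
    proof -
      have "frechet_derivative T (at (diagc z)) (diagc u) = diagc (frechet_derivative t (at z) u)" for u
        unfolding T_def by (rule frechet_prodc_diag[OF t(1) z F'.open_B])
      moreover have "T (diagc z) = diagc (t z)"
        by (simp add: T_def)
      ultimately show ?thesis
        by (simp add: F.bilc_diag[OF t(2)[OF z]] F'.bilc_diag[OF z] w[OF z])
    qed
  qed (simp_all add: frechet_linear[OF holomorphic_vec_frechet(1)[OF T]] holomorphic_vec_frechet(2)[OF T]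
      bilc_simps algebra_simps)
  then show ?thesis by simp
qed

section \<open>The Kaehler conditions carried over to the extension\<close>

locale local_kaehler = local_form B w F
  for B :: "(complex ^ 'n::finite) set" and w F +
  assumes w_alt: "\<And>z u. z \<in> B \<Longrightarrow> w z u u = 0"
    and w_J: "\<And>z u v. z \<in> B \<Longrightarrow> w z (\<i> *s u) (\<i> *s v) = w z u v"
    and w_pos: "\<And>z u. z \<in> B \<Longrightarrow> u \<noteq> 0 \<Longrightarrow> w z u (\<i> *s u) > 0"
    and w_closed: "\<And>z a b e. z \<in> B \<Longrightarrow> frechet_derivative (\<lambda>y. w y b e) (at z) a
      - frechet_derivative (\<lambda>y. w y a e) (at z) b + frechet_derivative (\<lambda>y. w y a b) (at z) e = 0"
begin

lemma w_antisym:
  assumes z: "z \<in> B"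
  shows "w z u v = - w z v u"
proof -
  have "w z (u + v) (u + v) = w z u u + w z u v + (w z v u + w z v v)"
    using w_bil[OF z] by (simp add: bilinear_ladd bilinear_radd)
  then show ?thesis by (simp add: w_alt[OF z])
qed

text \<open>\<open>bilc F A X X\<close> is quadratic in \<open>X\<close>, so its polarisation
  \<open>bilc F A X Y + bilc F A Y X\<close>, which is bilinear, is propagated instead.\<close>

lemma bilc_alt:
  assumes A: "A \<in> cdom B"
  shows "bilc F A X X = 0"
proof -
  have "bilc F A X X + bilc F A X X = 0"
  proof (rule bilinear_identity[OF open_B convex_B, of "\<lambda>A X Y. bilc F A X Y + bilc F A Y X", OF _ _ _ _ _ _ A])
    show "bilc F (diagc z) (diagc u) (diagc v) + bilc F (diagc z) (diagc v) (diagc u) = 0" if "z \<in> B" for z u v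
      using w_antisym[OF that, of u v] by (simp add: bilc_diag[OF that])
  qed (simp_all add: bilc_simps algebra_simps holomorphic_fun_add bilc_hol)
  then show ?thesis by simp
qed

text \<open>\<open>J\<close> extends complex-linearly as \<open>\<i>\<close> on the first factor
  and, since the second is conjugated, as \<open>- \<i>\<close> on the second. For vectors tangent
  to the second factor the propagated invariance therefore says that the form equals
  \<open>(- \<i>) ^ 2 = - 1\<close> times itself.\<close>

lemma bilc_lagrangian:
  assumes A: "A \<in> cdom B" and X: "fstc X = 0" and Y: "fstc Y = 0"
  shows "bilc F A X Y = 0"
proof -
  define J where "J X = pairc (\<i> *s fstc X) (\<i> *s sndc X)" for X :: "complex ^ ('n + 'n)"
  have J: "J (X + Y) = J X + J Y" "J (c *s X) = c *s J X" "J (diagc u) = diagc (\<i> *s u)" for X Y c u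
    by (simp_all add: J_def vec_sum_eq_iff algebra_simps)
  have J0: "J X = (- \<i>) *s X" if "fstc X = 0" for X
    by (rule complexified_eqI) (simp_all only: J_def fstc_pairc sndc_pairc fstc_simps sndc_simps that, simp_all)
  have "bilc F A (J X) (J Y) - bilc F A X Y = 0"
    by (rule bilinear_identity[OF open_B convex_B, of "\<lambda>A X Y. bilc F A (J X) (J Y) - bilc F A X Y", OF _ _ _ _ _ _ A])
      (simp_all add: J bilc_simps algebra_simps holomorphic_fun_diff bilc_hol bilc_diag w_J)
  then show ?thesis
    unfolding J0[OF X] J0[OF Y] bilc_simps by simp
qed

text \<open>Testing with \<open>diagc v\<close> separates real and imaginary parts, so
  \<open>rec X\<close> and \<open>imc X\<close> lie in the kernel of the real form; that kernel is
  trivial because \<open>w z u (\<i> *s u) > 0\<close>.\<close>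

lemma bilc_nondegenerate_diag:
  assumes z: "z \<in> B" and X: "\<And>Y. bilc F (diagc z) X Y = 0"
  shows "X = 0"
proof -
  have 0: "w z (rec X) v = 0" "w z (imc X) v = 0" for v
  proof -
    have "complex_of_real (w z (rec X) v) + \<i> * complex_of_real (w z (imc X) v) = 0"
      using X[of "diagc v"] by (subst (asm) complexified_decompose[of X]) (simp only: bilc_simps bilc_diag[OF z])
    then show "w z (rec X) v = 0" "w z (imc X) v = 0"
      by (simp_all add: complex_eq_iff)
  qed
  have "rec X = 0" "imc X = 0"
    using w_pos[OF z, of "rec X"] w_pos[OF z, of "imc X"] 0 by (metis less_irrefl)+
  then have "X = diagc 0 + \<i> *s diagc 0"
    using complexified_decompose[of X] by simp
  then show ?thesis
    by (simp add: vec_sum_eq_iff)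
qed

text \<open>A degenerate point has a unit vector in its kernel. Within a closed ball the pairs of a
  point and such a vector form a compact set, so the degenerate points form a closed set, and it
  misses \<open>diagc x\<close>.\<close>

lemma nondegenerate_near:
  assumes x: "x \<in> B"
  obtains r where "r > 0" "ball x r \<subseteq> B"
    "\<And>A X. A \<in> cdom (ball x r) \<Longrightarrow> (\<And>Y. bilc F A X Y = 0) \<Longrightarrow> X = 0"
proof -
  have "diagc x \<in> cdom B" using x by simp
  then obtain e where e: "e > 0" "cball (diagc x) e \<subseteq> cdom B"
    using open_contains_cball[of "cdom B"] open_cdom[OF open_B] by meson
  define K where "K = cball (diagc x) e \<times> sphere (0 :: complex ^ ('n + 'n)) 1"
  define Z where "Z = K \<inter> (\<Inter>Y. {p \<in> K. bilc F (fst p) (snd p) Y = 0})"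
  have K: "compact K" unfolding K_def by (intro compact_Times compact_cball compact_sphere)
  have "closed {p \<in> K. bilc F (fst p) (snd p) Y = 0}" for Y
  proof (rule continuous_closed_preimage_constant[OF _ compact_imp_closed[OF K]])
    have F: "continuous_on K (\<lambda>p. F a b (fst p))" if "a \<in> Basis" "b \<in> Basis" for a b
      by (rule continuous_on_compose2[OF holomorphic_fun_continuous_on[OF F_hol[OF that]] continuous_on_fst[OF continuous_on_id]])
        (use e in \<open>auto simp: K_def\<close>)
    have c: "continuous_on K (\<lambda>p. coordc a (snd p))" for a
      by (rule linear_continuous_on[OF bounded_linear_compose[OF bounded_linear_coordc bounded_linear_snd]])
    show "continuous_on K (\<lambda>p. bilc F (fst p) (snd p) Y)"
      unfolding bilc_def by (intro continuous_on_sum continuous_on_mult F c continuous_on_const)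
  qed
  then have "compact Z"
    unfolding Z_def by (intro compact_Int_closed K closed_INT ballI)
  then have "compact (fst ` Z)"
    by (rule compact_continuous_image[OF continuous_on_fst[OF continuous_on_id]])
  then have op: "open (ball (diagc x) e - fst ` Z)"
    by (intro open_Diff open_ball compact_imp_closed)
  have mem: "diagc x \<in> ball (diagc x) e - fst ` Z"
  proof -
    have "diagc x \<notin> fst ` Z"
    proof
      assume "diagc x \<in> fst ` Z"
      then obtain p where p: "diagc x = fst p" "p \<in> Z" by (rule imageE)
      have "snd p = 0" by (rule bilc_nondegenerate_diag[OF x]) (use p in \<open>auto simp: Z_def\<close>)
      then show False using p(2) by (auto simp: Z_def K_def)
    qed
    then show ?thesis using e by simp
  qed
  obtain d where d: "d > 0" "ball (diagc x) d \<subseteq> ball (diagc x) e - fst ` Z"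
    using op mem open_contains_ball by meson
  obtain r1 where r1: "r1 > 0" "ball x r1 \<subseteq> B" using open_B x open_contains_ball by meson
  \<comment> \<open>The norm of a pair is at most the sum of the norms of its components, each of
    which gets half of \<open>d\<close>.\<close>
  define r where "r = min r1 (d / 2)"
  have sub: "cdom (ball x r) \<subseteq> ball (diagc x) d"
  proof
    fix A assume A: "A \<in> cdom (ball x r)"
    have n: "norm X \<le> norm (fstc X) + norm (sndc X)" for X :: "complex ^ ('n + 'n)"
    proof -
      have "norm (pairc z 0) \<le> norm z" "norm (pairc 0 z) \<le> norm z" for z :: "complex ^ 'n"
        by (simp_all add: norm_vec_def L2_set_def sum.Plus[of UNIV UNIV, unfolded UNIV_Plus_UNIV])
      moreover have "X = pairc (fstc X) 0 + pairc 0 (sndc X)"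
        by (simp add: vec_sum_eq_iff)
      ultimately show ?thesis
        by (metis norm_triangle_mono)
    qed
    show "A \<in> ball (diagc x) d"
      using n[of "A - diagc x"] A by (auto simp: cdom_def dist_norm norm_minus_commute[of x] norm_minus_commute[of "diagc x"] r_def)
  qed
  show ?thesis
  proof
    show "r > 0" "ball x r \<subseteq> B" using r1 d by (auto simp: r_def)
    show "X = 0" if A: "A \<in> cdom (ball x r)" and X: "\<And>Y. bilc F A X Y = 0" for A X
    proof (rule ccontr)
      assume X0: "X \<noteq> 0"
      have "(A, (1 / norm X) *\<^sub>R X) \<in> Z"
        using sub A d X0 by (auto simp: Z_def K_def bilc_scaleR X subset_iff)
      then have "A \<in> fst ` Z" by force
      then show False using sub A d by auto
    qed
  qed
qed

text \<open>For fixed vectors the left side is holomorphic in \<open>A\<close>, and it is trilinear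
  in \<open>X\<close>, \<open>Y\<close>, \<open>Z\<close>. Hence it is enough to evaluate it at
  diagonal points on diagonal vectors, where it is the exterior derivative of the real form.\<close>

lemma bilc_closed:
  assumes A: "A \<in> cdom B"
  shows "frechet_derivative (\<lambda>y. bilc F y Y Z) (at A) X - frechet_derivative (\<lambda>y. bilc F y X Z) (at A) Y
    + frechet_derivative (\<lambda>y. bilc F y X Y) (at A) Z = 0"
proof -
  define D where "D A X Y Z = frechet_derivative (\<lambda>y. bilc F y Y Z) (at A) X" for A X Y Z
  have D_hd: "((\<lambda>y. bilc F y Y Z) has_derivative (\<lambda>X. D A X Y Z)) (at A)" if "A \<in> cdom B" for A Y Z
    unfolding D_def by (rule holomorphic_fun_frechet(1)[OF bilc_hol that])
  have D1: "D A (X + X') Y Z = D A X Y Z + D A X' Y Z" "D A (c *s X) Y Z = c * D A X Y Z"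
    if "A \<in> cdom B" for A X X' Y Z c
    unfolding D_def using frechet_linear[OF holomorphic_fun_frechet(1)[OF bilc_hol that]]
      holomorphic_fun_frechet(2)[OF bilc_hol that] by simp_all
  have D_eq: "D A X Y Z = D' X" if "((\<lambda>y. bilc F y Y Z) has_derivative D') (at A)" for A X Y Z D'
    unfolding D_def using frechet_derivative_eqI[OF that] by simp
  have D2: "D A X (Y + Y') Z = D A X Y Z + D A X Y' Z" "D A X (c *s Y) Z = c * D A X Y Z"
    if "A \<in> cdom B" for A X Y Y' Z c
  proof -
    show "D A X (Y + Y') Z = D A X Y Z + D A X Y' Z"
      by (rule D_eq) (unfold bilc_simps, intro has_derivative_add D_hd that)
    show "D A X (c *s Y) Z = c * D A X Y Z"
      by (rule D_eq) (unfold bilc_simps, intro has_derivative_mult_right D_hd that)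
  qed
  have D3: "D A X Y (Z + Z') = D A X Y Z + D A X Y Z'" "D A X Y (c *s Z) = c * D A X Y Z"
    if "A \<in> cdom B" for A X Y Z Z' c
  proof -
    show "D A X Y (Z + Z') = D A X Y Z + D A X Y Z'"
      by (rule D_eq) (unfold bilc_simps, intro has_derivative_add D_hd that)
    show "D A X Y (c *s Z) = c * D A X Y Z"
      by (rule D_eq) (unfold bilc_simps, intro has_derivative_mult_right D_hd that)
  qed
  have D_hol: "holomorphic_fun (cdom B) (\<lambda>A. D A X Y Z)" for X Y Z
    unfolding D_def by (rule holomorphic_fun_frechet_holomorphic[OF open_cdom[OF open_B] bilc_hol])
  define T where "T A X Y Z = D A X Y Z - D A Y X Z + D A Z X Y" for A X Y Z
  have diag: "D (diagc z) (diagc u) (diagc v) (diagc v') = complex_of_real (frechet_derivative (\<lambda>y. w y v v') (at z) u)"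
    if z: "z \<in> B" for z u v v'
  proof -
    have "((\<lambda>z. bilc F (diagc z) (diagc v) (diagc v')) has_derivative
        (\<lambda>u. D (diagc z) (diagc u) (diagc v) (diagc v'))) (at z)"
      by (rule has_derivative_compose[OF bounded_linear_imp_has_derivative[OF bounded_linear_complexified(4)] D_hd]) (simp add: z)
    from has_derivative_transform_within_open[OF this open_B z] 
    have 1: "((\<lambda>z. complex_of_real (w z v v')) has_derivative (\<lambda>u. D (diagc z) (diagc u) (diagc v) (diagc v'))) (at z)"
      by (simp add: bilc_diag)
    \<comment> \<open>\<open>w_closed\<close> is phrased with \<open>frechet_derivative\<close>,
      which carries information only where \<open>w\<close> is differentiable; differentiability is
      obtained here from the extension.\<close>
    have 2: "((\<lambda>z. w z v v') has_derivative (\<lambda>u. Re (D (diagc z) (diagc u) (diagc v) (diagc v')))) (at z)"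
      using bounded_linear.has_derivative[OF bounded_linear_Re 1] by simp
    have "((\<lambda>z. complex_of_real (w z v v')) has_derivative
        (\<lambda>u. complex_of_real (Re (D (diagc z) (diagc u) (diagc v) (diagc v'))))) (at z)"
      by (rule bounded_linear.has_derivative[OF bounded_linear_of_real 2])
    from fun_cong[OF has_derivative_unique[OF 1 this], of u] show ?thesis
      unfolding frechet_derivative_eqI[OF 2] .
  qed
  have "T A X Y Z = 0"
  proof (rule identity_from_diagonal[OF convex_B open_B _ _ A, of "\<lambda>A. T A X Y Z"])
    show "holomorphic_fun (cdom B) (\<lambda>A. T A X Y Z)"
      unfolding T_def by (intro holomorphic_fun_add holomorphic_fun_diff D_hol)
    fix z assume z: "z \<in> B"
    then have d: "diagc z \<in> cdom B" by simp
    show "T (diagc z) X Y Z = 0"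
    proof (rule clinear_zero[of "\<lambda>X. T (diagc z) X Y Z"])
      show "T (diagc z) (diagc u) Y Z = 0" for u
      proof (rule clinear_zero[of "\<lambda>Y. T (diagc z) (diagc u) Y Z"])
        show "T (diagc z) (diagc u) (diagc v) Z = 0" for v
        proof (rule clinear_zero[of "T (diagc z) (diagc u) (diagc v)"])
          show "T (diagc z) (diagc u) (diagc v) (diagc v') = 0" for v'
          proof -
            have "T (diagc z) (diagc u) (diagc v) (diagc v')
              = complex_of_real (frechet_derivative (\<lambda>y. w y v v') (at z) u
                - frechet_derivative (\<lambda>y. w y u v') (at z) v + frechet_derivative (\<lambda>y. w y u v) (at z) v')"
              unfolding T_def diag[OF z] by simp
            then show ?thesis unfolding w_closed[OF z] by simp
          qed
        qed (simp_all add: T_def D1[OF d] D2[OF d] D3[OF d] algebra_simps)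
      qed (simp_all add: T_def D1[OF d] D2[OF d] D3[OF d] algebra_simps)
    qed (simp_all add: T_def D1[OF d] D2[OF d] D3[OF d] algebra_simps)
  qed
  then show ?thesis by (simp add: T_def D_def)
qed

end

section \<open>Charts and tangent vectors\<close>

lemma chart_inv_mem:
  assumes "z \<in> snd c ` fst c"
  shows "chart_inv c z \<in> fst c" "snd c (chart_inv c z) = z"
  using assms by (simp_all add: chart_inv_def inv_into_into f_inv_into_f)

lemma chart_subset: "is_chart X c \<Longrightarrow> fst c \<subseteq> topspace X"
  by (simp add: is_chart_def openin_subset)

lemma chart_topspace: "is_chart X c \<Longrightarrow> topspace (subtopology X (fst c)) = fst c"
  by (simp add: chart_subset inf_absorb2)

lemma chart_inj:
  assumes "is_chart X c"
  shows "inj_on (snd c) (fst c)"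
proof -
  have "homeomorphic_map (subtopology X (fst c)) (top_of_set (snd c ` fst c)) (snd c)"
    using assms by (simp add: is_chart_def)
  from homeomorphic_imp_injective_map[OF this] show ?thesis
    by (simp only: chart_topspace[OF assms])
qed

lemma chart_inv_left: "is_chart X c \<Longrightarrow> p \<in> fst c \<Longrightarrow> chart_inv c (snd c p) = p"
  by (simp add: chart_inv_def inv_into_f_f[OF chart_inj])

lemma chart_continuous:
  assumes "is_chart X c"
  shows "continuous_map (subtopology X (fst c)) (top_of_set (snd c ` fst c)) (snd c)"
  using assms by (simp add: is_chart_def homeomorphic_imp_continuous_map)

lemma chart_inv_continuous:
  assumes c: "is_chart X c"
  shows "continuous_map (top_of_set (snd c ` fst c)) (subtopology X (fst c)) (chart_inv c)"
proof -
  have "homeomorphic_map (subtopology X (fst c)) (top_of_set (snd c ` fst c)) (snd c)"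
    using c by (simp add: is_chart_def)
  then obtain g where g: "homeomorphic_maps (subtopology X (fst c)) (top_of_set (snd c ` fst c)) (snd c) g"
    unfolding homeomorphic_map_maps by (rule exE)
  then have g1: "continuous_map (top_of_set (snd c ` fst c)) (subtopology X (fst c)) g"
    and g2: "\<And>p. p \<in> fst c \<Longrightarrow> g (snd c p) = p"
    using chart_topspace[OF c] by (auto simp: homeomorphic_maps_def)
  show ?thesis
    by (rule continuous_map_eq[OF g1]) (use g2 chart_inv_left[OF c] in auto)
qed

lemma chart_open_image:
  assumes c: "is_chart X c" and V: "openin X V" "V \<subseteq> fst c"
  shows "open (snd c ` V)"
proof -
  have "open_map (subtopology X (fst c)) (top_of_set (snd c ` fst c)) (snd c)"
    using c by (simp add: is_chart_def homeomorphic_imp_open_map)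
  moreover have "openin (subtopology X (fst c)) V"
    using c V by (simp add: is_chart_def openin_open_subtopology)
  ultimately have "openin (top_of_set (snd c ` fst c)) (snd c ` V)"
    by (simp add: open_map_def)
  then show ?thesis
    using c by (simp add: is_chart_def openin_open_eq)
qed

lemma chart_preimage_eq:
  assumes c: "is_chart X c" and S: "S \<subseteq> snd c ` fst c"
  shows "chart_inv c ` S = {p \<in> fst c. snd c p \<in> S}"
proof (intro set_eqI iffI)
  fix p assume "p \<in> chart_inv c ` S"
  then show "p \<in> {p \<in> fst c. snd c p \<in> S}"
    using chart_inv_mem[of _ c] S by auto
next
  fix p assume "p \<in> {p \<in> fst c. snd c p \<in> S}"
  then show "p \<in> chart_inv c ` S"
    using chart_inv_left[OF c, of p] by (intro image_eqI[of _ _ "snd c p"]) auto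
qed

lemma chart_open_preimage:
  assumes c: "is_chart X c" and S: "open S" "S \<subseteq> snd c ` fst c"
  shows "openin X (chart_inv c ` S)"
proof -
  have "openin (top_of_set (snd c ` fst c)) S"
    using S by (simp add: open_openin_trans[OF _ S(1)] openin_open_subtopology open_subset)
  from openin_continuous_map_preimage[OF chart_continuous[OF c] this]
  have "openin (subtopology X (fst c)) {p \<in> fst c. snd c p \<in> S}"
    unfolding chart_topspace[OF c] .
  then show ?thesis
    unfolding chart_preimage_eq[OF c S(2)] using c by (simp add: is_chart_def openin_open_subtopology)
qed

lemma open_local_dom:
  assumes c: "is_chart X c" and d: "is_chart Y d" and F: "continuous_map X Y F"
  shows "open (local_dom c d F)"
proof -
  have "openin X ({p \<in> topspace X. F p \<in> fst d} \<inter> fst c)"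
    using openin_continuous_map_preimage[OF F, of "fst d"] c d by (simp add: is_chart_def openin_Int)
  moreover have "{p \<in> topspace X. F p \<in> fst d} \<inter> fst c = {p \<in> fst c. F p \<in> fst d}"
    using chart_subset[OF c] by auto
  ultimately show ?thesis
    unfolding local_dom_def by (intro chart_open_image[OF c]) auto
qed

lemma local_dom_memI: "p \<in> fst c \<Longrightarrow> F p \<in> fst d \<Longrightarrow> snd c p \<in> local_dom c d F"
  unfolding local_dom_def by simp

lemma local_domE:
  assumes "z \<in> local_dom c d F"
  obtains p where "p \<in> fst c" "F p \<in> fst d" "z = snd c p"
  using assms unfolding local_dom_def by (elim imageE CollectE conjE)

lemma local_rep_at: "is_chart X c \<Longrightarrow> p \<in> fst c \<Longrightarrow> local_rep c d F (snd c p) = snd d (F p)"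
  by (simp add: local_rep_def chart_inv_left)

lemma local_rep_chain:
  assumes c: "is_chart X c" and d: "is_chart Y d" and F: "continuous_map X Y F"
    and p: "p \<in> fst c" "F p \<in> fst d"
    and D: "(local_rep c d F has_derivative D) (at (snd c p))"
    and E: "(local_rep d e G has_derivative E) (at (snd d (F p)))"
  shows "(local_rep c e (G \<circ> F) has_derivative (\<lambda>a. E (D a))) (at (snd c p))"
proof (rule has_derivative_transform_within_open[OF _ open_local_dom[OF c d F] local_dom_memI[of p c F d, OF p]])
  show "((\<lambda>z. local_rep d e G (local_rep c d F z)) has_derivative (\<lambda>a. E (D a))) (at (snd c p))"
    by (rule has_derivative_compose[OF D]) (simp add: E local_rep_at[OF c p(1)])
  fix z assume "z \<in> local_dom c d F"
  then obtain q where q: "q \<in> fst c" "F q \<in> fst d" "z = snd c q"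
    by (rule local_domE)
  then show "local_rep d e G (local_rep c d F z) = local_rep c e (G \<circ> F) z"
    by (simp add: local_rep_at[OF c] local_rep_at[OF d])
qed

lemma local_rep_self:
  assumes c: "is_chart X c" and p: "p \<in> fst c"
  shows "(local_rep c c id has_derivative id) (at (snd c p))"
proof (rule has_derivative_transform_within_open[where f = id])
  show "open (snd c ` fst c)" using c by (simp add: is_chart_def)
  fix z assume "z \<in> snd c ` fst c"
  then show "id z = local_rep c c id z"
    by (simp add: local_rep_def chart_inv_mem)
qed (use p in \<open>auto intro: has_derivative_id\<close>)

lemma compatible_transition:
  assumes c: "is_chart X c" and d: "is_chart X d" and cd: "compatible c d" and p: "p \<in> fst c" "p \<in> fst d"
  shows "(local_rep c d id has_derivative frechet_derivative (local_rep c d id) (at (snd c p))) (at (snd c p))"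
    "frechet_derivative (local_rep c d id) (at (snd c p)) (l *s a) = l *s frechet_derivative (local_rep c d id) (at (snd c p)) a"
proof -
  have h: "holomorphic_vec (local_dom c d id) (local_rep c d id)" "snd c p \<in> local_dom c d id"
    using cd p by (simp_all add: compatible_def local_dom_memI)
  show "(local_rep c d id has_derivative frechet_derivative (local_rep c d id) (at (snd c p))) (at (snd c p))"
    "frechet_derivative (local_rep c d id) (at (snd c p)) (l *s a) = l *s frechet_derivative (local_rep c d id) (at (snd c p)) a"
    by (rule holomorphic_vec_frechet[OF h])+
qed

lemma transition_chain:
  assumes c: "is_chart X c" and d: "is_chart X d" and e: "is_chart X e" and p: "p \<in> fst c" "p \<in> fst d" "p \<in> fst e"
    and cd: "compatible c d" and de: "compatible d e"
  shows "frechet_derivative (local_rep d e id) (at (snd d p)) (frechet_derivative (local_rep c d id) (at (snd c p)) a)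
    = frechet_derivative (local_rep c e id) (at (snd c p)) a"
proof -
  have p': "id p \<in> fst d" and E: "(local_rep d e id has_derivative frechet_derivative (local_rep d e id) (at (snd d p)))
      (at (snd d (id p)))"
    using p compatible_transition(1)[OF d e de p(2,3)] by simp_all
  have "(local_rep c e (id \<circ> id) has_derivative
     (\<lambda>a. frechet_derivative (local_rep d e id) (at (snd d p)) (frechet_derivative (local_rep c d id) (at (snd c p)) a))) (at (snd c p))"
    by (rule local_rep_chain[OF c d continuous_map_id p(1) p' compatible_transition(1)[OF c d cd p(1,2)] E])
  then show ?thesis
    by (simp add: frechet_derivative_eqI)
qed

section \<open>Tangent vectors and their coordinates\<close>

lemma charts_atD:
  assumes "complex_manifold M" "c \<in> charts_at M p"
  shows "is_chart (topol M) c" "p \<in> fst c" "c \<in> atlas M" "p \<in> points M"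
proof -
  show "is_chart (topol M) c" "p \<in> fst c" "c \<in> atlas M"
    using assms by (simp_all add: charts_at_def complex_manifold_def)
  then show "p \<in> points M" using chart_subset by blast
qed

lemma atlas_compatible: "complex_manifold M \<Longrightarrow> c \<in> atlas M \<Longrightarrow> d \<in> atlas M \<Longrightarrow> compatible c d"
  by (simp add: complex_manifold_def)

lemma atlas_is_chart: "complex_manifold M \<Longrightarrow> c \<in> atlas M \<Longrightarrow> is_chart (topol M) c"
  by (simp add: complex_manifold_def)

lemma atlas_holomorphic_charts: "complex_manifold M \<Longrightarrow> c \<in> atlas M \<Longrightarrow> c \<in> holomorphic_charts M"
  by (simp add: holomorphic_charts_def atlas_compatible atlas_is_chart)

lemma charts_at_nonempty:
  assumes "complex_manifold M" "p \<in> points M"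
  shows "(SOME c. c \<in> charts_at M p) \<in> charts_at M p"
proof -
  have "p \<in> (\<Union>c\<in>atlas M. fst c)" using assms by (simp add: complex_manifold_def)
  then have "\<exists>c. c \<in> charts_at M p" by (auto simp: charts_at_def)
  then show ?thesis by (rule someI_ex)
qed

text \<open>The transformation rule is the cocycle identity \<open>transition_chain\<close>. The
  chart \<open>c\<close> may lie outside the atlas, as slice charts do.\<close>

lemma from_coords_tangent:
  assumes M: "complex_manifold M" and c: "c \<in> holomorphic_charts M" and p: "p \<in> fst c"
  shows "from_coords M c p a \<in> tangent_space M p"
  unfolding tangent_space_def
proof (intro CollectI conjI ballI allI impI)
  fix d e assume d: "d \<in> charts_at M p" and e: "e \<in> charts_at M p"
  have c': "is_chart (topol M) c" "compatible c d"
    using c charts_atD(3)[OF M d] by (simp_all add: holomorphic_charts_def)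
  show "from_coords M c p a e = frechet_derivative (local_rep d e id) (at (snd d p)) (from_coords M c p a d)"
    using transition_chain[OF c'(1) charts_atD(1)[OF M d] charts_atD(1)[OF M e] p charts_atD(2)[OF M d]
        charts_atD(2)[OF M e] c'(2) atlas_compatible[OF M charts_atD(3)[OF M d] charts_atD(3)[OF M e]], of a]
    by (simp add: from_coords_def d e)
qed (simp add: from_coords_def)

lemma from_coords_self:
  assumes M: "complex_manifold M" and c: "c \<in> charts_at M p"
  shows "from_coords M c p a c = a"
  using frechet_derivative_eqI[OF local_rep_self[OF charts_atD(1,2)[OF M c]]] by (simp add: from_coords_def c)

lemma tangent_transition:
  "v \<in> tangent_space M p \<Longrightarrow> c \<in> charts_at M p \<Longrightarrow> d \<in> charts_at M p \<Longrightarrow>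
    frechet_derivative (local_rep c d id) (at (snd c p)) (v c) = v d"
  unfolding tangent_space_def mem_Collect_eq by (elim conjE) (drule (1) bspec, drule (1) bspec, erule sym)

lemma tangent_outside: "v \<in> tangent_space M p \<Longrightarrow> c \<notin> charts_at M p \<Longrightarrow> v c = 0"
  unfolding tangent_space_def mem_Collect_eq by (elim conjE allE) (erule (1) mp)

lemma from_coords_tangent_vector:
  assumes v: "v \<in> tangent_space M p" and c: "c \<in> charts_at M p"
  shows "from_coords M c p (v c) = v"
proof
  fix d show "from_coords M c p (v c) d = v d"
    using tangent_transition[OF v c] tangent_outside[OF v] by (simp add: from_coords_def)
qed

lemma from_coords_transition:
  assumes M: "complex_manifold M" and c: "c \<in> charts_at M p" and d: "d \<in> charts_at M p"
  shows "from_coords M d p (frechet_derivative (local_rep c d id) (at (snd c p)) a) = from_coords M c p a"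
proof -
  have "from_coords M c p a \<in> tangent_space M p"
    by (rule from_coords_tangent[OF M atlas_holomorphic_charts[OF M charts_atD(3)[OF M c]] charts_atD(2)[OF M c]])
  from from_coords_tangent_vector[OF this d] show ?thesis
    by (simp add: from_coords_def[of M c] d)
qed

section \<open>Products and translates of charts\<close>

lemma is_chartI:
  assumes U: "openin X U" and S: "open S"
    and f: "continuous_map (subtopology X U) (top_of_set S) f"
    and g: "continuous_map (top_of_set S) (subtopology X U) g"
    and gf: "\<And>p. p \<in> U \<Longrightarrow> g (f p) = p" and fg: "\<And>z. z \<in> S \<Longrightarrow> f (g z) = z"
  shows "is_chart X (U, f)" "f ` U = S" "\<And>z. z \<in> S \<Longrightarrow> chart_inv (U, f) z = g z"
proof -
  have ts: "topspace (subtopology X U) = U"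
    using openin_subset[OF U] by (simp add: inf_absorb2)
  have gU: "g z \<in> U" if "z \<in> S" for z
    using continuous_map_image_subset_topspace[OF g] ts that by auto
  have fS: "f p \<in> S" if "p \<in> U" for p
    using continuous_map_image_subset_topspace[OF f] ts that by auto
  show im: "f ` U = S"
  proof
    show "S \<subseteq> f ` U"
    proof
      fix z assume "z \<in> S"
      then show "z \<in> f ` U" using fg[of z] gU[of z] by (intro image_eqI[of _ _ "g z"]) auto
    qed
  qed (use fS in auto)
  have "homeomorphic_maps (subtopology X U) (top_of_set S) f g"
    unfolding homeomorphic_maps_def ts using f g gf fg by simp
  then have "homeomorphic_map (subtopology X U) (top_of_set S) f"
    unfolding homeomorphic_map_maps by (rule exI[of _ g])
  then show c: "is_chart X (U, f)"
    using U S by (simp add: is_chart_def im)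
  show "chart_inv (U, f) z = g z" if "z \<in> S" for z
    using chart_inv_left[OF c, of "g z"] gU[OF that] fg[OF that] by simp
qed

text \<open>The same chart on both factors sends the diagonal of \<open>V\<close> to the points
  \<open>diagc z\<close>. \<open>V\<close> is a parameter because only a small square, not the full
  domain of \<open>c\<close>, enters \<open>X\<close>.\<close>

definition prod_chart :: "'p set \<Rightarrow> ('p, 'n::finite) chart \<Rightarrow> ('p \<times> 'p, 'n + 'n) chart" where
  "prod_chart V c = (V \<times> V, \<lambda>x. pairc (snd c (fst x)) (snd c (snd x)))"

lemma prod_chart:
  fixes c :: "('p, 'n::finite) chart"
  assumes c: "is_chart X c" and V: "openin X V" "V \<subseteq> fst c" and W: "V \<times> V \<subseteq> W"
  shows "is_chart (subtopology (prod_topology X X) W) (prod_chart V c)"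
    "snd (prod_chart V c) ` fst (prod_chart V c) = cdom (snd c ` V)"
    "\<And>A. A \<in> cdom (snd c ` V) \<Longrightarrow> chart_inv (prod_chart V c) A = (chart_inv c (fstc A), chart_inv c (sndc A))"
proof -
  let ?T = "subtopology (prod_topology X X) W"
  let ?f = "\<lambda>x. pairc (snd c (fst x)) (snd c (snd x))"
  let ?g = "\<lambda>A. (chart_inv c (fstc A), chart_inv c (sndc A))"
  have sub: "subtopology ?T (V \<times> V) = subtopology (prod_topology X X) (V \<times> V)"
    using W by (simp add: subtopology_subtopology inf_absorb2)
  have ts: "topspace (subtopology (prod_topology X X) (V \<times> V)) = V \<times> V"
    using openin_subset[OF V(1)] by auto
  have cV: "continuous_map (subtopology X V) euclidean (snd c)"
    using continuous_map_from_subtopology_mono[OF continuous_map_into_fulltopology[OF chart_continuous[OF c]] V(2)] .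
  have 1: "openin ?T (V \<times> V)"
    using V(1) W by (auto simp: openin_subtopology intro!: exI[of _ "V \<times> V"] simp: openin_prod_Times_iff)
  have 2: "open (cdom (snd c ` V))"
    by (rule open_cdom[OF chart_open_image[OF c V]])
  have p12: "continuous_map (subtopology (prod_topology X X) (V \<times> V)) (subtopology X V) fst"
    "continuous_map (subtopology (prod_topology X X) (V \<times> V)) (subtopology X V) snd"
    unfolding continuous_map_in_subtopology
    by (auto simp: ts intro: continuous_map_from_subtopology continuous_map_fst continuous_map_snd)
  have 3: "continuous_map (subtopology ?T (V \<times> V)) (top_of_set (cdom (snd c ` V))) ?f"
    unfolding sub continuous_map_in_subtopology
  proof
    have a: "continuous_map (subtopology (prod_topology X X) (V \<times> V)) euclidean (\<lambda>x. (snd c (fst x), snd c (snd x)))"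
      using continuous_map_compose[OF p12(1) cV] continuous_map_compose[OF p12(2) cV]
      by (simp add: continuous_map_paired o_def flip: prod_topology_euclidean)
    have "bounded_linear (\<lambda>(z, w). pairc z w :: complex ^ ('n + 'n))"
      unfolding linear_conv_bounded_linear[symmetric]
      by (rule linearI) (auto simp: pairc_simps)
    then have "continuous_map euclidean euclidean (\<lambda>(z, w). pairc z w :: complex ^ ('n + 'n))"
      by (simp add: linear_continuous_on)
    from continuous_map_compose[OF a this]
    show "continuous_map (subtopology (prod_topology X X) (V \<times> V)) euclidean ?f"
      by (simp add: o_def)
    show "?f \<in> topspace (subtopology (prod_topology X X) (V \<times> V)) \<rightarrow> cdom (snd c ` V)"
      unfolding ts by (auto simp: cdom_def)
  qed
  have ci: "continuous_map (top_of_set (snd c ` V)) X (chart_inv c)"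
    by (rule continuous_map_from_subtopology_mono[OF continuous_map_into_fulltopology[OF chart_inv_continuous[OF c]]])
      (use V(2) in auto)
  have ps: "continuous_map (top_of_set (cdom (snd c ` V))) (top_of_set (snd c ` V)) fstc"
    "continuous_map (top_of_set (cdom (snd c ` V))) (top_of_set (snd c ` V)) sndc"
    by (auto simp: continuous_map_in_subtopology cdom_def linear_continuous_on bounded_linear_complexified)
  have civ: "chart_inv c z \<in> V" "snd c (chart_inv c z) = z" if "z \<in> snd c ` V" for z
    using that V(2) chart_inv_left[OF c] by auto
  have 4: "continuous_map (top_of_set (cdom (snd c ` V))) (subtopology ?T (V \<times> V)) ?g"
    unfolding sub continuous_map_in_subtopology
  proof
    show "continuous_map (top_of_set (cdom (snd c ` V))) (prod_topology X X) ?g"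
      using continuous_map_compose[OF ps(1) ci] continuous_map_compose[OF ps(2) ci]
      by (intro continuous_map_pairedI) (simp_all add: o_def)
    show "?g \<in> topspace (top_of_set (cdom (snd c ` V))) \<rightarrow> V \<times> V"
      using civ by (auto simp: cdom_def)
  qed
  have 5: "?g (?f x) = x" if "x \<in> V \<times> V" for x
    using that V(2) chart_inv_left[OF c] by auto
  have 6: "?f (?g A) = A" if "A \<in> cdom (snd c ` V)" for A
    using that civ by (simp add: cdom_def)
  show "is_chart ?T (prod_chart V c)"
    "snd (prod_chart V c) ` fst (prod_chart V c) = cdom (snd c ` V)"
    "\<And>A. A \<in> cdom (snd c ` V) \<Longrightarrow> chart_inv (prod_chart V c) A = ?g A"
    using is_chartI[OF 1 2 3 4 5 6] unfolding prod_chart_def by simp_all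
qed

text \<open>A slice chart has to show a fibre as a linear coordinate subspace, so the coordinates of
  the fixed first component must be moved to 0.\<close>

lemma translate_chart:
  assumes c: "is_chart X c"
  shows "is_chart X (fst c, \<lambda>x. snd c x + a)"
proof (rule is_chartI(1))
  let ?S = "snd c ` fst c"
  have op: "open ?S" "openin X (fst c)" using c by (simp_all add: is_chart_def)
  show "openin X (fst c)" by fact
  show "open ((\<lambda>z. z + a) ` ?S)" by (rule open_translation_subtract[of ?S "-a", simplified]) (rule op)
  have t: "continuous_map (top_of_set ?S) (top_of_set ((\<lambda>z. z + a) ` ?S)) (\<lambda>z. z + a)"
    "continuous_map (top_of_set ((\<lambda>z. z + a) ` ?S)) (top_of_set ?S) (\<lambda>z. z - a)"
    by (auto simp: continuous_map_in_subtopology intro!: continuous_intros)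
  show "continuous_map (subtopology X (fst c)) (top_of_set ((\<lambda>z. z + a) ` ?S)) (\<lambda>x. snd c x + a)"
    using continuous_map_compose[OF chart_continuous[OF c] t(1)] by (simp add: o_def)
  show "continuous_map (top_of_set ((\<lambda>z. z + a) ` ?S)) (subtopology X (fst c)) (\<lambda>z. chart_inv c (z - a))"
    using continuous_map_compose[OF t(2) chart_inv_continuous[OF c]] by (simp add: o_def)
qed (auto simp: chart_inv_left[OF c])

section \<open>Countability, local compactness and the complex structure\<close>

lemma second_countable_prod_topology:
  assumes X: "second_countable X" and Y: "second_countable Y"
  shows "second_countable (prod_topology X Y)"
proof -
  obtain \<B> where B: "countable \<B> \<and> (\<forall>V\<in>\<B>. openin X V) \<and>
      (\<forall>U x. openin X U \<and> x \<in> U \<longrightarrow> (\<exists>V\<in>\<B>. x \<in> V \<and> V \<subseteq> U))"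
    using X unfolding second_countable_def by (rule exE)
  obtain \<C> where C: "countable \<C> \<and> (\<forall>V\<in>\<C>. openin Y V) \<and>
      (\<forall>U x. openin Y U \<and> x \<in> U \<longrightarrow> (\<exists>V\<in>\<C>. x \<in> V \<and> V \<subseteq> U))"
    using Y unfolding second_countable_def by (rule exE)
  define \<D> where "\<D> = (\<lambda>(V, W). V \<times> W) ` (\<B> \<times> \<C>)"
  have "\<exists>Q\<in>\<D>. p \<in> Q \<and> Q \<subseteq> U" if U: "openin (prod_topology X Y) U" and p: "p \<in> U" for U p
  proof -
    obtain x y where xy: "p = (x, y)" by (rule prod.exhaust)
    obtain V W where VW: "openin X V" "openin Y W" "x \<in> V" "y \<in> W" "V \<times> W \<subseteq> U"
      using U[unfolded openin_prod_topology_alt, rule_format, OF p[unfolded xy]] by (elim exE conjE)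
    have "\<exists>V'\<in>\<B>. x \<in> V' \<and> V' \<subseteq> V" "\<exists>W'\<in>\<C>. y \<in> W' \<and> W' \<subseteq> W"
      using B C VW by simp_all
    then obtain V' W' where V': "V' \<in> \<B>" "x \<in> V'" "V' \<subseteq> V" and W': "W' \<in> \<C>" "y \<in> W'" "W' \<subseteq> W"
      by (elim bexE conjE)
    show ?thesis
    proof (intro bexI conjI)
      show "V' \<times> W' \<in> \<D>" using V' W' by (auto simp: \<D>_def)
      show "p \<in> V' \<times> W'" using xy V' W' by simp
      show "V' \<times> W' \<subseteq> U" using V'(3) W'(3) VW(5) by (meson Sigma_mono order_trans)
    qed
  qed
  moreover have "countable \<D>"
    unfolding \<D>_def using B C by (intro countable_image countable_SIGMA) simp_all
  moreover have "\<forall>Q\<in>\<D>. openin (prod_topology X Y) Q"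
    using B C by (auto simp: \<D>_def openin_prod_Times_iff)
  ultimately show ?thesis
    unfolding second_countable_def by (intro exI[of _ \<D>]) simp
qed

text \<open>Together with the Hausdorff property this gives regularity, the hypothesis of
  \<open>second_countable_regular_metric\<close>.\<close>

lemma locally_compact_complex_manifold:
  assumes M: "complex_manifold M"
  shows "locally_compact_space (topol M)"
  unfolding locally_compact_space_def
proof
  fix p assume p: "p \<in> points M"
  define c where "c = (SOME c. c \<in> charts_at M p)"
  have c: "c \<in> charts_at M p" unfolding c_def by (rule charts_at_nonempty[OF M p])
  note c1 = charts_atD[OF M c]
  have "open (snd c ` fst c)" using c1(1) by (simp add: is_chart_def)
  then obtain e where e: "e > 0" "cball (snd c p) e \<subseteq> snd c ` fst c"
    using open_contains_cball c1(2) by (metis imageI)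
  have "openin (topol M) (chart_inv c ` ball (snd c p) e)"
    by (rule chart_open_preimage[OF c1(1) open_ball]) (use e(2) in auto)
  moreover have "compactin (topol M) (chart_inv c ` cball (snd c p) e)"
  proof (rule image_compactin)
    show "compactin (top_of_set (snd c ` fst c)) (cball (snd c p) e)"
      using e(2) by (simp add: compactin_subtopology)
    show "continuous_map (top_of_set (snd c ` fst c)) (topol M) (chart_inv c)"
      by (rule continuous_map_into_fulltopology[OF chart_inv_continuous[OF c1(1)]])
  qed
  moreover have "p \<in> chart_inv c ` ball (snd c p) e"
    using chart_inv_left[OF c1(1,2)] e(1) by (intro image_eqI[of _ _ "snd c p"]) auto
  moreover have "chart_inv c ` ball (snd c p) e \<subseteq> chart_inv c ` cball (snd c p) e"
    by (intro image_mono) auto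
  ultimately show "\<exists>U K. openin (topol M) U \<and> compactin (topol M) K \<and> p \<in> U \<and> U \<subseteq> K"
    by (intro exI conjI)
qed

lemma from_coords_scale:
  assumes M: "complex_manifold M" and c: "c \<in> charts_at M p"
  shows "from_coords M c p (\<i> *s a) = cplx_struct (from_coords M c p a)"
proof
  fix d
  show "from_coords M c p (\<i> *s a) d = cplx_struct (from_coords M c p a) d"
  proof (cases "d \<in> charts_at M p")
    case True
    note cd = charts_atD[OF M c] charts_atD[OF M True]
    show ?thesis
      using compatible_transition(2)[OF cd(1,5) atlas_compatible[OF M cd(3,7)] cd(2,6)] True
      by (simp add: from_coords_def cplx_struct_def)
  qed (simp add: from_coords_def cplx_struct_def)
qed

section \<open>Local complexifications of the Kaehler form\<close>

lemma local_form_subset: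
  assumes "local_form B w F" "open B'" "convex B'" "B' \<subseteq> B"
  shows "local_form B' w F"
proof -
  interpret local_form B w F by fact
  have "cdom B' \<subseteq> cdom B" using assms(4) by (auto simp: cdom_def)
  then show ?thesis
    using assms F_diag w_bil by unfold_locales (auto intro: holomorphic_fun_subset[OF F_hol])
qed

lemma local_kaehler_subset:
  assumes "local_kaehler B w F" "open B'" "convex B'" "B' \<subseteq> B"
  shows "local_kaehler B' w F"
proof -
  interpret local_kaehler B w F by fact
  interpret B': local_form B' w F
    by (rule local_form_subset[OF local_form_axioms assms(2-4)])
  show ?thesis
    using assms(4) w_alt w_J w_pos w_closed by unfold_locales auto
qed

locale kaehler_manifold =
  fixes M :: "('m, 'n::finite) manifold" and \<omega> :: "('m, 'n, real) form2"
  assumes kaehler: "real_analytic_kaehler M \<omega>"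
begin

lemma M: "complex_manifold M"
  using kaehler by (simp add: real_analytic_kaehler_def)

lemma form_coords_transition:
  assumes c: "c \<in> charts_at M p" and d: "d \<in> charts_at M p"
  shows "form_coords M \<omega> d (snd d p) (frechet_derivative (local_rep c d id) (at (snd c p)) u)
      (frechet_derivative (local_rep c d id) (at (snd c p)) v)
    = form_coords M \<omega> c (snd c p) u v"
  using chart_inv_left[OF charts_atD(1,2)[OF M c]] chart_inv_left[OF charts_atD(1,2)[OF M d]]
  by (simp add: form_coords_def from_coords_transition[OF M c d])

lemma form_coords_at:
  assumes c: "c \<in> charts_at M p" and u: "u \<in> tangent_space M p" and v: "v \<in> tangent_space M p"
  shows "form_coords M \<omega> c (snd c p) (u c) (v c) = \<omega> p u v"
  using chart_inv_left[OF charts_atD(1,2)[OF M c]]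
  by (simp add: form_coords_def from_coords_tangent_vector[OF u c] from_coords_tangent_vector[OF v c])

lemma local_kaehlerI:
  assumes c: "c \<in> atlas M" and B: "open B" "convex B" "B \<subseteq> snd c ` fst c"
    and F: "\<And>e f. e \<in> Basis \<Longrightarrow> f \<in> Basis \<Longrightarrow> holomorphic_fun (cdom B) (F e f)"
    "\<And>z e f. z \<in> B \<Longrightarrow> e \<in> Basis \<Longrightarrow> f \<in> Basis \<Longrightarrow> F e f (diagc z) = complex_of_real (form_coords M \<omega> c z e f)"
  shows "local_kaehler B (form_coords M \<omega> c) F"
proof
  fix z assume "z \<in> B"
  then have z: "z \<in> snd c ` fst c" using B by blast
  define p where "p = chart_inv c z"
  have p: "p \<in> fst c" "snd c p = z"
    using chart_inv_mem[OF z] by (simp_all add: p_def)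
  have cp: "c \<in> charts_at M p" using c p by (simp add: charts_at_def)
  have pM: "p \<in> points M" by (rule charts_atD(4)[OF M cp])
  have tan: "from_coords M c p a \<in> tangent_space M p" for a
    by (rule from_coords_tangent[OF M atlas_holomorphic_charts[OF M c] p(1)])
  have alt: "alternating_form M \<omega>" and cl: "closed_form M \<omega>"
    using kaehler by (simp_all add: real_analytic_kaehler_def)
  note alt' = bspec[OF bspec[OF alt[unfolded alternating_form_def] c] z]
  show "bilinear (form_coords M \<omega> c z)"
    using alt' by (rule conjunct1)
  show "form_coords M \<omega> c z u u = 0" for u
    using alt' by simp
  show "form_coords M \<omega> c z (\<i> *s u) (\<i> *s v) = form_coords M \<omega> c z u v" for u v
  proof -
    have "\<omega> p (cplx_struct (from_coords M c p u)) (cplx_struct (from_coords M c p v))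
        = \<omega> p (from_coords M c p u) (from_coords M c p v)"
      using kaehler pM tan by (simp add: real_analytic_kaehler_def)
    then show ?thesis
      by (simp add: form_coords_def p_def[symmetric] from_coords_scale[OF M cp])
  qed
  show "form_coords M \<omega> c z u (\<i> *s u) > 0" if "u \<noteq> 0" for u
  proof -
    have "from_coords M c p u \<noteq> zero_vector"
      using fun_cong[of "from_coords M c p u" zero_vector c] from_coords_self[OF M cp, of u] that by auto
    then have "\<omega> p (from_coords M c p u) (cplx_struct (from_coords M c p u)) > 0"
      using kaehler pM tan by (simp add: real_analytic_kaehler_def)
    then show ?thesis
      by (simp add: form_coords_def p_def[symmetric] from_coords_scale[OF M cp])
  qed
  show "frechet_derivative (\<lambda>y. form_coords M \<omega> c y b e) (at z) a
      - frechet_derivative (\<lambda>y. form_coords M \<omega> c y a e) (at z) b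
      + frechet_derivative (\<lambda>y. form_coords M \<omega> c y a b) (at z) e = 0" for a b e
    using cl c z unfolding closed_form_def by blast
qed (use B F in auto)

text \<open>Each of the finitely many coefficients in the real basis has its own radius of
  extension; the smallest serves all of them, and \<open>nondegenerate_near\<close> reduces it once
  more.\<close>

lemma local_complexification:
  assumes p: "p \<in> points M"
  obtains c R F where "c \<in> charts_at M p" "R > 0" "ball (snd c p) R \<subseteq> snd c ` fst c"
    "local_kaehler (ball (snd c p) R) (form_coords M \<omega> c) F"
    "\<And>A X. A \<in> cdom (ball (snd c p) R) \<Longrightarrow> (\<And>Y. bilc F A X Y = 0) \<Longrightarrow> X = 0"
proof -
  define c where "c = (SOME c. c \<in> charts_at M p)"
  have c: "c \<in> charts_at M p" unfolding c_def by (rule charts_at_nonempty[OF M p])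
  note c1 = charts_atD[OF M c]
  let ?x = "snd c p"
  have xS: "?x \<in> snd c ` fst c" using c1(2) by simp
  have "open (snd c ` fst c)" using c1(1) by (simp add: is_chart_def)
  then obtain e where e: "e > 0" "ball ?x e \<subseteq> snd c ` fst c"
    using open_contains_ball xS by metis
  have "\<forall>q\<in>Basis \<times> Basis. \<exists>rF. fst rF > 0 \<and> holomorphic_fun (cdom (ball ?x (fst rF))) (snd rF) \<and>
      (\<forall>z\<in>ball ?x (fst rF). snd rF (diagc z) = complex_of_real (form_coords M \<omega> c z (fst q) (snd q)))"
  proof
    fix q :: "(complex ^ 'n) \<times> (complex ^ 'n)"
    have an: "real_analytic_fun (snd c ` fst c) (\<lambda>z. form_coords M \<omega> c z (fst q) (snd q))"
      using kaehler c1(3) by (simp add: real_analytic_kaehler_def)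
    obtain r G where "r > 0" "holomorphic_fun (cdom (ball ?x r)) G"
      "\<And>z. z \<in> ball ?x r \<Longrightarrow> G (diagc z) = complex_of_real (form_coords M \<omega> c z (fst q) (snd q))"
      by (fact real_analytic_complexification[OF an xS])
    then show "\<exists>rF. fst rF > 0 \<and> holomorphic_fun (cdom (ball ?x (fst rF))) (snd rF) \<and>
      (\<forall>z\<in>ball ?x (fst rF). snd rF (diagc z) = complex_of_real (form_coords M \<omega> c z (fst q) (snd q)))"
      by (intro exI[of _ "(r, G)"]) simp
  qed
  from bchoice[OF this] obtain rF where rF: "\<forall>q\<in>Basis \<times> Basis. fst (rF q) > 0 \<and>
      holomorphic_fun (cdom (ball ?x (fst (rF q)))) (snd (rF q)) \<and>
      (\<forall>z\<in>ball ?x (fst (rF q)). snd (rF q) (diagc z) = complex_of_real (form_coords M \<omega> c z (fst q) (snd q)))"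
    by (rule exE)
  \<comment> \<open>The extra radius \<open>e\<close> keeps the ball inside the image of the
    chart.\<close>
  define Q where "Q = insert e ((\<lambda>q. fst (rF q)) ` (Basis \<times> Basis))"
  have Q: "finite Q" "Q \<noteq> {}" by (simp_all add: Q_def)
  define r where "r = Min Q"
  have r: "r > 0" unfolding r_def Min_gr_iff[OF Q] using rF e by (auto simp: Q_def)
  have r_le: "r \<le> e" "\<And>q. q \<in> Basis \<times> Basis \<Longrightarrow> r \<le> fst (rF q)"
    unfolding r_def by (rule Min_le[OF Q(1)]; simp add: Q_def)+
  define F where "F a b = snd (rF (a, b))" for a b
  have lk: "local_kaehler (ball ?x r) (form_coords M \<omega> c) F"
  proof (rule local_kaehlerI[OF c1(3) open_ball convex_ball])
    show "ball ?x r \<subseteq> snd c ` fst c"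
      using e(2) r_le(1) by (meson order_trans subset_ball)
    fix a b :: "complex ^ 'n" assume ab: "a \<in> Basis" "b \<in> Basis"
    then have q: "(a, b) \<in> Basis \<times> Basis" by simp
    have sub: "ball ?x r \<subseteq> ball ?x (fst (rF (a, b)))" by (rule subset_ball[OF r_le(2)[OF q]])
    then have "cdom (ball ?x r) \<subseteq> cdom (ball ?x (fst (rF (a, b))))" by (auto simp: cdom_def)
    then show "holomorphic_fun (cdom (ball ?x r)) (F a b)"
      unfolding F_def using bspec[OF rF q] holomorphic_fun_subset by metis
    show "F a b (diagc z) = complex_of_real (form_coords M \<omega> c z a b)" if "z \<in> ball ?x r" for z
      using bspec[OF rF q] sub that by (auto simp: F_def)
  qed
  interpret local_kaehler "ball ?x r" "form_coords M \<omega> c" F by (rule lk)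
  have x: "?x \<in> ball ?x r" using r by simp
  obtain R where R: "R > 0" "ball ?x R \<subseteq> ball ?x r"
    "\<And>A X. A \<in> cdom (ball ?x R) \<Longrightarrow> (\<And>Y. bilc F A X Y = 0) \<Longrightarrow> X = 0"
    by (fact nondegenerate_near[OF x])
  show ?thesis
  proof (rule that[OF c R(1)])
    show "ball ?x R \<subseteq> snd c ` fst c"
      using R(2) r_le(1) e(2) by (meson order_trans subset_ball)
    show "local_kaehler (ball ?x R) (form_coords M \<omega> c) F"
      by (rule local_kaehler_subset[OF lk open_ball convex_ball R(2)])
  qed (rule R(3))
qed

text \<open>If two of the small balls \<open>V p\<close> meet, the one with the smaller metric size lies in the large
  ball around the centre of the other.\<close>

lemma complexification_cover_exists:
  obtains c s R F where
    "\<And>p. p \<in> points M \<Longrightarrow> c p \<in> charts_at M p"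
    "\<And>p. p \<in> points M \<Longrightarrow> 0 < s p \<and> s p \<le> (R p :: real)"
    "\<And>p. p \<in> points M \<Longrightarrow> ball (snd (c p) p) (R p) \<subseteq> snd (c p) ` fst (c p)"
    "\<And>p. p \<in> points M \<Longrightarrow> local_kaehler (ball (snd (c p) p) (R p)) (form_coords M \<omega> (c p)) (F p)"
    "\<And>p A X. p \<in> points M \<Longrightarrow> A \<in> cdom (ball (snd (c p) p) (R p)) \<Longrightarrow> (\<And>Y. bilc (F p) A X Y = 0) \<Longrightarrow> X = 0"
    "\<And>p q. p \<in> points M \<Longrightarrow> q \<in> points M \<Longrightarrow>
      chart_inv (c p) ` ball (snd (c p) p) (s p) \<inter> chart_inv (c q) ` ball (snd (c q) q) (s q) \<noteq> {} \<Longrightarrow>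
      chart_inv (c q) ` ball (snd (c q) q) (s q) \<subseteq> chart_inv (c p) ` ball (snd (c p) p) (R p) \<or>
      chart_inv (c p) ` ball (snd (c p) p) (s p) \<subseteq> chart_inv (c q) ` ball (snd (c q) q) (R q)"
proof -
  let ?P = "\<lambda>p t. case t of (c, R, F) \<Rightarrow> c \<in> charts_at M p \<and> R > 0 \<and> ball (snd c p) R \<subseteq> snd c ` fst c \<and>
    local_kaehler (ball (snd c p) R) (form_coords M \<omega> c) F \<and>
    (\<forall>A X. A \<in> cdom (ball (snd c p) R) \<longrightarrow> (\<forall>Y. bilc F A X Y = 0) \<longrightarrow> X = 0)"
  have "\<forall>p\<in>points M. \<exists>t. ?P p t"
  proof
    fix p assume p: "p \<in> points M"
    obtain c R F where "c \<in> charts_at M p" "R > 0" "ball (snd c p) R \<subseteq> snd c ` fst c"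
      "local_kaehler (ball (snd c p) R) (form_coords M \<omega> c) F"
      "\<And>A X. A \<in> cdom (ball (snd c p) R) \<Longrightarrow> (\<And>Y. bilc F A X Y = 0) \<Longrightarrow> X = 0"
      by (fact local_complexification[OF p])
    then show "\<exists>t. ?P p t" by (intro exI[of _ "(c, R, F)"]) simp
  qed
  from bchoice[OF this] obtain t where t: "\<forall>p\<in>points M. ?P p (t p)" by (rule exE)
  define c R F where "c p = fst (t p)" and "R p = fst (snd (t p))" and "F p = snd (snd (t p))" for p
  have P: "c p \<in> charts_at M p" "R p > 0" "ball (snd (c p) p) (R p) \<subseteq> snd (c p) ` fst (c p)"
    "local_kaehler (ball (snd (c p) p) (R p)) (form_coords M \<omega> (c p)) (F p)"
    "\<And>A X. A \<in> cdom (ball (snd (c p) p) (R p)) \<Longrightarrow> (\<And>Y. bilc (F p) A X Y = 0) \<Longrightarrow> X = 0"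
    if "p \<in> points M" for p
    using bspec[OF t that] by (simp_all add: c_def R_def F_def case_prod_beta)
  have reg: "regular_space (topol M)" and sc: "second_countable (topol M)"
    using M locally_compact_Hausdorff_imp_regular_space[OF locally_compact_complex_manifold[OF M]]
    by (simp_all add: complex_manifold_def)
  obtain d :: "'m \<Rightarrow> 'm \<Rightarrow> real" where d: "\<And>x y. d x y = d y x"
    "\<And>x y z. x \<in> points M \<Longrightarrow> y \<in> points M \<Longrightarrow> z \<in> points M \<Longrightarrow> d x z \<le> d x y + d y z"
    "\<And>U x. openin (topol M) U \<Longrightarrow> x \<in> U \<Longrightarrow> \<exists>\<rho>>0. \<forall>y\<in>points M. d x y < \<rho> \<longrightarrow> y \<in> U"
    "\<And>x \<rho>. x \<in> points M \<Longrightarrow> \<rho> > 0 \<Longrightarrow> \<exists>U. openin (topol M) U \<and> x \<in> U \<and> (\<forall>y\<in>U. d x y < \<rho>)"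
    by (fact second_countable_regular_metric[OF sc reg])
  \<comment> \<open>The factor 3 pays for the path from \<open>p\<close> over a common point
    \<open>x\<close> and the centre \<open>q\<close> to a point \<open>y\<close> of the other ball:
    if \<open>\<rho> q \<le> \<rho> p\<close>, each of its three legs is shorter than
    \<open>\<rho> p\<close>.\<close>
  have "\<forall>p\<in>points M. \<exists>\<rho>>0. \<forall>y\<in>points M. d p y < 3 * \<rho> \<longrightarrow> y \<in> chart_inv (c p) ` ball (snd (c p) p) (R p)"
  proof
    fix p assume p: "p \<in> points M"
    note c1 = charts_atD[OF M P(1)[OF p]]
    have "openin (topol M) (chart_inv (c p) ` ball (snd (c p) p) (R p))"
      by (rule chart_open_preimage[OF c1(1) open_ball P(3)[OF p]])
    moreover have "p \<in> chart_inv (c p) ` ball (snd (c p) p) (R p)"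
      using chart_inv_left[OF c1(1,2)] P(2)[OF p] by (intro image_eqI[of _ _ "snd (c p) p"]) auto
    ultimately obtain \<rho> where "\<rho> > 0" "\<forall>y\<in>points M. d p y < \<rho> \<longrightarrow> y \<in> chart_inv (c p) ` ball (snd (c p) p) (R p)"
      using d(3) by meson
    then show "\<exists>\<rho>>0. \<forall>y\<in>points M. d p y < 3 * \<rho> \<longrightarrow> y \<in> chart_inv (c p) ` ball (snd (c p) p) (R p)"
      by (intro exI[of _ "\<rho> / 3"]) simp
  qed
  from bchoice[OF this] obtain \<rho> where \<rho>: "\<forall>p\<in>points M. \<rho> p > 0 \<and>
      (\<forall>y\<in>points M. d p y < 3 * \<rho> p \<longrightarrow> y \<in> chart_inv (c p) ` ball (snd (c p) p) (R p))"
    by (rule exE)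
  \<comment> \<open>The radius \<open>s p\<close> is measured in coordinates, but chosen so that the
    small ball lies within distance \<open>\<rho> p\<close> of its centre.\<close>
  have "\<forall>p\<in>points M. \<exists>s. 0 < s \<and> s \<le> R p \<and> (\<forall>y\<in>chart_inv (c p) ` ball (snd (c p) p) s. y \<in> points M \<and> d p y < \<rho> p)"
  proof
    fix p assume p: "p \<in> points M"
    note c1 = charts_atD[OF M P(1)[OF p]]
    have "\<rho> p > 0" using bspec[OF \<rho> p] by simp
    then obtain U where U: "openin (topol M) U" "p \<in> U" "\<forall>y\<in>U. d p y < \<rho> p"
      using d(4)[OF p] by meson
    have "openin (topol M) (U \<inter> fst (c p))"
      using U(1) c1(1) by (simp add: is_chart_def openin_Int)
    then have "open (snd (c p) ` (U \<inter> fst (c p)))"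
      by (rule chart_open_image[OF c1(1)]) simp
    moreover have "snd (c p) p \<in> snd (c p) ` (U \<inter> fst (c p))" using U(2) c1(2) by simp
    ultimately obtain r where r: "r > 0" "ball (snd (c p) p) r \<subseteq> snd (c p) ` (U \<inter> fst (c p))"
      using open_contains_ball by metis
    show "\<exists>s. 0 < s \<and> s \<le> R p \<and> (\<forall>y\<in>chart_inv (c p) ` ball (snd (c p) p) s. y \<in> points M \<and> d p y < \<rho> p)"
    proof (intro exI[of _ "min r (R p)"] conjI ballI)
      show "0 < min r (R p)" "min r (R p) \<le> R p" using r(1) P(2)[OF p] by simp_all
      fix y assume "y \<in> chart_inv (c p) ` ball (snd (c p) p) (min r (R p))"
      then obtain z where z: "z \<in> ball (snd (c p) p) r" "y = chart_inv (c p) z" by auto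
      then obtain x where x: "x \<in> U" "x \<in> fst (c p)" "z = snd (c p) x" using r(2) by auto
      have "y = x" using z x chart_inv_left[OF c1(1) x(2)] by simp
      then show "y \<in> points M" "d p y < \<rho> p" using x(1) U openin_subset by auto
    qed
  qed
  from bchoice[OF this] obtain s where s: "\<forall>p\<in>points M. 0 < s p \<and> s p \<le> R p \<and>
      (\<forall>y\<in>chart_inv (c p) ` ball (snd (c p) p) (s p). y \<in> points M \<and> d p y < \<rho> p)"
    by (rule exE)
  have sub: "chart_inv (c q) ` ball (snd (c q) q) (s q) \<subseteq> chart_inv (c p) ` ball (snd (c p) p) (R p)"
    if p: "p \<in> points M" and q: "q \<in> points M" and x: "x \<in> chart_inv (c p) ` ball (snd (c p) p) (s p)"
      "x \<in> chart_inv (c q) ` ball (snd (c q) q) (s q)" and le: "\<rho> q \<le> \<rho> p" for p q x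
  proof
    fix y assume y: "y \<in> chart_inv (c q) ` ball (snd (c q) q) (s q)"
    have xp: "x \<in> points M" "d p x < \<rho> p" using bspec[OF s p] x(1) by blast+
    have xq: "d q x < \<rho> q" using bspec[OF s q] x(2) by blast
    have yq: "y \<in> points M" "d q y < \<rho> q" using bspec[OF s q] y by blast+
    have "d p y < 3 * \<rho> p"
      using d(2)[OF p xp(1) yq(1)] d(2)[OF xp(1) q yq(1)] d(1)[of x q] xp(2) xq yq(2) le by linarith
    then show "y \<in> chart_inv (c p) ` ball (snd (c p) p) (R p)"
      using bspec[OF \<rho> p] yq(1) by blast
  qed
  show ?thesis
  proof (rule that[of c s R F])
    fix p q
    assume pq: "p \<in> points M" "q \<in> points M"
    assume "chart_inv (c p) ` ball (snd (c p) p) (s p) \<inter> chart_inv (c q) ` ball (snd (c q) q) (s q) \<noteq> {}"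
    then obtain x where x: "x \<in> chart_inv (c p) ` ball (snd (c p) p) (s p)"
      "x \<in> chart_inv (c q) ` ball (snd (c q) q) (s q)" by auto
    show "chart_inv (c q) ` ball (snd (c q) q) (s q) \<subseteq> chart_inv (c p) ` ball (snd (c p) p) (R p) \<or>
      chart_inv (c p) ` ball (snd (c p) p) (s p) \<subseteq> chart_inv (c q) ` ball (snd (c q) q) (R q)"
      using sub[OF pq x] sub[OF pq(2,1) x(2,1)] linear[of "\<rho> q" "\<rho> p"] by argo
  qed (use P s in auto)
qed

end

section \<open>Gluing the complexifications along the diagonal\<close>

text \<open>\<open>s p\<close> is the radius of the ball whose square enters \<open>X\<close>;
  \<open>R p\<close> is the radius up to which the extension \<open>F p\<close> is defined and
  nondegenerate. The gap between the two is what \<open>nested\<close> uses.\<close>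

locale complexification_cover = kaehler_manifold M \<omega>
  for M :: "('m, 'n::finite) manifold" and \<omega> :: "('m, 'n, real) form2" +
  fixes c :: "'m \<Rightarrow> ('m, 'n) chart" and s R :: "'m \<Rightarrow> real"
    and F :: "'m \<Rightarrow> complex ^ 'n \<Rightarrow> complex ^ 'n \<Rightarrow> complex ^ ('n + 'n) \<Rightarrow> complex"
  assumes c_at: "\<And>p. p \<in> points M \<Longrightarrow> c p \<in> charts_at M p"
    and sR: "\<And>p. p \<in> points M \<Longrightarrow> 0 < s p \<and> s p \<le> R p"
    and R_sub: "\<And>p. p \<in> points M \<Longrightarrow> ball (snd (c p) p) (R p) \<subseteq> snd (c p) ` fst (c p)"
    and kaehler_F: "\<And>p. p \<in> points M \<Longrightarrow> local_kaehler (ball (snd (c p) p) (R p)) (form_coords M \<omega> (c p)) (F p)"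
    and nondegenerate_F: "\<And>p A X. p \<in> points M \<Longrightarrow> A \<in> cdom (ball (snd (c p) p) (R p)) \<Longrightarrow>
      (\<And>Y. bilc (F p) A X Y = 0) \<Longrightarrow> X = 0"
    and nested: "\<And>p q. p \<in> points M \<Longrightarrow> q \<in> points M \<Longrightarrow>
      chart_inv (c p) ` ball (snd (c p) p) (s p) \<inter> chart_inv (c q) ` ball (snd (c q) q) (s q) \<noteq> {} \<Longrightarrow>
      chart_inv (c q) ` ball (snd (c q) q) (s q) \<subseteq> chart_inv (c p) ` ball (snd (c p) p) (R p) \<or>
      chart_inv (c p) ` ball (snd (c p) p) (s p) \<subseteq> chart_inv (c q) ` ball (snd (c q) q) (R q)"
begin

definition V :: "'m \<Rightarrow> 'm set" where
  "V p = chart_inv (c p) ` ball (snd (c p) p) (s p)"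

definition W :: "('m \<times> 'm) set" where
  "W = (\<Union>p\<in>points M. V p \<times> V p)"

definition hat :: "'m \<Rightarrow> ('m \<times> 'm, 'n + 'n) chart" where
  "hat p = prod_chart (V p) (c p)"

definition X :: "('m \<times> 'm, 'n + 'n) manifold" where
  "X = \<lparr>topol = subtopology (prod_topology (topol M) (topol M)) W, atlas = hat ` points M\<rparr>"

text \<open>The choice of \<open>p\<close> is immaterial on tangent vectors, by
  \<open>\<Omega>_eq\<close>.\<close>

definition \<Omega> :: "('m \<times> 'm, 'n + 'n, complex) form2" where
  "\<Omega> x u v = (let p = SOME p. p \<in> points M \<and> x \<in> V p \<times> V p in
     bilc (F p) (snd (hat p) x) (u (hat p)) (v (hat p)))"

lemma c_facts:
  assumes "p \<in> points M"
  shows "is_chart (topol M) (c p)" "p \<in> fst (c p)" "c p \<in> atlas M"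
  using charts_atD[OF M c_at[OF assms]] by simp_all

lemma s_sub:
  assumes p: "p \<in> points M"
  shows "ball (snd (c p) p) (s p) \<subseteq> ball (snd (c p) p) (R p)"
    "ball (snd (c p) p) (s p) \<subseteq> snd (c p) ` fst (c p)"
proof -
  show "ball (snd (c p) p) (s p) \<subseteq> ball (snd (c p) p) (R p)"
    using sR[OF p] by (simp add: subset_ball)
  then show "ball (snd (c p) p) (s p) \<subseteq> snd (c p) ` fst (c p)"
    using R_sub[OF p] by (rule order_trans)
qed

lemma V_facts:
  assumes p: "p \<in> points M"
  shows "openin (topol M) (V p)" "V p \<subseteq> fst (c p)" "p \<in> V p" "snd (c p) ` V p = ball (snd (c p) p) (s p)"
    "V p \<subseteq> points M"
proof -
  note c = c_facts[OF p]
  show o: "openin (topol M) (V p)"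
    unfolding V_def by (rule chart_open_preimage[OF c(1) open_ball s_sub(2)[OF p]])
  then show "V p \<subseteq> points M" by (rule openin_subset)
  have V: "V p = {q \<in> fst (c p). snd (c p) q \<in> ball (snd (c p) p) (s p)}"
    unfolding V_def by (rule chart_preimage_eq[OF c(1) s_sub(2)[OF p]])
  show "V p \<subseteq> fst (c p)" unfolding V by blast
  show "p \<in> V p" unfolding V using c(2) sR[OF p] by simp
  show "snd (c p) ` V p = ball (snd (c p) p) (s p)"
    unfolding V using s_sub(2)[OF p] by auto
qed

lemma V_charts_at: "p \<in> points M \<Longrightarrow> q \<in> V p \<Longrightarrow> c p \<in> charts_at M q"
  using c_facts(3) V_facts(2) unfolding charts_at_def by auto

lemma topol_X: "topol X = subtopology (prod_topology (topol M) (topol M)) W"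
  and atlas_X: "atlas X = hat ` points M"
  by (simp_all add: X_def)

lemma W_sub: "W \<subseteq> points M \<times> points M"
  unfolding W_def using V_facts(5) by blast

lemma points_X: "points X = W"
  using W_sub by (auto simp: topol_X)

lemma fst_hat: "fst (hat p) = V p \<times> V p"
  and snd_hat: "snd (hat p) x = pairc (snd (c p) (fst x)) (snd (c p) (snd x))"
  by (simp_all add: hat_def prod_chart_def)

lemma WE:
  assumes "x \<in> W"
  obtains p where "p \<in> points M" "x \<in> V p \<times> V p"
  using assms unfolding W_def by (elim UN_E)

lemma W_I: "p \<in> points M \<Longrightarrow> x \<in> V p \<times> V p \<Longrightarrow> x \<in> W"
  unfolding W_def by (rule UN_I)

lemma hat_chart:
  assumes p: "p \<in> points M"
  shows "is_chart (topol X) (hat p)" "snd (hat p) ` fst (hat p) = cdom (ball (snd (c p) p) (s p))"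
proof -
  have "V p \<times> V p \<subseteq> W" using W_I[OF p] by (rule subsetI)
  from prod_chart[OF c_facts(1)[OF p] V_facts(1,2)[OF p] this]
  show "is_chart (topol X) (hat p)" "snd (hat p) ` fst (hat p) = cdom (ball (snd (c p) p) (s p))"
    unfolding topol_X hat_def V_facts(4)[OF p] by simp_all
qed

abbreviation tr :: "'m \<Rightarrow> 'm \<Rightarrow> complex ^ 'n \<Rightarrow> complex ^ 'n" where
  "tr p q \<equiv> local_rep (c p) (c q) id"

abbreviation Tr :: "'m \<Rightarrow> 'm \<Rightarrow> complex ^ ('n + 'n) \<Rightarrow> complex ^ ('n + 'n)" where
  "Tr p q \<equiv> \<lambda>A. pairc (tr p q (fstc A)) (tr p q (sndc A))"

lemma tr_at: "p \<in> points M \<Longrightarrow> a \<in> V p \<Longrightarrow> tr p q (snd (c p) a) = snd (c q) a"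
  using V_facts(2) by (simp add: local_rep_at[OF c_facts(1)] subset_iff)

lemma Tr_at:
  assumes "p \<in> points M" "x \<in> V p \<times> V p"
  shows "Tr p q (snd (hat p) x) = snd (hat q) x"
  using assms by (simp add: snd_hat tr_at mem_Times_iff)

lemma hat_local_dom:
  assumes p: "p \<in> points M" and q: "q \<in> points M" and z: "z \<in> local_dom (hat p) (hat q) id"
  shows "z \<in> cdom (local_dom (c p) (c q) id)" "local_rep (hat p) (hat q) id z = Tr p q z"
proof -
  obtain x where x: "x \<in> V p \<times> V p" "x \<in> V q \<times> V q" "z = snd (hat p) x"
    using z by (rule local_domE) (simp add: fst_hat)
  have "fst x \<in> fst (c p)" "snd x \<in> fst (c p)" "fst x \<in> fst (c q)" "snd x \<in> fst (c q)"
    using x V_facts(2)[OF p] V_facts(2)[OF q] by auto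
  then show "z \<in> cdom (local_dom (c p) (c q) id)"
    unfolding x(3) snd_hat by (simp add: cdom_def local_dom_memI)
  show "local_rep (hat p) (hat q) id z = Tr p q z"
    unfolding x(3) Tr_at[OF p x(1)] using local_rep_at[OF hat_chart(1)[OF p], of x "hat q" id] x(1)
    by (simp add: fst_hat)
qed

lemma tr_holomorphic: 
  assumes "p \<in> points M" "q \<in> points M"
  shows "holomorphic_vec (local_dom (c p) (c q) id) (tr p q)"
  using atlas_compatible[OF M c_facts(3)[OF assms(1)] c_facts(3)[OF assms(2)]] by (simp add: compatible_def)

lemma hat_transition_holomorphic:
  assumes p: "p \<in> points M" and q: "q \<in> points M"
  shows "holomorphic_vec (local_dom (hat p) (hat q) id) (local_rep (hat p) (hat q) id)"
proof (rule holomorphic_vec_cong[OF _ open_local_dom[OF hat_chart(1)[OF p] hat_chart(1)[OF q] continuous_map_id]])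
  show "holomorphic_vec (local_dom (hat p) (hat q) id) (Tr p q)"
    by (rule holomorphic_vec_subset[OF holomorphic_vec_prodc[OF tr_holomorphic[OF p q]]])
      (use hat_local_dom(1)[OF p q] in blast)
qed (rule hat_local_dom(2)[OF p q])

lemma manifold_X: "complex_manifold X"
  unfolding complex_manifold_def
proof (intro conjI ballI)
  have "Hausdorff_space (topol M)" "second_countable (topol M)"
    using M by (simp_all add: complex_manifold_def)
  then show "Hausdorff_space (topol X)" "second_countable (topol X)"
    unfolding topol_X by (simp_all add: Hausdorff_space_subtopology Hausdorff_space_prod_topology
        second_countable_subtopology second_countable_prod_topology)
  show "is_chart (topol X) d" if "d \<in> atlas X" for d
    using that hat_chart(1) by (auto simp: atlas_X)
  show "(\<Union>d\<in>atlas X. fst d) = points X"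
    unfolding points_X W_def atlas_X by (simp add: fst_hat)
  show "compatible d e" if "d \<in> atlas X" "e \<in> atlas X" for d e
    using that hat_transition_holomorphic by (auto simp: atlas_X compatible_def)
qed

lemma hat_charts_at: "p \<in> points M \<Longrightarrow> x \<in> V p \<times> V p \<Longrightarrow> hat p \<in> charts_at X x"
  by (simp add: charts_at_def atlas_X fst_hat)

lemma charts_at_hatE:
  assumes "d \<in> charts_at X x"
  obtains p where "p \<in> points M" "x \<in> V p \<times> V p" "d = hat p"
  using assms by (auto simp: charts_at_def atlas_X fst_hat)

lemma some_chart_X:
  assumes "x \<in> W"
  obtains p where "p \<in> points M" "x \<in> V p \<times> V p" "(SOME d. d \<in> charts_at X x) = hat p"
  by (rule charts_at_hatE[OF charts_at_nonempty[OF manifold_X, unfolded points_X, OF assms]])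

lemma hat_frechet:
  assumes p: "p \<in> points M" and q: "q \<in> points M" and x: "x \<in> V p \<times> V p" "x \<in> V q \<times> V q"
  shows "frechet_derivative (local_rep (hat p) (hat q) id) (at (snd (hat p) x))
    = frechet_derivative (Tr p q) (at (snd (hat p) x))"
  by (rule frechet_derivative_cong_open[OF open_local_dom[OF hat_chart(1)[OF p] hat_chart(1)[OF q] continuous_map_id]])
    (use hat_local_dom(2)[OF p q] x in \<open>auto simp: local_dom_memI fst_hat\<close>)

lemma hat_mem:
  assumes "p \<in> points M" "x \<in> V p \<times> V p"
  shows "snd (hat p) x \<in> cdom (ball (snd (c p) p) (s p))"
  using hat_chart(2)[OF assms(1)] assms(2) unfolding fst_hat by blast

lemma hat_mem_R:
  assumes "p \<in> points M" "x \<in> V p \<times> V p"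
  shows "snd (hat p) x \<in> cdom (ball (snd (c p) p) (R p))"
  using hat_mem[OF assms] s_sub(1)[OF assms(1)] unfolding cdom_def by blast

section \<open>The glued symplectic form\<close>

lemma bilc_transition:
  assumes p: "p \<in> points M" and q: "q \<in> points M" and x: "x \<in> V p \<times> V p" "x \<in> V q \<times> V q"
    and sub: "V q \<subseteq> chart_inv (c p) ` ball (snd (c p) p) (R p)"
    and u: "u \<in> tangent_space X x" and v: "v \<in> tangent_space X x"
  shows "bilc (F p) (snd (hat p) x) (u (hat p)) (v (hat p)) = bilc (F q) (snd (hat q) x) (u (hat q)) (v (hat q))"
proof -
  \<comment> \<open>The identity is propagated over the whole ball of \<open>q\<close>, which is
    convex, and only then evaluated at \<open>x\<close>; the overlap of the two balls need not be
    convex.\<close>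
  let ?B = "ball (snd (c q) q) (s q)"
  have qp: "a \<in> fst (c q)" "a \<in> fst (c p)" "snd (c p) a \<in> ball (snd (c p) p) (R p)" if "a \<in> V q" for a
  proof -
    show "a \<in> fst (c q)" using V_facts(2)[OF q] that by (rule subsetD)
    have "a \<in> chart_inv (c p) ` ball (snd (c p) p) (R p)" using sub that by (rule subsetD)
    then show "a \<in> fst (c p)" "snd (c p) a \<in> ball (snd (c p) p) (R p)"
      unfolding chart_preimage_eq[OF c_facts(1)[OF p] R_sub[OF p]] by simp_all
  qed
  have BE: "\<exists>a\<in>V q. z = snd (c q) a" if "z \<in> ?B" for z
    using that unfolding V_facts(4)[OF q, symmetric] by (elim imageE bexI[rotated])
  have lf: "local_form (ball (snd (c p) p) (R p)) (form_coords M \<omega> (c p)) (F p)"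
    by (rule local_kaehler.axioms(1)[OF kaehler_F[OF p]])
  have lf': "local_form ?B (form_coords M \<omega> (c q)) (F q)"
    by (rule local_form_subset[OF local_kaehler.axioms(1)[OF kaehler_F[OF q]] open_ball convex_ball s_sub(1)[OF q]])
  have tr: "holomorphic_vec ?B (tr q p)"
  proof (rule holomorphic_vec_subset[OF tr_holomorphic[OF q p]])
    show "?B \<subseteq> local_dom (c q) (c p) id"
    proof
      fix z assume "z \<in> ?B"
      then obtain a where "a \<in> V q" "z = snd (c q) a" using BE by meson
      then show "z \<in> local_dom (c q) (c p) id" using qp by (simp add: local_dom_memI)
    qed
  qed
  have trB: "tr q p z \<in> ball (snd (c p) p) (R p)" if z: "z \<in> ?B" for z
  proof -
    obtain a where "a \<in> V q" "z = snd (c q) a" using BE[OF z] by (elim bexE)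
    then show ?thesis using qp by (simp add: tr_at[OF q])
  qed
  have w: "form_coords M \<omega> (c q) z a b
      = form_coords M \<omega> (c p) (tr q p z) (frechet_derivative (tr q p) (at z) a) (frechet_derivative (tr q p) (at z) b)"
    if z: "z \<in> ?B" for z a b
  proof -
    obtain m where m: "m \<in> V q" "z = snd (c q) m" using BE[OF z] by (elim bexE)
    have "c p \<in> charts_at M m" "c q \<in> charts_at M m"
      using qp[OF m(1)] c_facts(3)[OF p] c_facts(3)[OF q] by (simp_all add: charts_at_def)
    from form_coords_transition[OF this(2,1)] show ?thesis
      by (simp add: m(2) tr_at[OF q m(1)])
  qed
  have D: "frechet_derivative (Tr q p) (at (snd (hat q) x)) (y (hat q)) = y (hat p)" if "y \<in> tangent_space X x" for y
    using tangent_transition[OF that hat_charts_at[OF q x(2)] hat_charts_at[OF p x(1)]]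
    unfolding hat_frechet[OF q p x(2,1)] .
  have "bilc (F p) (Tr q p (snd (hat q) x)) (frechet_derivative (Tr q p) (at (snd (hat q) x)) (u (hat q)))
      (frechet_derivative (Tr q p) (at (snd (hat q) x)) (v (hat q)))
    = bilc (F q) (snd (hat q) x) (u (hat q)) (v (hat q))"
    by (rule bilc_transform[OF lf lf' tr trB w hat_mem[OF q x(2)]])
  then show ?thesis
    unfolding D[OF u] D[OF v] Tr_at[OF q x(2)] .
qed

text \<open>Immediate from the definition, and therefore valid for all \<open>u\<close> and
  \<open>v\<close>. At a point where the representative may be left unspecified, it applies to
  differentials of maps without a proof that they are tangent vectors.\<close>

lemma \<Omega>_some:
  assumes "x \<in> W"
  obtains p where "p \<in> points M" "x \<in> V p \<times> V p"
    "\<And>u v. \<Omega> x u v = bilc (F p) (snd (hat p) x) (u (hat p)) (v (hat p))"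
proof -
  define p where "p = (SOME p. p \<in> points M \<and> x \<in> V p \<times> V p)"
  have "\<exists>p. p \<in> points M \<and> x \<in> V p \<times> V p"
    using assms by (elim WE) (intro exI conjI)
  then have p: "p \<in> points M \<and> x \<in> V p \<times> V p" unfolding p_def by (rule someI_ex)
  show ?thesis
    by (rule that[OF conjunct1[OF p] conjunct2[OF p]]) (simp add: \<Omega>_def p_def[symmetric])
qed

text \<open>Squares that share \<open>x\<close> come from balls that share \<open>fst x\<close>. So
  one of the balls lies in the large ball of the other, and \<open>bilc_transition\<close> applies
  in one direction or the other.\<close>

lemma \<Omega>_eq:
  assumes p: "p \<in> points M" and x: "x \<in> V p \<times> V p" and u: "u \<in> tangent_space X x" and v: "v \<in> tangent_space X x"
  shows "\<Omega> x u v = bilc (F p) (snd (hat p) x) (u (hat p)) (v (hat p))"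
proof -
  obtain q where q: "q \<in> points M" "x \<in> V q \<times> V q"
    and eq: "\<And>u v. \<Omega> x u v = bilc (F q) (snd (hat q) x) (u (hat q)) (v (hat q))"
    by (fact \<Omega>_some[OF W_I[OF p x]])
  have "fst x \<in> V p \<inter> V q" using x q(2) by auto
  then have "V p \<inter> V q \<noteq> {}" by blast
  from nested[OF p q(1), folded V_def, OF this] show ?thesis
  proof
    assume "V q \<subseteq> chart_inv (c p) ` ball (snd (c p) p) (R p)"
    from bilc_transition[OF p q(1) x q(2) this u v] show ?thesis by (simp add: eq)
  next
    assume "V p \<subseteq> chart_inv (c q) ` ball (snd (c q) q) (R q)"
    from bilc_transition[OF q(1) p q(2) x this u v] show ?thesis by (simp add: eq)
  qed
qed

lemma hat_tangent:
  assumes p: "p \<in> points M" and x: "x \<in> V p \<times> V p"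
  shows "from_coords X (hat p) x a \<in> tangent_space X x" "from_coords X (hat p) x a (hat p) = a"
proof -
  note h = hat_charts_at[OF p x]
  show "from_coords X (hat p) x a \<in> tangent_space X x"
    by (rule from_coords_tangent[OF manifold_X atlas_holomorphic_charts[OF manifold_X charts_atD(3)[OF manifold_X h]]
        charts_atD(2)[OF manifold_X h]])
  show "from_coords X (hat p) x a (hat p) = a" by (rule from_coords_self[OF manifold_X h])
qed

lemma form_coords_\<Omega>:
  assumes p: "p \<in> points M" and A: "A \<in> cdom (ball (snd (c p) p) (s p))"
  shows "form_coords X \<Omega> (hat p) A a b = bilc (F p) A a b"
proof -
  define x where "x = chart_inv (hat p) A"
  have "A \<in> snd (hat p) ` fst (hat p)" using A hat_chart(2)[OF p] by simp
  from chart_inv_mem[OF this] have x: "x \<in> V p \<times> V p" "snd (hat p) x = A"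
    by (simp_all add: x_def fst_hat)
  show ?thesis
    unfolding form_coords_def Let_def x_def[symmetric]
    using \<Omega>_eq[OF p x(1) hat_tangent(1)[OF p x(1)] hat_tangent(1)[OF p x(1)]]
    by (simp add: hat_tangent(2)[OF p x(1)] x(2))
qed

lemma cdom_s_R: "p \<in> points M \<Longrightarrow> A \<in> cdom (ball (snd (c p) p) (s p)) \<Longrightarrow> A \<in> cdom (ball (snd (c p) p) (R p))"
  using s_sub(1) unfolding cdom_def by blast

lemma symplectic_\<Omega>: "holomorphic_symplectic X \<Omega>"
  unfolding holomorphic_symplectic_def
proof (intro conjI)
  show "alternating_form X \<Omega>"
    unfolding alternating_form_def
  proof (intro ballI)
    fix A d assume d: "d \<in> atlas X" and A: "A \<in> snd d ` fst d"
    obtain p where p: "p \<in> points M" and dp: "d = hat p" using d unfolding atlas_X by (rule imageE)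
    have A': "A \<in> cdom (ball (snd (c p) p) (s p))" using A hat_chart(2)[OF p] dp by simp
    have eq: "form_coords X \<Omega> (hat p) A = bilc (F p) A"
      by (intro ext form_coords_\<Omega>[OF p A'])
    show "bilinear (form_coords X \<Omega> d A) \<and> (\<forall>a. form_coords X \<Omega> d A a a = 0)"
      unfolding dp eq using bilinear_bilc local_kaehler.bilc_alt[OF kaehler_F[OF p] cdom_s_R[OF p A']] by simp
  qed
  show "\<forall>x\<in>points X. \<forall>u\<in>tangent_space X x. \<forall>v\<in>tangent_space X x. \<Omega> x (cplx_struct u) v = \<i> * \<Omega> x u v"
  proof (intro ballI)
    fix x u v assume "x \<in> points X"
    then have x: "x \<in> W" by (simp add: points_X)
    obtain p where "\<And>u v. \<Omega> x u v = bilc (F p) (snd (hat p) x) (u (hat p)) (v (hat p))"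
      using \<Omega>_some[OF x] by metis
    then show "\<Omega> x (cplx_struct u) v = \<i> * \<Omega> x u v"
      by (simp add: cplx_struct_def bilc_simps)
  qed
  show "\<forall>d\<in>atlas X. \<forall>a b. holomorphic_fun (snd d ` fst d) (\<lambda>z. form_coords X \<Omega> d z a b)"
  proof (intro ballI allI)
    fix d a b assume d: "d \<in> atlas X"
    obtain p where p: "p \<in> points M" and dp: "d = hat p" using d unfolding atlas_X by (rule imageE)
    have sub: "cdom (ball (snd (c p) p) (s p)) \<subseteq> cdom (ball (snd (c p) p) (R p))"
      using cdom_s_R[OF p] by blast
    show "holomorphic_fun (snd d ` fst d) (\<lambda>z. form_coords X \<Omega> d z a b)"
      unfolding dp hat_chart(2)[OF p]
      by (rule holomorphic_fun_cong[OF holomorphic_fun_subset[OF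
            local_form.bilc_hol[OF local_kaehler.axioms(1)[OF kaehler_F[OF p]]] sub] open_cdom[OF open_ball]
            form_coords_\<Omega>[OF p]])
  qed
  show "closed_form X \<Omega>"
    unfolding closed_form_def
  proof (intro ballI allI)
    fix d z and a b e :: "complex ^ ('n + 'n)"
    assume d: "d \<in> atlas X" and z: "z \<in> snd d ` fst d"
    obtain p where p: "p \<in> points M" and dp: "d = hat p" using d unfolding atlas_X by (rule imageE)
    have z': "z \<in> cdom (ball (snd (c p) p) (s p))" using z hat_chart(2)[OF p] dp by simp
    have eq: "frechet_derivative (\<lambda>y. form_coords X \<Omega> (hat p) y a b) (at z)
        = frechet_derivative (\<lambda>y. bilc (F p) y a b) (at z)" for a b
      by (rule frechet_derivative_cong_open[OF open_cdom[OF open_ball] z' form_coords_\<Omega>[OF p]])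
    show "frechet_derivative (\<lambda>y. form_coords X \<Omega> d y b e) (at z) a -
         frechet_derivative (\<lambda>y. form_coords X \<Omega> d y a e) (at z) b +
         frechet_derivative (\<lambda>y. form_coords X \<Omega> d y a b) (at z) e = 0"
      unfolding dp eq by (rule local_kaehler.bilc_closed[OF kaehler_F[OF p] cdom_s_R[OF p z']])
  qed
  show "\<forall>x\<in>points X. \<forall>u\<in>tangent_space X x. u \<noteq> zero_vector \<longrightarrow> (\<exists>v\<in>tangent_space X x. \<Omega> x u v \<noteq> 0)"
  proof (intro ballI impI)
    fix x u assume "x \<in> points X" and u: "u \<in> tangent_space X x" "u \<noteq> zero_vector"
    then have "x \<in> W" by (simp add: points_X)
    then obtain p where p: "p \<in> points M" "x \<in> V p \<times> V p" by (rule WE)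
    \<comment> \<open>Nondegeneracy is known for coordinate vectors. A tangent vector is determined
      by its coordinates in one chart, so these do not vanish.\<close>
    have "u (hat p) \<noteq> 0"
    proof
      assume "u (hat p) = 0"
      moreover have "from_coords X (hat p) x 0 = zero_vector"
      proof -
        have "zero_vector \<in> tangent_space X x"
          unfolding tangent_space_def
        proof (intro CollectI conjI ballI allI impI)
          fix d e assume d: "d \<in> charts_at X x" and e: "e \<in> charts_at X x"
          note de = charts_atD[OF manifold_X d] charts_atD[OF manifold_X e]
          show "0 = frechet_derivative (local_rep d e id) (at (snd d x)) 0"
            using compatible_transition(2)[OF de(1,5) atlas_compatible[OF manifold_X de(3,7)] de(2,6), of 0 0] by simp
        qed simp
        from from_coords_tangent_vector[OF this hat_charts_at[OF p]] show ?thesis .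
      qed
      ultimately show False
        using from_coords_tangent_vector[OF u(1) hat_charts_at[OF p]] u(2) by simp
    qed
    then obtain Y where Y: "bilc (F p) (snd (hat p) x) (u (hat p)) Y \<noteq> 0"
      using nondegenerate_F[OF p(1) hat_mem_R[OF p]] by metis
    show "\<exists>v\<in>tangent_space X x. \<Omega> x u v \<noteq> 0"
    proof (rule bexI[OF _ hat_tangent(1)[OF p, of Y]])
      show "\<Omega> x u (from_coords X (hat p) x Y) \<noteq> 0"
        unfolding \<Omega>_eq[OF p u(1) hat_tangent(1)[OF p]] hat_tangent(2)[OF p] by (rule Y)
    qed
  qed
qed

end

section \<open>The embedding, the involution and the projection\<close>

lemma translate_chart_holomorphic:
  assumes X: "complex_manifold X" and c: "c \<in> holomorphic_charts X"
  shows "(fst c, \<lambda>x. snd c x + a) \<in> holomorphic_charts X"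
  unfolding holomorphic_charts_def
proof (intro CollectI conjI ballI)
  let ?c = "(fst c, \<lambda>x. snd c x + a)"
  have cc: "is_chart (topol X) c" using c by (simp add: holomorphic_charts_def)
  show ct: "is_chart (topol X) ?c" by (rule translate_chart[OF cc])
  fix d assume d: "d \<in> atlas X"
  then have cd: "compatible c d" and dc: "is_chart (topol X) d"
    using c atlas_is_chart[OF X d] by (simp_all add: holomorphic_charts_def)
  have "holomorphic_vec (local_dom ?c d id) (local_rep ?c d id)"
  proof (rule holomorphic_vec_cong[OF _ open_local_dom[OF ct dc continuous_map_id]])
    show "holomorphic_vec (local_dom ?c d id) (\<lambda>z. local_rep c d id (z + (- a)))"
    proof (rule holomorphic_vec_compose[OF _ holomorphic_vec_translate])
      show "holomorphic_vec (local_dom c d id) (local_rep c d id)" using cd by (simp add: compatible_def)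
      show "z + (- a) \<in> local_dom c d id" if "z \<in> local_dom ?c d id" for z
        using that by (elim local_domE) (simp add: local_dom_memI)
    qed
    fix z assume "z \<in> local_dom ?c d id"
    then obtain p where p: "p \<in> fst c" "z = snd c p + a" by (rule local_domE) simp
    show "local_rep ?c d id z = local_rep c d id (z + (- a))"
      using local_rep_at[OF ct, of p d id] local_rep_at[OF cc p(1), of d id] p by simp
  qed
  moreover have "holomorphic_vec (local_dom d ?c id) (local_rep d ?c id)"
  proof (rule holomorphic_vec_cong[OF _ open_local_dom[OF dc ct continuous_map_id]])
    have sub: "z \<in> local_dom d c id" if "z \<in> local_dom d ?c id" for z
      using that by (elim local_domE) (simp add: local_dom_memI)
    have "holomorphic_vec (local_dom d c id) (local_rep d c id)" using cd by (simp add: compatible_def)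
    from holomorphic_vec_compose[OF holomorphic_vec_translate[of UNIV a] this]
    have "holomorphic_vec (local_dom d c id) (\<lambda>z. local_rep d c id z + a)" by simp
    then show "holomorphic_vec (local_dom d ?c id) (\<lambda>z. local_rep d c id z + a)"
      by (rule holomorphic_vec_subset) (use sub in blast)
  qed (simp add: local_rep_def)
  ultimately show "compatible ?c d" by (simp add: compatible_def)
qed

context complexification_cover
begin

section \<open>The diagonal embedding\<close>

lemma diag_mem: "p \<in> points M \<Longrightarrow> (p, p) \<in> W"
  using V_facts(3) by (auto intro: W_I)

lemma diag_local_dom:
  assumes d: "d \<in> atlas M" and q: "q \<in> points M" and z: "z \<in> local_dom d (hat q) (\<lambda>p. (p, p))"
  shows "z \<in> local_dom d (c q) id" "local_rep d (hat q) (\<lambda>p. (p, p)) z = diagc (local_rep d (c q) id z)"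
proof -
  obtain p where p: "p \<in> fst d" "p \<in> V q" "z = snd d p"
    using z by (rule local_domE) (simp add: fst_hat)
  have "p \<in> fst (c q)" using V_facts(2)[OF q] p(2) by (rule subsetD)
  then show "z \<in> local_dom d (c q) id"
    using p(1) local_dom_memI[of p d id "c q"] by (simp add: p(3))
  show "local_rep d (hat q) (\<lambda>p. (p, p)) z = diagc (local_rep d (c q) id z)"
    by (simp add: local_rep_def snd_hat)
qed

lemma diag_continuous: "continuous_map (topol M) (topol X) (\<lambda>p. (p, p))"
  unfolding topol_X continuous_map_in_subtopology
  using diag_mem by (auto intro!: continuous_map_pairedI continuous_map_id[unfolded id_def])

text \<open>\<open>differential\<close> works with an arbitrarily chosen source chart
  \<open>d\<close>; the transformation rule for \<open>u\<close> replaces it by \<open>c q\<close>,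
  in which the diagonal map is \<open>diagc\<close>.\<close>

lemma diag_differential:
  assumes u: "u \<in> tangent_space M p" and p: "p \<in> points M" and q: "q \<in> points M" "p \<in> V q"
  shows "differential M X (\<lambda>p. (p, p)) p u (hat q) = diagc (u (c q))"
proof -
  define d where "d = (SOME d. d \<in> charts_at M p)"
  have d: "d \<in> charts_at M p" unfolding d_def by (rule charts_at_nonempty[OF M p])
  note d1 = charts_atD[OF M d]
  have cq: "c q \<in> charts_at M p" by (rule V_charts_at[OF q])
  have z: "snd d p \<in> local_dom d (hat q) (\<lambda>p. (p, p))"
    using d1(2) q(2) by (simp add: local_dom_memI fst_hat)
  have "((\<lambda>z. diagc (local_rep d (c q) id z)) has_derivative
      (\<lambda>a. diagc (frechet_derivative (local_rep d (c q) id) (at (snd d p)) a))) (at (snd d p))"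
    by (rule bounded_linear.has_derivative[OF bounded_linear_complexified(4)
          compatible_transition(1)[OF d1(1) c_facts(1)[OF q(1)] atlas_compatible[OF M d1(3) c_facts(3)[OF q(1)]] d1(2)
            charts_atD(2)[OF M cq]]])
  from has_derivative_transform_within_open[OF this
      open_local_dom[OF d1(1) hat_chart(1)[OF q(1)] diag_continuous] z diag_local_dom(2)[OF d1(3) q(1), symmetric]]
  have "frechet_derivative (local_rep d (hat q) (\<lambda>p. (p, p))) (at (snd d p))
      = (\<lambda>a. diagc (frechet_derivative (local_rep d (c q) id) (at (snd d p)) a))"
    by (rule frechet_derivative_eqI)
  then show ?thesis
    using hat_charts_at[OF q(1), of "(p, p)"] q(2)
    by (simp add: differential_def Let_def d_def[symmetric] tangent_transition[OF u d cq])
qed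

lemma diag_embedding: "smooth_embedding M X (\<lambda>p. (p, p))"
  unfolding smooth_embedding_def smooth_map_def
proof (intro conjI diag_continuous ballI)
  fix d e assume d: "d \<in> atlas M" and e: "e \<in> atlas X"
  obtain q where q: "q \<in> points M" and eq: "e = hat q" using e unfolding atlas_X by (rule imageE)
  have op: "open (local_dom d (hat q) (\<lambda>p. (p, p)))"
    by (rule open_local_dom[OF atlas_is_chart[OF M d] hat_chart(1)[OF q] diag_continuous])
  have "holomorphic_vec (local_dom d (c q) id) (local_rep d (c q) id)"
    using atlas_compatible[OF M d c_facts(3)[OF q]] by (simp add: compatible_def)
  then have "holomorphic_vec (local_dom d (hat q) (\<lambda>p. (p, p))) (local_rep d (c q) id)"
    by (rule holomorphic_vec_subset) (use diag_local_dom(1)[OF d q] in blast)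
  from smooth_vec_bounded_linear[OF op bounded_linear_complexified(4) holomorphic_vec_smooth[OF op this]]
  show "smooth_vec (local_dom d e (\<lambda>p. (p, p))) (local_rep d e (\<lambda>p. (p, p)))"
    unfolding eq by (rule smooth_vec_cong[OF op]) (rule diag_local_dom(2)[OF d q, symmetric])
next
  \<comment> \<open>The diagonal is the graph of the identity.\<close>
  have "embedding_map (topol M) (prod_topology (topol M) (topol M)) (\<lambda>p. (p, p))"
    unfolding embedding_map_graph by (rule continuous_map_id[unfolded id_def])
  then show "embedding_map (topol M) (topol X) (\<lambda>p. (p, p))"
    unfolding topol_X embedding_map_in_subtopology using diag_mem by auto
next
  fix p assume p: "p \<in> points M"
  note pV = V_facts(3)[OF p]
  show "inj_on (differential M X (\<lambda>p. (p, p)) p) (tangent_space M p)"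
  proof (rule inj_onI)
    fix u v assume u: "u \<in> tangent_space M p" and v: "v \<in> tangent_space M p"
      and eq: "differential M X (\<lambda>p. (p, p)) p u = differential M X (\<lambda>p. (p, p)) p v"
    have "diagc (u (c p)) = diagc (v (c p))"
      unfolding diag_differential[OF u p p pV, symmetric] diag_differential[OF v p p pV, symmetric] eq ..
    then have "fstc (diagc (u (c p))) = fstc (diagc (v (c p)))" by (rule arg_cong)
    then have "u (c p) = v (c p)" by simp
    then show "u = v"
      by (subst from_coords_tangent_vector[OF u c_at[OF p], symmetric],
          subst from_coords_tangent_vector[OF v c_at[OF p], symmetric]) simp
  qed
qed

lemma diag_pullback: "form_eq M (pullback M X (\<lambda>p. (p, p)) \<Omega>) (\<lambda>p u v. complex_of_real (\<omega> p u v))"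
  unfolding form_eq_def pullback_def
proof (intro ballI)
  fix p u v assume p: "p \<in> points M" and u: "u \<in> tangent_space M p" and v: "v \<in> tangent_space M p"
  obtain q where q: "q \<in> points M" "(p, p) \<in> V q \<times> V q"
    and eq: "\<And>u v. \<Omega> (p, p) u v = bilc (F q) (snd (hat q) (p, p)) (u (hat q)) (v (hat q))"
    by (fact \<Omega>_some[OF diag_mem[OF p]])
  have pV: "p \<in> V q" using q(2) by simp
  have cq: "c q \<in> charts_at M p" by (rule V_charts_at[OF q(1) pV])
  have "snd (c q) p \<in> ball (snd (c q) q) (R q)"
    using hat_mem_R[OF q] by (simp add: snd_hat)
  then show "\<Omega> (p, p) (differential M X (\<lambda>p. (p, p)) p u) (differential M X (\<lambda>p. (p, p)) p v)
      = complex_of_real (\<omega> p u v)"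
    unfolding eq diag_differential[OF u p q(1) pV] diag_differential[OF v p q(1) pV] snd_hat fst_conv snd_conv
    using local_form.bilc_diag[OF local_kaehler.axioms(1)[OF kaehler_F[OF q(1)]]]
    by (simp only: form_coords_at[OF cq u v])
qed

section \<open>The exchange of the factors\<close>

lemma swap_mem: "prod.swap x \<in> V p \<times> V p \<longleftrightarrow> x \<in> V p \<times> V p"
  by (cases x) auto

lemma swap_W: "x \<in> W \<Longrightarrow> prod.swap x \<in> W"
  by (elim WE) (rule W_I, assumption, simp add: swap_mem)

text \<open>Every square \<open>V p \<times> V p\<close> is invariant under the swap, so the same
  charts serve at \<open>x\<close> and at its image, and the swap is \<open>conjc\<close> after a
  change of charts.\<close>

lemma swap_local_dom:
  assumes p: "p \<in> points M" and q: "q \<in> points M" and z: "z \<in> local_dom (hat p) (hat q) prod.swap"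
  shows "z \<in> local_dom (hat p) (hat q) id"
    "local_rep (hat p) (hat q) prod.swap z = conjc (local_rep (hat p) (hat q) id z)"
proof -
  obtain x where x: "x \<in> V p \<times> V p" "prod.swap x \<in> V q \<times> V q" "z = snd (hat p) x"
    using z by (rule local_domE) (simp add: fst_hat)
  then show "z \<in> local_dom (hat p) (hat q) id"
    by (auto simp: swap_mem fst_hat intro: local_dom_memI)
  show "local_rep (hat p) (hat q) prod.swap z = conjc (local_rep (hat p) (hat q) id z)"
    by (simp add: local_rep_def snd_hat)
qed

lemma swap_continuous: "continuous_map (topol X) (topol X) prod.swap"
  unfolding topol_X continuous_map_in_subtopology
proof
  have "continuous_map (prod_topology (topol M) (topol M)) (prod_topology (topol M) (topol M)) (\<lambda>x. (snd x, fst x))"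
    by (intro continuous_map_pairedI continuous_map_fst continuous_map_snd)
  then show "continuous_map (subtopology (prod_topology (topol M) (topol M)) W)
      (prod_topology (topol M) (topol M)) prod.swap"
    by (intro continuous_map_from_subtopology) (simp only: prod.swap_def[abs_def])
qed (auto intro: swap_W simp del: swap_simp)

lemma swap_antiholomorphic: "antiholomorphic_map X X prod.swap"
  unfolding antiholomorphic_map_def
proof (intro conjI swap_continuous ballI)
  fix d e assume d: "d \<in> atlas X" and e: "e \<in> atlas X"
  obtain p where p: "p \<in> points M" and dp: "d = hat p" using d unfolding atlas_X by (rule imageE)
  obtain q where q: "q \<in> points M" and eq: "e = hat q" using e unfolding atlas_X by (rule imageE)
  have op: "open (local_dom (hat p) (hat q) prod.swap)"
    by (rule open_local_dom[OF hat_chart(1)[OF p] hat_chart(1)[OF q] swap_continuous])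
  have hol: "holomorphic_vec (local_dom (hat p) (hat q) prod.swap) (local_rep (hat p) (hat q) id)"
    by (rule holomorphic_vec_subset[OF hat_transition_holomorphic[OF p q]]) (use swap_local_dom(1)[OF p q] in blast)
  show "antiholomorphic_vec (local_dom d e prod.swap) (local_rep d e prod.swap)"
    unfolding antiholomorphic_vec_def dp eq
  proof
    fix i :: "'n + 'n"
    \<comment> \<open>Conjugating a component of \<open>conjc A\<close> gives the component of
      \<open>A\<close> at the other copy of the same index, which is holomorphic.\<close>
    define j where "j = (case i of Inl k \<Rightarrow> Inr k | Inr k \<Rightarrow> Inl k)"
    have j: "cnj (conjc A $ i) = A $ j" for A :: "complex ^ ('n + 'n)"
      by (cases i) (simp_all add: conjc_def j_def)
    show "holomorphic_fun (local_dom (hat p) (hat q) prod.swap) (\<lambda>z. cnj (local_rep (hat p) (hat q) prod.swap z $ i))"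
    proof (rule holomorphic_fun_cong[OF _ op])
      show "holomorphic_fun (local_dom (hat p) (hat q) prod.swap) (\<lambda>z. local_rep (hat p) (hat q) id z $ j)"
        using hol by (simp add: holomorphic_vec_def)
    qed (simp add: swap_local_dom(2)[OF p q] j)
  qed
qed

lemma swap_differential:
  assumes u: "u \<in> tangent_space X x" and q: "q \<in> points M" "x \<in> V q \<times> V q"
  shows "differential X X prod.swap x u (hat q) = conjc (u (hat q))"
proof -
  obtain p where p: "p \<in> points M" "x \<in> V p \<times> V p" and some: "(SOME d. d \<in> charts_at X x) = hat p"
    by (fact some_chart_X[OF W_I[OF q]])
  have z: "snd (hat p) x \<in> local_dom (hat p) (hat q) prod.swap"
    by (rule local_dom_memI) (use p q in \<open>simp_all add: fst_hat swap_mem\<close>)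
  have z': "snd (hat p) x \<in> local_dom (hat p) (hat q) id"
    by (rule swap_local_dom(1)[OF p(1) q(1) z])
  have "((\<lambda>z. conjc (local_rep (hat p) (hat q) id z)) has_derivative
      (\<lambda>a. conjc (frechet_derivative (local_rep (hat p) (hat q) id) (at (snd (hat p) x)) a))) (at (snd (hat p) x))"
    by (rule bounded_linear.has_derivative[OF bounded_linear_complexified(3)
          holomorphic_vec_frechet(1)[OF hat_transition_holomorphic[OF p(1) q(1)] z']])
  from has_derivative_transform_within_open[OF this
      open_local_dom[OF hat_chart(1)[OF p(1)] hat_chart(1)[OF q(1)] swap_continuous] z
      swap_local_dom(2)[OF p(1) q(1), symmetric]]
  have "frechet_derivative (local_rep (hat p) (hat q) prod.swap) (at (snd (hat p) x))
      = (\<lambda>a. conjc (frechet_derivative (local_rep (hat p) (hat q) id) (at (snd (hat p) x)) a))"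
    by (rule frechet_derivative_eqI)
  moreover have "hat q \<in> charts_at X (prod.swap x)"
    by (rule hat_charts_at[OF q(1)]) (use q(2) in \<open>simp add: swap_mem\<close>)
  ultimately show ?thesis
    by (simp add: differential_def Let_def some tangent_transition[OF u hat_charts_at[OF p] hat_charts_at[OF q]])
qed

lemma swap_pullback: "form_eq X (pullback X X prod.swap \<Omega>) (\<lambda>x u v. cnj (\<Omega> x u v))"
  unfolding form_eq_def pullback_def points_X
proof (intro ballI)
  fix x u v assume x: "x \<in> W" and u: "u \<in> tangent_space X x" and v: "v \<in> tangent_space X x"
  \<comment> \<open>The representative is picked at the image point; its square contains
    \<open>x\<close> as well, so both sides can be read in one chart and compared by
    \<open>bilc_reality\<close>.\<close>
  obtain q where q: "q \<in> points M" "prod.swap x \<in> V q \<times> V q"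
    and eq: "\<And>u v. \<Omega> (prod.swap x) u v = bilc (F q) (snd (hat q) (prod.swap x)) (u (hat q)) (v (hat q))"
    by (fact \<Omega>_some[OF swap_W[OF x]])
  have xq: "x \<in> V q \<times> V q" using q(2) by (simp add: swap_mem)
  have "snd (hat q) (prod.swap x) = conjc (snd (hat q) x)"
    by (simp add: snd_hat)
  then show "\<Omega> (prod.swap x) (differential X X prod.swap x u) (differential X X prod.swap x v) = cnj (\<Omega> x u v)"
    unfolding eq swap_differential[OF u q(1) xq] swap_differential[OF v q(1) xq] \<Omega>_eq[OF q(1) xq u v]
    by (simp add: local_form.bilc_reality[OF local_kaehler.axioms(1)[OF kaehler_F[OF q(1)]] hat_mem_R[OF q(1) xq]])
qed

lemma swap_fixed_points: "{x \<in> points X. prod.swap x = x} = (\<lambda>p. (p, p)) ` points M"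
proof (intro equalityI subsetI)
  fix x assume "x \<in> {x \<in> points X. prod.swap x = x}"
  then have x: "x \<in> W" "prod.swap x = x" by (simp_all add: points_X)
  have "snd x = fst x"
    using arg_cong[OF x(2), of fst] by (simp only: fst_swap)
  moreover have "fst x \<in> points M"
    using subsetD[OF W_sub x(1)] by (simp add: mem_Times_iff)
  ultimately show "x \<in> (\<lambda>p. (p, p)) ` points M"
    by (intro image_eqI[of _ _ "fst x"] prod_eqI) simp_all
qed (auto simp: points_X diag_mem)

section \<open>The projection to the first factor\<close>

lemma fst_continuous: "continuous_map (topol X) (topol M) fst"
  unfolding topol_X by (intro continuous_map_from_subtopology continuous_map_fst)

lemma fst_local_dom:
  assumes p: "p \<in> points M" and z: "z \<in> local_dom (hat p) d fst"
  shows "fstc z \<in> local_dom (c p) d id" "local_rep (hat p) d fst z = local_rep (c p) d id (fstc z)"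
proof -
  obtain x where x: "x \<in> V p \<times> V p" "fst x \<in> fst d" "z = snd (hat p) x"
    using z by (rule local_domE) (simp add: fst_hat)
  have f: "fst x \<in> fst (c p)" using x(1) V_facts(2)[OF p] by auto
  then show "fstc z \<in> local_dom (c p) d id"
    using x(2) by (simp add: x(3) snd_hat local_dom_memI)
  show "local_rep (hat p) d fst z = local_rep (c p) d id (fstc z)"
    using local_rep_at[OF hat_chart(1)[OF p], of x d fst] x(1) local_rep_at[OF c_facts(1)[OF p] f, of d id]
    by (simp add: x(3) snd_hat fst_hat)
qed

lemma fst_local_holomorphic:
  assumes p: "p \<in> points M" and d: "d \<in> atlas M"
  shows "holomorphic_vec (local_dom (hat p) d fst) (local_rep (hat p) d fst)"
proof (rule holomorphic_vec_cong[OF _ open_local_dom[OF hat_chart(1)[OF p] atlas_is_chart[OF M d] fst_continuous]])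
  have "holomorphic_vec (local_dom (c p) d id) (local_rep (c p) d id)"
    using atlas_compatible[OF M c_facts(3)[OF p] d] by (simp add: compatible_def)
  then show "holomorphic_vec (local_dom (hat p) d fst) (\<lambda>z. local_rep (c p) d id (fstc z))"
    by (rule holomorphic_vec_compose[OF _ holomorphic_vec_fstc]) (rule fst_local_dom(1)[OF p])
qed (rule fst_local_dom(2)[OF p])

lemma fst_holomorphic: "holomorphic_map X M fst"
  unfolding holomorphic_map_def
proof (intro conjI fst_continuous ballI)
  fix d e assume d: "d \<in> atlas X" and e: "e \<in> atlas M"
  obtain p where "p \<in> points M" "d = hat p" using d unfolding atlas_X by (rule imageE)
  then show "holomorphic_vec (local_dom d e fst) (local_rep d e fst)"
    using fst_local_holomorphic e by simp
qed

text \<open>The chart comes with the conclusion because it is the one that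
  \<open>differential\<close> happens to choose. In it the projection is \<open>fstc\<close>, and
  \<open>from_coords\<close> takes care of the charts of \<open>M\<close>.\<close>

lemma fst_differential:
  assumes x: "x \<in> W"
  obtains p where "p \<in> points M" "x \<in> V p \<times> V p"
    "\<And>u. differential X M fst x u = from_coords M (c p) (fst x) (fstc (u (hat p)))"
proof -
  obtain p where p: "p \<in> points M" "x \<in> V p \<times> V p" and some: "(SOME d. d \<in> charts_at X x) = hat p"
    by (fact some_chart_X[OF x])
  have fx: "fst x \<in> V p" using p(2) by auto
  have cp: "c p \<in> charts_at M (fst x)" by (rule V_charts_at[OF p(1) fx])
  have "frechet_derivative (local_rep (hat p) d fst) (at (snd (hat p) x)) a
      = frechet_derivative (local_rep (c p) d id) (at (snd (c p) (fst x))) (fstc a)"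
    if d: "d \<in> charts_at M (fst x)" for d a
  proof -
    note d1 = charts_atD[OF M d]
    have z: "snd (hat p) x \<in> local_dom (hat p) d fst"
      using p(2) d1(2) by (simp add: local_dom_memI fst_hat)
    have f: "fstc (snd (hat p) x) = snd (c p) (fst x)" by (simp add: snd_hat)
    have T: "(local_rep (c p) d id has_derivative frechet_derivative (local_rep (c p) d id) (at (snd (c p) (fst x))))
        (at (fstc (snd (hat p) x)))"
      unfolding f by (rule compatible_transition(1)[OF c_facts(1)[OF p(1)] d1(1)
            atlas_compatible[OF M c_facts(3)[OF p(1)] d1(3)] charts_atD(2)[OF M cp] d1(2)])
    have "((\<lambda>z. local_rep (c p) d id (fstc z)) has_derivative
        (\<lambda>a. frechet_derivative (local_rep (c p) d id) (at (snd (c p) (fst x))) (fstc a))) (at (snd (hat p) x))"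
      by (rule has_derivative_compose[OF bounded_linear_imp_has_derivative[OF bounded_linear_complexified(1)] T])
    from has_derivative_transform_within_open[OF this
        open_local_dom[OF hat_chart(1)[OF p(1)] d1(1) fst_continuous] z fst_local_dom(2)[OF p(1), symmetric]]
    show ?thesis by (simp add: frechet_derivative_eqI)
  qed
  then have "differential X M fst x u = from_coords M (c p) (fst x) (fstc (u (hat p)))" for u
    by (auto simp: differential_def Let_def some from_coords_def fun_eq_iff)
  with p show ?thesis by (rule that)
qed

lemma fst_submersion: "submersion X M fst"
  unfolding submersion_def smooth_map_def
proof (intro conjI fst_continuous ballI)
  fix d e assume d: "d \<in> atlas X" and e: "e \<in> atlas M"
  obtain p where p: "p \<in> points M" and dp: "d = hat p" using d unfolding atlas_X by (rule imageE)
  show "smooth_vec (local_dom d e fst) (local_rep d e fst)"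
    unfolding dp by (rule holomorphic_vec_smooth[OF open_local_dom[OF hat_chart(1)[OF p] atlas_is_chart[OF M e] fst_continuous]
          fst_local_holomorphic[OF p e]])
next
  fix x assume "x \<in> points X"
  then have x: "x \<in> W" by (simp add: points_X)
  obtain p where p: "p \<in> points M" "x \<in> V p \<times> V p"
    and diff: "\<And>u. differential X M fst x u = from_coords M (c p) (fst x) (fstc (u (hat p)))"
    by (fact fst_differential[OF x])
  have "fst x \<in> V p" using p(2) by auto
  then have cp: "c p \<in> charts_at M (fst x)" by (rule V_charts_at[OF p(1)])
  show "differential X M fst x ` tangent_space X x = tangent_space M (fst x)"
  proof (intro equalityI subsetI)
    fix v assume "v \<in> differential X M fst x ` tangent_space X x"
    then show "v \<in> tangent_space M (fst x)"
      using from_coords_tangent[OF M atlas_holomorphic_charts[OF M charts_atD(3)[OF M cp]] charts_atD(2)[OF M cp]]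
      by (auto simp: diff)
  next
    fix v assume v: "v \<in> tangent_space M (fst x)"
    \<comment> \<open>The lift of \<open>v\<close> that is tangent to the first factor.\<close>
    let ?u = "from_coords X (hat p) x (pairc (v (c p)) 0)"
    have "differential X M fst x ?u = v"
      by (simp add: diff hat_tangent(2)[OF p] from_coords_tangent_vector[OF v cp])
    then show "v \<in> differential X M fst x ` tangent_space X x"
      using hat_tangent(1)[OF p] by (metis imageI)
  qed
qed

section \<open>The fibres as Lagrangian submanifolds\<close>

lemma fibre_slice_chart:
  assumes q: "q \<in> points M" and x: "x \<in> V q \<times> V q"
  shows "slice_chart X {y \<in> points X. fst y = fst x} x
    (fst (hat q), \<lambda>y. snd (hat q) y + pairc (- snd (c q) (fst x)) 0) (range Inr)"
  unfolding slice_chart_def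
proof (intro conjI)
  let ?a = "pairc (- snd (c q) (fst x)) 0 :: complex ^ ('n + 'n)"
  let ?L = "{y \<in> points X. fst y = fst x}"
  have "hat q \<in> holomorphic_charts X"
    by (rule atlas_holomorphic_charts[OF manifold_X]) (use q in \<open>simp add: atlas_X\<close>)
  then show "(fst (hat q), \<lambda>y. snd (hat q) y + ?a) \<in> holomorphic_charts X"
    by (rule translate_chart_holomorphic[OF manifold_X])
  show "x \<in> fst (fst (hat q), \<lambda>y. snd (hat q) y + ?a)" using x by (simp add: fst_hat)
  \<comment> \<open>After the translation the vanishing of the \<open>Inl\<close> coordinates says
    that \<open>fst y\<close> and \<open>fst x\<close> have the same coordinates;
    \<open>snd (c q)\<close> is injective, so they are the same point.\<close>
  have iff: "y \<in> ?L \<longleftrightarrow> snd (hat q) y + ?a \<in> coord_subspace (range Inr)" if y: "y \<in> V q \<times> V q" for y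
  proof -
    have "snd (hat q) y + ?a \<in> coord_subspace (range Inr) \<longleftrightarrow> (\<forall>j. (snd (hat q) y + ?a) $ Inl j = 0)"
      unfolding coord_subspace_def mem_Collect_eq
    proof (intro iffI allI impI)
      fix i assume l: "\<forall>j. (snd (hat q) y + ?a) $ Inl j = 0" and i: "i \<notin> range (Inr :: 'n \<Rightarrow> 'n + 'n)"
      show "(snd (hat q) y + ?a) $ i = 0" using i l by (cases i) auto
    qed (auto simp del: vector_add_component)
    also have "\<dots> \<longleftrightarrow> snd (c q) (fst y) = snd (c q) (fst x)"
      by (simp add: snd_hat vec_eq_iff)
    also have "\<dots> \<longleftrightarrow> fst y = fst x"
    proof (rule inj_on_eq_iff[OF chart_inj[OF c_facts(1)[OF q]]])
      show "fst y \<in> fst (c q)" "fst x \<in> fst (c q)" using x y V_facts(2)[OF q] by auto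
    qed
    finally show ?thesis using W_I[OF q y] by (simp add: points_X)
  qed
  show "snd (fst (hat q), \<lambda>y. snd (hat q) y + ?a) ` (fst (fst (hat q), \<lambda>y. snd (hat q) y + ?a) \<inter> ?L)
    = snd (fst (hat q), \<lambda>y. snd (hat q) y + ?a) ` fst (fst (hat q), \<lambda>y. snd (hat q) y + ?a) \<inter> coord_subspace (range Inr)"
    unfolding fst_conv snd_conv fst_hat using iff by blast
qed

text \<open>Differentiate \<open>fst\<close>, which is constant on the fibre, along the straight line through the
  point in the slice.\<close>

lemma fibre_tangent:
  assumes sl: "slice_chart X {y \<in> points X. fst y = m} x d S" and a: "a \<in> coord_subspace S"
    and xm: "x \<in> points X" "fst x = m" and q: "q \<in> points M" "x \<in> V q \<times> V q"
  shows "fstc (from_coords X d x a (hat q)) = 0"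
proof -
  let ?L = "{y \<in> points X. fst y = m}"
  let ?T = "local_rep d (hat q) id"
  have d: "is_chart (topol X) d" "compatible d (hat q)" "x \<in> fst d"
    and im: "snd d ` (fst d \<inter> ?L) = snd d ` fst d \<inter> coord_subspace S"
    using sl q(1) by (simp_all add: slice_chart_def holomorphic_charts_def atlas_X)
  have xS: "snd d x \<in> coord_subspace S"
  proof -
    have "snd d x \<in> snd d ` (fst d \<inter> ?L)" using d(3) xm by (intro imageI) simp
    then show ?thesis unfolding im by simp
  qed
  have xh: "x \<in> fst (hat q)" using q(2) by (simp add: fst_hat)
  \<comment> \<open>\<open>submanifold_tangent\<close> admits all slice charts, so \<open>d\<close>
    is unrelated to the product structure. The slice property alone has to show that the line stays
    in the fibre as long as it remains in the domain of the transition.\<close>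
  define \<gamma> where "\<gamma> r = snd d x + r *\<^sub>R a" for r :: real
  have \<gamma>S: "\<gamma> r \<in> coord_subspace S" for r
    using xS a by (simp add: \<gamma>_def coord_subspace_def)
  have \<gamma>': "(\<gamma> has_derivative (\<lambda>r. r *\<^sub>R a)) (at 0)"
    unfolding \<gamma>_def by (auto intro!: derivative_eq_intros)
  define O' where "O' = {r. \<gamma> r \<in> local_dom d (hat q) id}"
  have O': "open O'"
  proof -
    have "continuous_on UNIV \<gamma>" unfolding \<gamma>_def by (intro continuous_intros)
    then have "open (\<gamma> -` local_dom d (hat q) id)"
      by (rule open_vimage[OF open_local_dom[OF d(1) hat_chart(1)[OF q(1)] continuous_map_id]])
    then show ?thesis by (simp add: O'_def vimage_def)
  qed
  have 0: "0 \<in> O'"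
    using d(3) xh by (simp add: O'_def \<gamma>_def local_dom_memI)
  have const: "fstc (?T (\<gamma> r)) = snd (c q) m" if r: "r \<in> O'" for r
  proof -
    obtain y where y: "y \<in> fst d" "y \<in> fst (hat q)" "\<gamma> r = snd d y"
      using r unfolding O'_def mem_Collect_eq by (rule local_domE) simp
    have "\<gamma> r \<in> snd d ` (fst d \<inter> ?L)"
      unfolding im using \<gamma>S[of r] y(1) by (simp add: y(3))
    \<comment> \<open>The slice property provides a point of the fibre with coordinates
      \<open>\<gamma> r\<close>; by injectivity of the chart it is the point \<open>y\<close>
      already named.\<close>
    then obtain y' where y': "y' \<in> fst d" "y' \<in> ?L" "\<gamma> r = snd d y'" by (elim imageE IntE)
    have "y' = y" using chart_inj[OF d(1)] y y' by (simp add: inj_on_def)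
    then have "fst y = m" using y'(2) by simp
    then show ?thesis
      using local_rep_at[OF d(1) y(1), of "hat q" id] by (simp add: y(3) snd_hat)
  qed
  have T: "(?T has_derivative frechet_derivative ?T (at (snd d x))) (at (\<gamma> 0))"
    using compatible_transition(1)[OF d(1) hat_chart(1)[OF q(1)] d(2,3) xh] by (simp add: \<gamma>_def)
  have 1: "((\<lambda>r. fstc (?T (\<gamma> r))) has_derivative (\<lambda>r. fstc (frechet_derivative ?T (at (snd d x)) (r *\<^sub>R a)))) (at 0)"
    by (rule bounded_linear.has_derivative[OF bounded_linear_complexified(1) has_derivative_compose[OF \<gamma>' T]])
  have "((\<lambda>r. fstc (?T (\<gamma> r))) has_derivative (\<lambda>r. 0)) (at 0)"
    by (rule has_derivative_transform_within_open[OF has_derivative_const O' 0 const[symmetric]])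
  from fun_cong[OF has_derivative_unique[OF 1 this], of 1]
  have "fstc (frechet_derivative ?T (at (snd d x)) a) = 0" by simp
  then show ?thesis
    using hat_charts_at[OF q] by (simp add: from_coords_def)
qed

lemma fibre_lagrangian:
  "holomorphic_lagrangian X \<Omega> CARD('n) {x \<in> points X. fst x = m}"
  unfolding holomorphic_lagrangian_def complex_submanifold_def
proof (intro conjI ballI)
  let ?L = "{x \<in> points X. fst x = m}"
  show "?L \<subseteq> points X" by blast
  fix x assume "x \<in> ?L"
  then have x: "x \<in> points X" "fst x = m" by simp_all
  have xW: "x \<in> W" using x(1) by (simp add: points_X)
  obtain q where q: "q \<in> points M" "x \<in> V q \<times> V q"
    and eq: "\<And>u v. \<Omega> x u v = bilc (F q) (snd (hat q) x) (u (hat q)) (v (hat q))"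
    by (fact \<Omega>_some[OF xW])
  show "\<exists>d S. slice_chart X ?L x d S \<and> card S = CARD('n)"
    using fibre_slice_chart[OF q] card_image[of "Inr :: 'n \<Rightarrow> 'n + 'n" UNIV] unfolding x(2) by (intro exI conjI) simp_all
  fix u v assume "u \<in> submanifold_tangent X ?L x" "v \<in> submanifold_tangent X ?L x"
  then have "fstc (u (hat q)) = 0" "fstc (v (hat q)) = 0"
    using fibre_tangent[OF _ _ x q] by (auto simp: submanifold_tangent_def)
  then show "\<Omega> x u v = 0"
    unfolding eq by (rule local_kaehler.bilc_lagrangian[OF kaehler_F[OF q(1)] hat_mem_R[OF q]])
qed

end

(* The type 'm * 'm only serves as a supply of points for X: up to isomorphism it carries every
   second countable manifold as soon as M is nonempty, since 'm then has at least continuum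
   cardinality. If M is empty, then so is X, because the projection maps X to M. *)

theorem proposition1p1:
  fixes M :: "('m, 'n::finite) manifold" and \<omega> :: "('m, 'n, real) form2"
  assumes "real_analytic_kaehler M \<omega>"
  shows "\<exists>(X :: ('m \<times> 'm, 'n + 'n) manifold) (\<Omega> :: ('m \<times> 'm, 'n + 'n, complex) form2)
          (\<iota> :: 'm \<Rightarrow> 'm \<times> 'm).
     complex_manifold X \<and> holomorphic_symplectic X \<Omega> \<and>
     smooth_embedding M X \<iota> \<and>
     form_eq M (pullback M X \<iota> \<Omega>) (\<lambda>p u v. complex_of_real (\<omega> p u v)) \<and>
     (\<exists>\<tau> :: 'm \<times> 'm \<Rightarrow> 'm \<times> 'm.
        antiholomorphic_map X X \<tau> \<and> (\<forall>x\<in>points X. \<tau> (\<tau> x) = x) \<and>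
        {x \<in> points X. \<tau> x = x} = \<iota> ` points M \<and>
        form_eq X (pullback X X \<tau> \<Omega>) (\<lambda>x u v. cnj (\<Omega> x u v))) \<and>
     (\<exists>\<pi> :: 'm \<times> 'm \<Rightarrow> 'm.
        holomorphic_map X M \<pi> \<and> submersion X M \<pi> \<and> (\<forall>p\<in>points M. \<pi> (\<iota> p) = p) \<and>
        (\<forall>m\<in>points M. holomorphic_lagrangian X \<Omega> CARD('n) {x \<in> points X. \<pi> x = m}))"
proof -
  interpret kaehler_manifold M \<omega>
    by unfold_locales (rule assms)
  obtain c s R F where cover:
    "\<And>p. p \<in> points M \<Longrightarrow> c p \<in> charts_at M p"
    "\<And>p. p \<in> points M \<Longrightarrow> 0 < s p \<and> s p \<le> (R p :: real)"
    "\<And>p. p \<in> points M \<Longrightarrow> ball (snd (c p) p) (R p) \<subseteq> snd (c p) ` fst (c p)"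
    "\<And>p. p \<in> points M \<Longrightarrow> local_kaehler (ball (snd (c p) p) (R p)) (form_coords M \<omega> (c p)) (F p)"
    "\<And>p A X. p \<in> points M \<Longrightarrow> A \<in> cdom (ball (snd (c p) p) (R p)) \<Longrightarrow> (\<And>Y. bilc (F p) A X Y = 0) \<Longrightarrow> X = 0"
    "\<And>p q. p \<in> points M \<Longrightarrow> q \<in> points M \<Longrightarrow>
      chart_inv (c p) ` ball (snd (c p) p) (s p) \<inter> chart_inv (c q) ` ball (snd (c q) q) (s q) \<noteq> {} \<Longrightarrow>
      chart_inv (c q) ` ball (snd (c q) q) (s q) \<subseteq> chart_inv (c p) ` ball (snd (c p) p) (R p) \<or>
      chart_inv (c p) ` ball (snd (c p) p) (s p) \<subseteq> chart_inv (c q) ` ball (snd (c q) q) (R q)"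
    by (fact complexification_cover_exists)
  interpret complexification_cover M \<omega> c s R F
    by (intro complexification_cover.intro kaehler_manifold_axioms complexification_cover_axioms.intro)
      (fact cover)+
  have "\<forall>x\<in>points X. prod.swap (prod.swap x) = x"
    by simp
  then have "\<exists>\<tau> :: 'm \<times> 'm \<Rightarrow> 'm \<times> 'm. antiholomorphic_map X X \<tau> \<and> (\<forall>x\<in>points X. \<tau> (\<tau> x) = x) \<and>
      {x \<in> points X. \<tau> x = x} = (\<lambda>p. (p, p)) ` points M \<and>
      form_eq X (pullback X X \<tau> \<Omega>) (\<lambda>x u v. cnj (\<Omega> x u v))"
    using swap_antiholomorphic swap_fixed_points swap_pullback by (intro exI[of _ prod.swap] conjI)
  moreover have "\<exists>\<pi> :: 'm \<times> 'm \<Rightarrow> 'm. holomorphic_map X M \<pi> \<and> submersion X M \<pi> \<and>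
      (\<forall>p\<in>points M. \<pi> (p, p) = p) \<and>
      (\<forall>m\<in>points M. holomorphic_lagrangian X \<Omega> CARD('n) {x \<in> points X. \<pi> x = m})"
    using fst_holomorphic fst_submersion fibre_lagrangian by (intro exI[of _ fst] conjI ballI) simp_all
  ultimately show ?thesis
    using manifold_X symplectic_\<Omega> diag_embedding diag_pullback
    by (intro exI[of _ X] exI[of _ \<Omega>] exI[of _ "\<lambda>p. (p, p)"] conjI)
qed

end
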